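(* Let $k$ be an algebraically closed field, $q\in k^*$, let $H$ be the Hecke algebra over $k$ with parameter $q$ of the extended affine Weyl group $W=W_0\ltimes P$ of an irreducible root system $R$, and let $T$ be a maximal torus, with character group identified with $P$, of the simply connected simple algebraic group $G$ over $k$ with root system $R$. Let $t\in T$, and let $H_t$, $C$, $C'$, $\theta_\rho$ be as defined in the context. Then: (a) If the element $C\theta_\rho C'$ of $H_t$ is nonzero, then the left $H$-module $L_t=H_tC\theta_\rho C'$ it generates is irreducible; moreover, $CL_t\neq 0$ in this case. (b) If the element $C'\theta_\rho C$ of $H_t$ is nonzero, then the left $H$-module $L'_t=H_tC'\theta_\rho C$ it generates is irreducible; moreover, $C'L'_t\neq 0$ in this case.
   Context: $R$ is an irreducible root system with simple roots $\Delta$, positive roots $R^+$, coroots $\alpha^\vee$, weight lattice $P$ (written multiplicatively) and Weyl group $W_0$. $W=W_0\ltimes P$ contains the affine Weyl group $W_a=W_0\ltimes\mathbb{Z}R$, a Coxeter group with simple reflections $S=\{s_\alpha\mid\alpha\in\Delta\}\cup\{s_0\}$, where $s_0=\beta s_\beta$, $\beta$ the dominant short root. The length function $l$ on $W$ is given, for $w\in W_0$, $x\in P$, by $$l(wx)=\sum_{\alpha\in R^+,\,w(\alpha)\in -R^+}|\langle x,\alpha^\vee\rangle+1|+\sum_{\alpha\in R^+,\,w(\alpha)\in R^+}|\langle x,\alpha^\vee\rangle| .$$ $w_0$ is the longest element of $W_0$. $P^+=\{x\in P\mid l(w_0x)=l(w_0)+l(x)\}$ is the set of dominant weights. $\rho\in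 P$ is the product (in the multiplicative notation of $P$) of all fundamental dominant weights. $k$ is an algebraically closed field, $q\in k^*$, and a square root $q^{1/2}\in k$ is fixed. $H$ is the $k$-algebra with basis $\{T_w\}_{w\in W}$ and multiplication determined by $T_wT_u=T_{wu}$ if $l(wu)=l(w)+l(u)$, and $(T_s-q)(T_s+1)=0$ for $s\in S$. For $w\in W$ put $C_w=q^{-l(w)/2}\sum_{y\le w}P_{y,w}(q)T_y$ and $C'_w=q^{l(w)/2}\sum_{y\le w}(-1)^{l(w)-l(y)}q^{-l(y)}P_{y,w}(q^{-1})T_y$, where $P_{y,w}$ are the Kazhdan–Lusztig polynomials and $\le$ is the Bruhat order. Set $C=C_{w_0}$ and $C'=C'_{w_0}$. Since $P_{y,w_0}=1$ for all $y\in W_0$, this means $C=q^{-l(w_0)/2}\sum_{y\in W_0}T_y$ and $C'=q^{l(w_0)/2}\sum_{y\in W_0}(-1)^{l(w_0)-l(y)}q^{-l(y)}T_y$. For $x\in P$ write $x=yz^{-1}$ with $y,z\in P^+$ and put $\theta_x=q^{-l(y)/2}T_y\,q^{l(z)/2}T_z^{-1}$, which is well defined. One has $\theta_x\theta_y=\theta_{xy}$. $\Theta$ is the commutative subalgebra of $H$ with basis $\theta_x$, $x\in P$. $W_0$ acts on $\Theta$ by $w(\theta_x)=\theta_{w(x)}$, and the center of $H$ is $Z(H)=\Theta^{W_0}$. $G$ is the simply connected simple algebraic group over $k$ with root system $R$, and $T\subset G$ is a maximal torus with $\mathrm{Hom}(T,k^* )$ identified with $P$. For $t\in T$, $\phi_t:\Theta\to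 k$ is the $k$-algebra homomorphism $\theta_x\mapsto x(t)$ ($x\in P$). $\mathcal{Z}_t$ is the two-sided ideal of $H$ generated by all $z-\phi_t(z)$, $z\in Z(H)$, and $H_t=H/\mathcal{Z}_t$, regarded as a left $H$-module by left multiplication. The same notations $C,C',\theta_x$ are used for the images in $H_t$. *)

theory Defs
  imports
    "HOL-Analysis.Analysis"
    "HOL-Computational_Algebra.Polynomial"
    "HOL-Algebra.Algebraic_Closure_Type"
    "HOL-Algebra.QuotRing"
begin

unbundle no fps_syntax

section \<open>Root systems\<close>

definition coroot :: "'v::euclidean_space \<Rightarrow> 'v" where
  "coroot \<alpha> = (2 / (\<alpha> \<bullet> \<alpha>)) *\<^sub>R \<alpha>"

definition reflection :: "'v::euclidean_space \<Rightarrow> 'v \<Rightarrow> 'v" where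
  "reflection \<alpha> x = x - (x \<bullet> coroot \<alpha>) *\<^sub>R \<alpha>"

text \<open>Root systems are reduced and crystallographic, and span the ambient space.\<close>

definition root_system :: "'v::euclidean_space set \<Rightarrow> bool" where
  "root_system R \<longleftrightarrow>
     finite R \<and> 0 \<notin> R \<and> span R = UNIV \<and>
     (\<forall>\<alpha>\<in>R. reflection \<alpha> ` R \<subseteq> R) \<and>
     (\<forall>\<alpha>\<in>R. \<forall>\<gamma>\<in>R. \<gamma> \<bullet> coroot \<alpha> \<in> \<int>) \<and>
     (\<forall>\<alpha>\<in>R. \<forall>c. c *\<^sub>R \<alpha> \<in> R \<longrightarrow> c = 1 \<or> c = -1)"

definition irreducible_root_system :: "'v::euclidean_space set \<Rightarrow> bool" where
  "irreducible_root_system R \<longleftrightarrow>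
     root_system R \<and> R \<noteq> {} \<and>
     (\<nexists>A B. A \<noteq> {} \<and> B \<noteq> {} \<and> A \<union> B = R \<and> (\<forall>a\<in>A. \<forall>b\<in>B. a \<bullet> b = 0))"

definition positive_roots :: "'v::euclidean_space set \<Rightarrow> 'v set \<Rightarrow> 'v set" where
  "positive_roots R \<Delta> = {\<alpha> \<in> R. \<exists>c :: 'v \<Rightarrow> nat. \<alpha> = (\<Sum>\<delta>\<in>\<Delta>. real (c \<delta>) *\<^sub>R \<delta>)}"

definition simple_roots :: "'v::euclidean_space set \<Rightarrow> 'v set \<Rightarrow> bool" where
  "simple_roots R \<Delta> \<longleftrightarrow>
     \<Delta> \<subseteq> R \<and> independent \<Delta> \<and>
     (\<forall>\<alpha>\<in>R. \<alpha> \<in> positive_roots R \<Delta> \<or> - \<alpha> \<in> positive_roots R \<Delta>)"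

text \<open>The weight lattice is written additively here.\<close>

definition weight_lattice :: "'v::euclidean_space set \<Rightarrow> 'v set" where
  "weight_lattice R = {x. \<forall>\<alpha>\<in>R. x \<bullet> coroot \<alpha> \<in> \<int>}"

definition pairing :: "'v::euclidean_space \<Rightarrow> 'v \<Rightarrow> int" where
  "pairing x \<alpha> = \<lfloor>x \<bullet> coroot \<alpha>\<rfloor>"

definition fundamental_weight :: "'v::euclidean_space set \<Rightarrow> 'v \<Rightarrow> 'v" where
  "fundamental_weight \<Delta> \<alpha> = (THE x. \<forall>\<gamma>\<in>\<Delta>. x \<bullet> coroot \<gamma> = (if \<gamma> = \<alpha> then 1 else 0))"

definition rho :: "'v::euclidean_space set \<Rightarrow> 'v" where
  "rho \<Delta> = (\<Sum>\<alpha>\<in>\<Delta>. fundamental_weight \<Delta> \<alpha>)"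

text \<open>If all roots have the same length, every root counts as short.\<close>

definition dominant_short_root :: "'v::euclidean_space set \<Rightarrow> 'v set \<Rightarrow> 'v" where
  "dominant_short_root R \<Delta> =
     (THE \<beta>. \<beta> \<in> R \<and> (\<forall>\<alpha>\<in>R. norm \<beta> \<le> norm \<alpha>) \<and> (\<forall>\<alpha>\<in>\<Delta>. 0 \<le> \<beta> \<bullet> coroot \<alpha>))"


section \<open>The finite and the extended affine Weyl group\<close>

inductive_set weyl_group :: "'v::euclidean_space set \<Rightarrow> ('v \<Rightarrow> 'v) set" for R where
  weyl_id: "id \<in> weyl_group R"
| weyl_reflection: "\<alpha> \<in> R \<Longrightarrow> w \<in> weyl_group R \<Longrightarrow> reflection \<alpha> \<circ> w \<in> weyl_group R"

text \<open>
  The pair \<open>(w, x)\<close> stands for the product \<open>w x\<close> of a finite Weyl group element and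
  a weight, in this order; hence
  \<open>(w x) (u y) = (w u) (u\<^sup>-\<^sup>1(x) y)\<close>.
\<close>

definition affine_weyl_group :: "'v::euclidean_space set \<Rightarrow> (('v \<Rightarrow> 'v) \<times> 'v) monoid" where
  "affine_weyl_group R =
     \<lparr>carrier = weyl_group R \<times> weight_lattice R,
      mult = (\<lambda>(w, x) (u, y). (w \<circ> u, inv_into UNIV u x + y)),
      one = (id, 0)\<rparr>"

definition weyl_length :: "'v::euclidean_space set \<Rightarrow> 'v set \<Rightarrow> ('v \<Rightarrow> 'v) \<times> 'v \<Rightarrow> nat" where
  "weyl_length R \<Delta> = (\<lambda>(w, x).
     (\<Sum>\<alpha> | \<alpha> \<in> positive_roots R \<Delta> \<and> - w \<alpha> \<in> positive_roots R \<Delta>. nat \<bar>pairing x \<alpha> + 1\<bar>) +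
     (\<Sum>\<alpha> | \<alpha> \<in> positive_roots R \<Delta> \<and> w \<alpha> \<in> positive_roots R \<Delta>. nat \<bar>pairing x \<alpha>\<bar>))"

definition simple_reflections ::
    "'v::euclidean_space set \<Rightarrow> 'v set \<Rightarrow> (('v \<Rightarrow> 'v) \<times> 'v) set" where
  "simple_reflections R \<Delta> =
     {(reflection \<alpha>, 0) | \<alpha>. \<alpha> \<in> \<Delta>} \<union>
     {(id, dominant_short_root R \<Delta>) \<otimes>\<^bsub>affine_weyl_group R\<^esub>
        (reflection (dominant_short_root R \<Delta>), 0)}"

definition longest_element :: "'v::euclidean_space set \<Rightarrow> 'v set \<Rightarrow> 'v \<Rightarrow> 'v" where
  "longest_element R \<Delta> =
     (THE w. w \<in> weyl_group R \<and>
        (\<forall>u\<in>weyl_group R. weyl_length R \<Delta> (u, 0) \<le> weyl_length R \<Delta> (w, 0)))"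

definition dominant_weights :: "'v::euclidean_space set \<Rightarrow> 'v set \<Rightarrow> 'v set" where
  "dominant_weights R \<Delta> =
     {x \<in> weight_lattice R.
        weyl_length R \<Delta> (longest_element R \<Delta>, x) =
        weyl_length R \<Delta> (longest_element R \<Delta>, 0) + weyl_length R \<Delta> (id, x)}"


section \<open>The Hecke algebra\<close>

text \<open>
  \<open>H\<close> is carried by the type \<open>'h\<close>, with scalar multiplication \<open>smul\<close> and
  standard basis \<open>T\<close> indexed by the extended affine Weyl group (values of \<open>T\<close>
  off the group are irrelevant). These axioms determine \<open>H\<close> up to unique isomorphism
  preserving the basis.
\<close>

locale affine_hecke_algebra = vector_space smul
  for smul :: "'k::field \<Rightarrow> 'h::ring_1 \<Rightarrow> 'h" +
  fixes R \<Delta> :: "'v::euclidean_space set"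
    and q :: 'k
    and T :: "('v \<Rightarrow> 'v) \<times> 'v \<Rightarrow> 'h"
  assumes scale_mult_left: "smul c a * b = smul c (a * b)"
    and scale_mult_right: "a * smul c b = smul c (a * b)"
    and T_inj: "inj_on T (carrier (affine_weyl_group R))"
    and T_independent: "independent (T ` carrier (affine_weyl_group R))"
    and T_span: "span (T ` carrier (affine_weyl_group R)) = UNIV"
    and T_mult:
      "\<lbrakk>w \<in> carrier (affine_weyl_group R); u \<in> carrier (affine_weyl_group R);
        weyl_length R \<Delta> (w \<otimes>\<^bsub>affine_weyl_group R\<^esub> u) = weyl_length R \<Delta> w + weyl_length R \<Delta> u\<rbrakk>
       \<Longrightarrow> T w * T u = T (w \<otimes>\<^bsub>affine_weyl_group R\<^esub> u)"
    and T_quadratic: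
      "s \<in> simple_reflections R \<Delta> \<Longrightarrow> (T s - smul q 1) * (T s + 1) = 0"

text \<open>
  Below \<open>v\<close> is the chosen square root of \<open>q\<close>. The elements \<open>C\<close> and \<open>C'\<close>
  are the Kazhdan--Lusztig elements of the longest element \<open>w\<^sub>0\<close>, all of whose
  Kazhdan--Lusztig polynomials \<open>P\<^bsub>y,w\<^sub>0\<^esub>\<close> are \<open>1\<close>.
\<close>

definition hecke_C ::
    "('k::field \<Rightarrow> 'h::ring_1 \<Rightarrow> 'h) \<Rightarrow> 'v::euclidean_space set \<Rightarrow> 'v set \<Rightarrow> 'k
     \<Rightarrow> (('v \<Rightarrow> 'v) \<times> 'v \<Rightarrow> 'h) \<Rightarrow> 'h" where
  "hecke_C smul R \<Delta> v T =
     smul (inverse v ^ weyl_length R \<Delta> (longest_element R \<Delta>, 0)) (\<Sum>y\<in>weyl_group R. T (y, 0))"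

definition hecke_C' ::
    "('k::field \<Rightarrow> 'h::ring_1 \<Rightarrow> 'h) \<Rightarrow> 'v::euclidean_space set \<Rightarrow> 'v set \<Rightarrow> 'k \<Rightarrow> 'k
     \<Rightarrow> (('v \<Rightarrow> 'v) \<times> 'v \<Rightarrow> 'h) \<Rightarrow> 'h" where
  "hecke_C' smul R \<Delta> q v T =
     smul (v ^ weyl_length R \<Delta> (longest_element R \<Delta>, 0))
       (\<Sum>y\<in>weyl_group R.
          smul ((-1) ^ (weyl_length R \<Delta> (longest_element R \<Delta>, 0) - weyl_length R \<Delta> (y, 0))
                 * inverse q ^ weyl_length R \<Delta> (y, 0))
            (T (y, 0)))"

definition theta ::
    "('k::field \<Rightarrow> 'h::ring_1 \<Rightarrow> 'h) \<Rightarrow> 'v::euclidean_space set \<Rightarrow> 'v set \<Rightarrow> 'k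
     \<Rightarrow> (('v \<Rightarrow> 'v) \<times> 'v \<Rightarrow> 'h) \<Rightarrow> 'v \<Rightarrow> 'h" where
  "theta smul R \<Delta> v T x =
     (THE h. \<exists>y\<in>dominant_weights R \<Delta>. \<exists>z\<in>dominant_weights R \<Delta>. x = y - z \<and>
        h = smul (inverse v ^ weyl_length R \<Delta> (id, y)) (T (id, y)) *
            smul (v ^ weyl_length R \<Delta> (id, z)) (inv\<^bsub>ring_of_type_algebra\<^esub> T (id, z)))"

text \<open>
  For a homomorphism \<open>\<psi>\<close> from the weight lattice to the multiplicative group of the
  field, \<open>phi\<close> is the linear extension of \<open>\<theta>\<^sub>x \<mapsto> \<psi>(x)\<close> to the span
  \<open>\<Theta>\<close> of all \<open>\<theta>\<^sub>x\<close>; its values off \<open>\<Theta>\<close> are irrelevant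
  (\<open>\<Theta>\<close> contains the centre).
\<close>

definition phi ::
    "('k::field \<Rightarrow> 'h::ring_1 \<Rightarrow> 'h) \<Rightarrow> 'v::euclidean_space set \<Rightarrow> 'v set \<Rightarrow> 'k
     \<Rightarrow> (('v \<Rightarrow> 'v) \<times> 'v \<Rightarrow> 'h) \<Rightarrow> ('v \<Rightarrow> 'k) \<Rightarrow> 'h \<Rightarrow> 'k" where
  "phi smul R \<Delta> v T \<psi> h =
     (let \<theta> = theta smul R \<Delta> v T;
          c = Modules.module.representation smul (\<theta> ` weight_lattice R) h
      in \<Sum>b | c b \<noteq> 0. c b * \<psi> (the_inv_into (weight_lattice R) \<theta> b))"

definition center :: "'h::ring_1 set" where
  "center = {z. \<forall>h. z * h = h * z}"

definition central_ideal ::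
    "('k::field \<Rightarrow> 'h::ring_1 \<Rightarrow> 'h) \<Rightarrow> 'v::euclidean_space set \<Rightarrow> 'v set \<Rightarrow> 'k
     \<Rightarrow> (('v \<Rightarrow> 'v) \<times> 'v \<Rightarrow> 'h) \<Rightarrow> ('v \<Rightarrow> 'k) \<Rightarrow> 'h set" where
  "central_ideal smul R \<Delta> v T \<psi> =
     Idl\<^bsub>ring_of_type_algebra\<^esub> {z - smul (phi smul R \<Delta> v T \<psi> z) 1 | z. z \<in> center}"


section \<open>Quotients of a ring as left modules\<close>

definition image_in_quotient :: "'h::ring_1 set \<Rightarrow> 'h \<Rightarrow> 'h set" where
  "image_in_quotient I h = I +>\<^bsub>ring_of_type_algebra\<^esub> h"

text \<open>The quotient ring by \<open>I\<close>, with the whole ring acting by left multiplication.\<close>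

definition quotient_module :: "'h::ring_1 set \<Rightarrow> ('h, 'h set) module" where
  "quotient_module I =
     (let Q = ring_of_type_algebra Quot I in
      \<lparr>carrier = carrier Q, mult = mult Q, one = one Q, zero = zero Q, add = add Q,
       smult = (\<lambda>h Y. image_in_quotient I h \<otimes>\<^bsub>Q\<^esub> Y)\<rparr>)"

definition generated_left_ideal :: "('a, 'b) ring_scheme \<Rightarrow> 'a \<Rightarrow> 'a set" where
  "generated_left_ideal Q c = {x \<otimes>\<^bsub>Q\<^esub> c | x. x \<in> carrier Q}"

text \<open>
  The library locale \<open>submodule\<close> does not require the ring of scalars to be commutative.
\<close>

definition irreducible_submodule ::
    "('a, 'c) ring_scheme \<Rightarrow> ('a, 'b) module \<Rightarrow> 'b set \<Rightarrow> bool" where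
  "irreducible_submodule A M L \<longleftrightarrow>
     submodule L A M \<and> L \<noteq> {\<zero>\<^bsub>M\<^esub>} \<and>
     (\<forall>N. submodule N A M \<and> N \<subseteq> L \<longrightarrow> N = {\<zero>\<^bsub>M\<^esub>} \<or> N = L)"


section \<open>Linear algebraic groups over an algebraically closed field\<close>

text \<open>
  Algebraic groups are identified with their groups of rational points and realised as Zariski
  closed subgroups of a general linear group.
\<close>

inductive_set polynomial_functions :: "('k::field ^ 'n ^ 'n \<Rightarrow> 'k) set" where
  "(\<lambda>_. c) \<in> polynomial_functions"
| "(\<lambda>A. A $ i $ j) \<in> polynomial_functions"
| "f \<in> polynomial_functions \<Longrightarrow> g \<in> polynomial_functions \<Longrightarrow>
     (\<lambda>A. f A + g A) \<in> polynomial_functions"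
| "f \<in> polynomial_functions \<Longrightarrow> g \<in> polynomial_functions \<Longrightarrow>
     (\<lambda>A. f A * g A) \<in> polynomial_functions"

definition closed_in_GL :: "('k::field ^ 'n ^ 'n) set \<Rightarrow> bool" where
  "closed_in_GL S \<longleftrightarrow>
     (\<exists>F \<subseteq> polynomial_functions. S = {A. invertible A \<and> (\<forall>f\<in>F. f A = 0)})"

definition linear_algebraic_group :: "('k::field ^ 'n ^ 'n) set \<Rightarrow> bool" where
  "linear_algebraic_group G \<longleftrightarrow>
     closed_in_GL G \<and> mat 1 \<in> G \<and>
     (\<forall>A\<in>G. \<forall>B\<in>G. A ** B \<in> G) \<and> (\<forall>A\<in>G. matrix_inv A \<in> G)"

definition zariski_connected :: "('k::field ^ 'n ^ 'n) set \<Rightarrow> bool" where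
  "zariski_connected G \<longleftrightarrow>
     (\<nexists>A B. closed_in_GL A \<and> closed_in_GL B \<and> A \<noteq> {} \<and> B \<noteq> {} \<and> A \<inter> B = {} \<and> A \<union> B = G)"

definition simple_algebraic_group :: "('k::field ^ 'n ^ 'n) set \<Rightarrow> bool" where
  "simple_algebraic_group G \<longleftrightarrow>
     linear_algebraic_group G \<and> zariski_connected G \<and>
     (\<exists>A\<in>G. \<exists>B\<in>G. A ** B \<noteq> B ** A) \<and>
     (\<forall>N. linear_algebraic_group N \<and> zariski_connected N \<and> N \<subseteq> G \<and>
          (\<forall>A\<in>G. \<forall>B\<in>N. A ** B ** matrix_inv A \<in> N) \<longrightarrow> N = {mat 1} \<or> N = G)"

definition regular_on :: "('k::field ^ 'n ^ 'n) set \<Rightarrow> ('k ^ 'n ^ 'n \<Rightarrow> 'k) \<Rightarrow> bool" where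
  "regular_on S f \<longleftrightarrow> (\<exists>p\<in>polynomial_functions. \<exists>m. \<forall>A\<in>S. f A = p A / det A ^ m)"

definition algebraic_group_hom ::
    "('k::field ^ 'n ^ 'n) set \<Rightarrow> ('k ^ 'n ^ 'n) set \<Rightarrow> ('k ^ 'n ^ 'n \<Rightarrow> 'k ^ 'n ^ 'n) \<Rightarrow> bool" where
  "algebraic_group_hom G H f \<longleftrightarrow>
     f ` G \<subseteq> H \<and> (\<forall>A\<in>G. \<forall>B\<in>G. f (A ** B) = f A ** f B) \<and>
     (\<forall>i j. regular_on G (\<lambda>A. f A $ i $ j))"

text \<open>The product of copies of the multiplicative group indexed by \<open>I\<close>.\<close>

definition diagonal_torus :: "'n::finite set \<Rightarrow> ('k::field ^ 'n ^ 'n) set" where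
  "diagonal_torus I =
     {A. (\<forall>i j. i \<noteq> j \<longrightarrow> A $ i $ j = 0) \<and> (\<forall>i. A $ i $ i \<noteq> 0) \<and> (\<forall>i. i \<notin> I \<longrightarrow> A $ i $ i = 1)}"

definition is_torus :: "('k::field ^ 'n ^ 'n) set \<Rightarrow> bool" where
  "is_torus S \<longleftrightarrow>
     linear_algebraic_group S \<and>
     (\<exists>I f g. algebraic_group_hom S (diagonal_torus I) f \<and> algebraic_group_hom (diagonal_torus I) S g \<and>
        (\<forall>A\<in>S. g (f A) = A) \<and> (\<forall>B\<in>diagonal_torus I. f (g B) = B))"

definition maximal_torus :: "('k::field ^ 'n ^ 'n) set \<Rightarrow> ('k ^ 'n ^ 'n) set \<Rightarrow> bool" where
  "maximal_torus G S \<longleftrightarrow>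
     is_torus S \<and> S \<subseteq> G \<and> (\<forall>S'. is_torus S' \<and> S \<subseteq> S' \<and> S' \<subseteq> G \<longrightarrow> S' = S)"

text \<open>Characters are made extensional, so that they can be compared as functions.\<close>

definition characters :: "('k::field ^ 'n ^ 'n) set \<Rightarrow> ('k ^ 'n ^ 'n \<Rightarrow> 'k) set" where
  "characters S =
     {\<psi> \<in> extensional S. regular_on S \<psi> \<and> (\<forall>A\<in>S. \<psi> A \<noteq> 0) \<and>
        (\<forall>A\<in>S. \<forall>B\<in>S. \<psi> (A ** B) = \<psi> A * \<psi> B)}"

text \<open>
  The Lie algebra is the tangent space at the identity: \<open>Y\<close> belongs to it iff for every
  polynomial function \<open>f\<close> vanishing on \<open>G\<close> the polynomial \<open>f(1 + s Y)\<close> in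
  \<open>s\<close> has no linear term. The field is infinite, so this polynomial is determined by its values.
\<close>

definition lie_algebra :: "('k::field ^ 'n ^ 'n) set \<Rightarrow> ('k ^ 'n ^ 'n) set" where
  "lie_algebra G =
     {Y. \<forall>f\<in>polynomial_functions. (\<forall>A\<in>G. f A = 0) \<longrightarrow>
        (\<forall>p. (\<forall>s. f (\<chi> i j. mat 1 $ i $ j + s * Y $ i $ j) = poly p s) \<longrightarrow> Polynomial.coeff p 1 = 0)}"

definition roots_of_group ::
    "('k::field ^ 'n ^ 'n) set \<Rightarrow> ('k ^ 'n ^ 'n) set \<Rightarrow> ('k ^ 'n ^ 'n \<Rightarrow> 'k) set" where
  "roots_of_group G S =
     {a \<in> characters S. (\<exists>A\<in>S. a A \<noteq> 1) \<and>
        (\<exists>Y\<in>lie_algebra G. Y \<noteq> 0 \<and>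
           (\<forall>A\<in>S. A ** Y ** matrix_inv A = (\<chi> i j. a A * Y $ i $ j)))}"

text \<open>
  \<open>G\<close> is simple with root system \<open>R\<close> with respect to the maximal torus \<open>S\<close>, and
  \<open>\<iota>\<close> identifies the character group of \<open>S\<close> with the full weight lattice of \<open>R\<close>,
  which says that \<open>G\<close> is simply connected.
\<close>

definition simply_connected_simple_group ::
    "'v::euclidean_space set \<Rightarrow> ('k::field ^ 'n ^ 'n) set \<Rightarrow> ('k ^ 'n ^ 'n) set
     \<Rightarrow> ('v \<Rightarrow> 'k ^ 'n ^ 'n \<Rightarrow> 'k) \<Rightarrow> bool" where
  "simply_connected_simple_group R G S \<iota> \<longleftrightarrow>
     simple_algebraic_group G \<and> maximal_torus G S \<and>
     bij_betw \<iota> (weight_lattice R) (characters S) \<and>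
     (\<forall>x\<in>weight_lattice R. \<forall>y\<in>weight_lattice R. \<forall>A\<in>S. \<iota> (x + y) A = \<iota> x A * \<iota> y A) \<and>
     \<iota> ` R = roots_of_group G S"

end

theory Submission
  imports Defs "Jordan_Normal_Form.Determinant" "HOL-Library.Poly_Mapping"
begin

text \<open>
  The element \<open>C\<close> is divisible by \<open>1 + T\<^sub>s\<close> on both sides and \<open>C'\<close> by \<open>1 - q\<^sup>-\<^sup>1 T\<^sub>s\<close>, for every finite
  simple reflection \<open>s\<close>, and these two factors annihilate each other. As \<open>T\<^sub>s\<close> commutes with
  \<open>s\<close>-invariant elements of \<open>\<Theta>\<close>, the map \<open>f \<mapsto> C f C'\<close> on \<open>\<Theta>\<close> is antisymmetric under \<open>W\<^sub>0\<close>. It thus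
  factors through the alternating sum, and \<open>C f C' = \<pi>(f) C \<theta>\<^sub>\<rho> C'\<close>, where \<open>\<pi>(f)\<close> is the alternating sum
  of \<open>f\<close> divided by that of \<open>\<theta>\<^sub>\<rho>\<close> (Weyl's character formula) and lies in the centre. The form
  \<open>(f, g) \<mapsto> \<pi>(f g)\<close> is perfect over \<open>\<Theta>\<^sup>W\<close>, because its Gram matrix on Steinberg's basis has determinant
  \<open>\<plusminus>1\<close>; hence every \<open>f\<close> is a combination of fixed elements with coefficients \<open>\<pi>(f e\<^sub>i)\<close>. Moreover
  \<open>H C' = \<Theta> C'\<close>. If \<open>h C' = f C'\<close> is nonzero in \<open>H\<^sub>t\<close>, some central \<open>\<pi>(f e\<^sub>i)\<close> acts by a nonzero scalar, so
  \<open>C e\<^sub>i h C'\<close> is a nonzero multiple of the generator \<open>C \<theta>\<^sub>\<rho> C'\<close>. This gives irreducibility, and also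
  \<open>C L\<^sub>t \<noteq> 0\<close>. For (b), exchange \<open>C\<close> and \<open>C'\<close>. The torus enters only through the ideal it defines in \<open>H\<close>.
\<close>

unbundle no m_inv_syntax
no_notation scalar_prod (infix "\<bullet>" 70)

section \<open>Root systems and their Weyl groups\<close>

text \<open>The characteristic may be two and \<open>q\<close> may be a root of unity, so neither
  division by 2 nor normalising \<open>C\<close> and \<open>C'\<close> to idempotents is available.
  This shapes the proof: sums over \<open>W\<close> are grouped by pairing \<open>w\<close> with its
  product by a reflection; vanishing on weights fixed by a simple reflection is shown separately,
  since antisymmetry does not imply it; and cancellation rests on leading coefficient 1
  (\<open>lead\<close>), where exponents are compared by their inner product with \<rho>. This
  comparison is only a preorder, but a dominant weight is the strict maximum of its orbit, which is
  enough. The Gram determinant is constant because the Steinberg weights add up to half of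
  \<open>card W\<close> times \<rho>, so that both sides of the determinant identity have the same
  top exponent. Much of the root combinatorics serves well-definedness: \<open>theta\<close> needs
  every \<open>T (id, x)\<close> to be invertible, hence a descent to length zero in the extended
  affine group, and this uses that the dominant short root has the highest coroot.\<close>

lemma inner_coroot: "x \<bullet> coroot \<alpha> = 2 * (x \<bullet> \<alpha>) / (\<alpha> \<bullet> \<alpha>)"
  by (simp add: coroot_def)

lemma coroot_inner_self: "\<alpha> \<noteq> 0 \<Longrightarrow> \<alpha> \<bullet> coroot \<alpha> = 2"
  by (simp add: inner_coroot)

lemma coroot_uminus: "coroot (- \<alpha>) = - coroot \<alpha>"
  by (simp add: coroot_def)

lemma inner_coroot_pos_iff: "\<alpha> \<noteq> 0 \<Longrightarrow> 0 < x \<bullet> coroot \<alpha> \<longleftrightarrow> 0 < x \<bullet> \<alpha>"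
  using inner_ge_zero[of \<alpha>] by (auto simp: inner_coroot zero_less_divide_iff simp del: inner_ge_zero)

lemma inner_coroot_nonneg_iff: "\<alpha> \<noteq> 0 \<Longrightarrow> 0 \<le> x \<bullet> coroot \<alpha> \<longleftrightarrow> 0 \<le> x \<bullet> \<alpha>"
  using inner_gt_zero_iff[of \<alpha>] by (auto simp: inner_coroot zero_le_divide_iff simp del: inner_gt_zero_iff)

lemma inner_coroot_eq_0_iff: "\<alpha> \<noteq> 0 \<Longrightarrow> x \<bullet> coroot \<alpha> = 0 \<longleftrightarrow> x \<bullet> \<alpha> = 0"
  by (simp add: inner_coroot)

lemma reflection_uminus: "reflection (- \<alpha>) = reflection \<alpha>"
  by (simp add: fun_eq_iff reflection_def coroot_uminus)

lemma reflection_self: "\<alpha> \<noteq> 0 \<Longrightarrow> reflection \<alpha> \<alpha> = - \<alpha>"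
  by (simp add: reflection_def coroot_inner_self scaleR_2)

lemma reflection_fixed: "x \<bullet> coroot \<alpha> = 0 \<Longrightarrow> reflection \<alpha> x = x"
  by (simp add: reflection_def)

lemma reflection_inner: "reflection \<alpha> x \<bullet> reflection \<alpha> y = x \<bullet> y"
proof (cases "\<alpha> = 0")
  case False
  then show ?thesis
    by (simp add: reflection_def inner_coroot inner_diff_left inner_diff_right inner_commute field_simps)
qed (simp add: reflection_def)

lemma reflection_orthogonal: "orthogonal_transformation (reflection \<alpha>)"
proof -
  have "linear (reflection \<alpha>)"
    by (rule linearI) (simp_all add: reflection_def inner_add_left algebra_simps)
  then show ?thesis by (simp add: orthogonal_transformation_def reflection_inner)
qed

lemma reflection_involution: "reflection \<alpha> (reflection \<alpha> x) = x"
proof (cases "\<alpha> = 0")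
  case False
  then show ?thesis
    by (simp add: reflection_def inner_diff_left coroot_inner_self algebra_simps)
qed (simp add: reflection_def)

lemma reflection_comp_self: "reflection \<alpha> \<circ> reflection \<alpha> = id"
  by (simp add: fun_eq_iff reflection_involution)

lemma inv_reflection: "inv (reflection \<alpha>) = reflection \<alpha>"
  by (rule inv_unique_comp) (simp_all add: reflection_comp_self)

lemma orthogonal_inner_swap:
  fixes w :: "'v::euclidean_space \<Rightarrow> 'v"
  assumes "orthogonal_transformation w"
  shows "w x \<bullet> y = x \<bullet> inv w y"
proof -
  have "y = w (inv w y)"
    using orthogonal_transformation_surj[OF assms] by (simp add: surj_f_inv_f)
  moreover have "w x \<bullet> w (inv w y) = x \<bullet> inv w y"
    using assms by (simp add: orthogonal_transformation_def)
  ultimately show ?thesis by simp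
qed

lemma reflection_inner_swap: "reflection \<alpha> x \<bullet> y = x \<bullet> reflection \<alpha> y"
  using orthogonal_inner_swap[OF reflection_orthogonal] by (simp add: inv_reflection)

lemma orthogonal_coroot:
  fixes w :: "'v::euclidean_space \<Rightarrow> 'v"
  assumes "orthogonal_transformation w"
  shows "coroot (w \<alpha>) = w (coroot \<alpha>)"
  using assms unfolding coroot_def orthogonal_transformation_def by (simp add: linear_scale)

lemma orthogonal_reflection:
  fixes w :: "'v::euclidean_space \<Rightarrow> 'v"
  assumes "orthogonal_transformation w"
  shows "reflection (w \<alpha>) (w x) = w (reflection \<alpha> x)"
  using assms unfolding reflection_def orthogonal_coroot[OF assms]
  by (simp add: orthogonal_transformation_def linear_diff linear_scale)

locale based_root_system =
  fixes R \<Delta> :: "'v::euclidean_space set"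
  assumes root_system: "root_system R" and simple_roots: "simple_roots R \<Delta>"
begin

abbreviation "W \<equiv> weyl_group R"
abbreviation "pos \<equiv> positive_roots R \<Delta>"
abbreviation "P \<equiv> weight_lattice R"
abbreviation "\<omega> \<equiv> fundamental_weight \<Delta>"
abbreviation "\<rho> \<equiv> rho \<Delta>"
abbreviation "s \<equiv> reflection"

lemma finite_R: "finite R" and span_R: "span R = UNIV"
  and root_nonzero: "\<alpha> \<in> R \<Longrightarrow> \<alpha> \<noteq> 0"
  and reflection_root: "\<alpha> \<in> R \<Longrightarrow> \<gamma> \<in> R \<Longrightarrow> s \<alpha> \<gamma> \<in> R"
  and root_integral: "\<alpha> \<in> R \<Longrightarrow> \<gamma> \<in> R \<Longrightarrow> \<gamma> \<bullet> coroot \<alpha> \<in> \<int>"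
  and root_reduced: "\<alpha> \<in> R \<Longrightarrow> c *\<^sub>R \<alpha> \<in> R \<Longrightarrow> c = 1 \<or> c = -1"
  using root_system unfolding root_system_def by auto

lemma simple_root: "\<gamma> \<in> \<Delta> \<Longrightarrow> \<gamma> \<in> R" and independent_simple: "independent \<Delta>"
  and pos_or_neg: "\<alpha> \<in> R \<Longrightarrow> \<alpha> \<in> pos \<or> - \<alpha> \<in> pos"
  using simple_roots unfolding simple_roots_def by auto

lemma finite_simple: "finite \<Delta>"
  using independent_simple by (rule independent_imp_finite)

lemma simple_nonzero: "\<gamma> \<in> \<Delta> \<Longrightarrow> \<gamma> \<noteq> 0"
  using simple_root root_nonzero by blast

lemma pos_root: "\<alpha> \<in> pos \<Longrightarrow> \<alpha> \<in> R"
  by (simp add: positive_roots_def)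

lemma finite_pos: "finite pos"
  using finite_R pos_root by (meson finite_subset subsetI)

lemma pos_nonzero: "\<alpha> \<in> pos \<Longrightarrow> \<alpha> \<noteq> 0"
  using pos_root root_nonzero by blast

lemma simple_pos: assumes "\<gamma> \<in> \<Delta>" shows "\<gamma> \<in> pos"
proof -
  have "\<gamma> = (\<Sum>\<delta>\<in>\<Delta>. real (if \<delta> = \<gamma> then 1 else 0) *\<^sub>R \<delta>)"
    using assms finite_simple by (simp add: if_distrib[of real] if_distrib[of "\<lambda>c. c *\<^sub>R _"] sum.delta cong: if_cong)
  then show ?thesis
    using simple_root[OF assms] unfolding positive_roots_def
    by (intro CollectI conjI exI[of _ "\<lambda>\<delta>. if \<delta> = \<gamma> then 1 else 0"])
qed

lemma root_uminus: "\<alpha> \<in> R \<Longrightarrow> - \<alpha> \<in> R"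
  using reflection_root[of \<alpha> \<alpha>] reflection_self[of \<alpha>] root_nonzero by auto

lemma span_simple: "span \<Delta> = UNIV"
proof -
  have pos: "\<alpha> \<in> span \<Delta>" if "\<alpha> \<in> pos" for \<alpha>
  proof -
    obtain c :: "'v \<Rightarrow> nat" where "\<alpha> = (\<Sum>\<delta>\<in>\<Delta>. real (c \<delta>) *\<^sub>R \<delta>)"
      using \<open>\<alpha> \<in> pos\<close> unfolding positive_roots_def by auto
    then show ?thesis by (simp add: span_sum span_scale span_base)
  qed
  have "R \<subseteq> span \<Delta>"
  proof
    fix \<alpha> assume "\<alpha> \<in> R"
    then show "\<alpha> \<in> span \<Delta>"
      using pos_or_neg[of \<alpha>] pos[of \<alpha>] pos[of "- \<alpha>"] span_neg[of "- \<alpha>" \<Delta>] by auto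
  qed
  then show ?thesis using span_R by (metis span_minimal subspace_span top.extremum_unique)
qed

lemma eq_if_inner_simple_eq:
  assumes "\<And>\<gamma>. \<gamma> \<in> \<Delta> \<Longrightarrow> x \<bullet> coroot \<gamma> = y \<bullet> coroot \<gamma>"
  shows "x = y"
proof -
  have "(x - y) \<bullet> z = 0" if "z \<in> span \<Delta>" for z
    using that
  proof (induct rule: span_induct_alt)
    case (step c \<gamma> z)
    have "(x - y) \<bullet> coroot \<gamma> = 0" using assms[OF step(1)] by (simp add: inner_diff_left)
    then have "(x - y) \<bullet> \<gamma> = 0" using simple_nonzero[OF step(1)] by (simp add: inner_coroot)
    then show ?case using step(2) by (simp add: inner_add_right)
  qed simp
  then have "(x - y) \<bullet> (x - y) = 0" by (simp add: span_simple)
  then show ?thesis by simp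
qed

section \<open>Fundamental weights, positive roots and coordinates\<close>

lemma ex_fundamental_weight: "\<exists>x. \<forall>\<gamma>\<in>\<Delta>. x \<bullet> coroot \<gamma> = (if \<gamma> = \<alpha> then 1 else 0)"
proof -
  \<comment> \<open>A linear functional is prescribed on the basis \<open>\<Delta>\<close> and then
    represented by a vector; half the squared length undoes the factor in
    \<open>coroot\<close>.\<close>
  obtain f :: "'v \<Rightarrow> real" where f: "linear f" "\<And>\<gamma>. \<gamma> \<in> \<Delta> \<Longrightarrow> f \<gamma> = (if \<gamma> = \<alpha> then (\<gamma> \<bullet> \<gamma>) / 2 else 0)"
    using linear_independent_extend[OF independent_simple, of "\<lambda>\<gamma>. if \<gamma> = \<alpha> then (\<gamma> \<bullet> \<gamma>) / 2 else 0"]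
    by auto
  define x where "x = (\<Sum>b\<in>Basis. f b *\<^sub>R b)"
  have "x \<bullet> y = f y" for y
  proof -
    have "f y = f (\<Sum>b\<in>Basis. (y \<bullet> b) *\<^sub>R b)" by (simp add: euclidean_representation)
    also have "\<dots> = (\<Sum>b\<in>Basis. (y \<bullet> b) * f b)"
      using f(1) by (simp add: linear_sum linear_scale)
    finally show ?thesis by (simp add: x_def inner_sum_right inner_commute[of _ y] mult.commute)
  qed
  then show ?thesis using f(2) simple_nonzero by (intro exI[of _ x]) (auto simp: inner_coroot)
qed

lemma fundamental_weight_inner:
  assumes "\<gamma> \<in> \<Delta>"
  shows "\<omega> \<alpha> \<bullet> coroot \<gamma> = (if \<gamma> = \<alpha> then 1 else 0)"
proof -
  have "\<exists>!x. \<forall>\<gamma>\<in>\<Delta>. x \<bullet> coroot \<gamma> = (if \<gamma> = \<alpha> then 1 else 0)"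
    using ex_fundamental_weight[of \<alpha>] eq_if_inner_simple_eq by (metis (no_types, lifting))
  from theI'[OF this] show ?thesis using assms unfolding fundamental_weight_def by blast
qed

lemma fundamental_weight_inner_simple:
  assumes "\<gamma> \<in> \<Delta>"
  shows "\<omega> \<alpha> \<bullet> \<gamma> = (if \<gamma> = \<alpha> then (\<gamma> \<bullet> \<gamma>) / 2 else 0)"
  using fundamental_weight_inner[OF assms, of \<alpha>] simple_nonzero[OF assms]
  by (auto simp: inner_coroot field_simps split: if_splits)

lemma rho_inner: "\<gamma> \<in> \<Delta> \<Longrightarrow> \<rho> \<bullet> coroot \<gamma> = 1"
  using finite_simple by (simp add: rho_def inner_sum_left fundamental_weight_inner)

lemma expand_weights: "x = (\<Sum>\<gamma>\<in>\<Delta>. (x \<bullet> coroot \<gamma>) *\<^sub>R \<omega> \<gamma>)"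
  by (rule eq_if_inner_simple_eq)
    (simp add: inner_sum_left fundamental_weight_inner finite_simple if_distrib cong: if_cong)

lemma expand_coroots: "x = (\<Sum>\<gamma>\<in>\<Delta>. (\<omega> \<gamma> \<bullet> x) *\<^sub>R coroot \<gamma>)"
proof -
  have "y \<bullet> x = y \<bullet> (\<Sum>\<gamma>\<in>\<Delta>. (\<omega> \<gamma> \<bullet> x) *\<^sub>R coroot \<gamma>)" for y
    by (subst expand_weights[of y]) (simp add: inner_sum_left inner_sum_right mult.commute)
  then show ?thesis using vector_eq_ldot by blast
qed

text \<open>The source of most sign arguments: if x is dominant and y is a positive root, every
  summand is nonnegative.\<close>

lemma inner_expand: "x \<bullet> y = (\<Sum>\<gamma>\<in>\<Delta>. (x \<bullet> coroot \<gamma>) * (\<omega> \<gamma> \<bullet> y))"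
  by (subst expand_coroots[of y]) (simp add: inner_sum_right mult.commute)

lemma pos_coordinate: assumes "\<alpha> \<in> pos" shows "0 \<le> \<omega> \<gamma> \<bullet> \<alpha>"
proof -
  obtain c :: "'v \<Rightarrow> nat" where "\<alpha> = (\<Sum>\<delta>\<in>\<Delta>. real (c \<delta>) *\<^sub>R \<delta>)"
    using assms unfolding positive_roots_def by auto
  then show ?thesis
    by (auto simp: inner_sum_right fundamental_weight_inner_simple intro!: sum_nonneg)
qed

lemma rho_pos: assumes "\<alpha> \<in> pos" shows "0 < \<rho> \<bullet> \<alpha>"
proof -
  have "\<rho> \<bullet> \<alpha> = (\<Sum>\<gamma>\<in>\<Delta>. \<omega> \<gamma> \<bullet> \<alpha>)" by (simp add: rho_def inner_sum_left)
  moreover have "(\<Sum>\<gamma>\<in>\<Delta>. \<omega> \<gamma> \<bullet> \<alpha>) \<noteq> 0"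
  proof
    assume "(\<Sum>\<gamma>\<in>\<Delta>. \<omega> \<gamma> \<bullet> \<alpha>) = 0"
    then have "\<forall>\<gamma>\<in>\<Delta>. \<omega> \<gamma> \<bullet> \<alpha> = 0"
      using assms pos_coordinate finite_simple by (subst (asm) sum_nonneg_eq_0_iff) auto
    then have "\<alpha> = 0" using expand_coroots[of \<alpha>] by simp
    then show False using assms pos_nonzero by blast
  qed
  ultimately show ?thesis
    using sum_nonneg[of \<Delta> "\<lambda>\<gamma>. \<omega> \<gamma> \<bullet> \<alpha>"] pos_coordinate[OF assms] by force
qed

lemma not_pos_uminus: "\<alpha> \<in> pos \<Longrightarrow> - \<alpha> \<notin> pos"
  using rho_pos[of \<alpha>] rho_pos[of "- \<alpha>"] by auto

lemma pos_uminus_iff: "\<alpha> \<in> R \<Longrightarrow> - \<alpha> \<in> pos \<longleftrightarrow> \<alpha> \<notin> pos"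
  using pos_or_neg not_pos_uminus by blast

lemma pos_if_coordinate: assumes "\<alpha> \<in> R" "0 < \<omega> \<gamma> \<bullet> \<alpha>" shows "\<alpha> \<in> pos"
  using pos_or_neg[OF assms(1)] pos_coordinate[of "- \<alpha>" \<gamma>] assms(2) by auto

lemma pos_iff_rho: "\<alpha> \<in> R \<Longrightarrow> \<alpha> \<in> pos \<longleftrightarrow> 0 < \<rho> \<bullet> \<alpha>"
  using pos_or_neg rho_pos[of \<alpha>] rho_pos[of "- \<alpha>"] by force

text \<open>The reflection alters only the \<open>\<gamma>\<close> coordinate. Since the root system
  is reduced, a positive root other than \<open>\<gamma>\<close> has a further nonzero, hence
  positive, coordinate, and one positive coordinate decides the sign of a root.\<close>

lemma simple_reflection_pos:
  assumes "\<gamma> \<in> \<Delta>" "\<alpha> \<in> pos" "\<alpha> \<noteq> \<gamma>"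
  shows "s \<gamma> \<alpha> \<in> pos"
proof -
  have "\<exists>\<delta>\<in>\<Delta> - {\<gamma>}. \<omega> \<delta> \<bullet> \<alpha> \<noteq> 0"
  proof (rule ccontr)
    assume "\<not> ?thesis"
    then have "\<alpha> = (\<Sum>\<delta>\<in>\<Delta>. if \<delta> = \<gamma> then (\<omega> \<gamma> \<bullet> \<alpha>) *\<^sub>R coroot \<gamma> else 0)"
      by (subst expand_coroots[of \<alpha>]) (auto intro!: sum.cong)
    then have "\<alpha> = ((\<omega> \<gamma> \<bullet> \<alpha>) * (2 / (\<gamma> \<bullet> \<gamma>))) *\<^sub>R \<gamma>"
      using assms(1) finite_simple by (simp add: coroot_def)
    then have "\<alpha> = \<gamma> \<or> \<alpha> = - \<gamma>"
      using root_reduced[OF simple_root[OF assms(1)]] pos_root[OF assms(2)]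
      by (metis scaleR_minus_left scaleR_one)
    then show False
      using assms not_pos_uminus simple_pos by auto
  qed
  then obtain \<delta> where d: "\<delta> \<in> \<Delta>" "\<delta> \<noteq> \<gamma>" "\<omega> \<delta> \<bullet> \<alpha> \<noteq> 0" by blast
  then have "0 < \<omega> \<delta> \<bullet> \<alpha>" using pos_coordinate[OF assms(2), of \<delta>] by simp
  moreover have "\<omega> \<delta> \<bullet> s \<gamma> \<alpha> = \<omega> \<delta> \<bullet> \<alpha>"
    using d assms(1) by (simp add: reflection_def inner_diff_right fundamental_weight_inner_simple)
  ultimately show ?thesis
    using pos_if_coordinate[of "s \<gamma> \<alpha>" \<delta>] reflection_root[OF simple_root[OF assms(1)] pos_root[OF assms(2)]]
    by simp
qed

text \<open>Induction on height, measured by \<rho>. Expanding the square norm of the root shows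
  that it pairs positively with some simple root, and reflecting in that one lowers the height.
  Heights are real numbers here, so the induction counts the roots of smaller height.\<close>

lemma pos_induct [consumes 1, case_names simple step]:
  assumes "\<alpha> \<in> pos"
    and "\<And>\<gamma>. \<gamma> \<in> \<Delta> \<Longrightarrow> Q \<gamma>"
    and "\<And>\<alpha> \<gamma>. \<alpha> \<in> pos \<Longrightarrow> \<gamma> \<in> \<Delta> \<Longrightarrow> \<alpha> \<noteq> \<gamma> \<Longrightarrow> 0 < \<alpha> \<bullet> coroot \<gamma> \<Longrightarrow> s \<gamma> \<alpha> \<in> pos \<Longrightarrow> Q (s \<gamma> \<alpha>) \<Longrightarrow> Q \<alpha>"
  shows "Q \<alpha>"
  using assms(1)
proof (induct "card {\<beta> \<in> R. \<rho> \<bullet> \<beta> < \<rho> \<bullet> \<alpha>}" arbitrary: \<alpha> rule: less_induct)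
  case less
  have "\<exists>\<gamma>\<in>\<Delta>. 0 < \<alpha> \<bullet> coroot \<gamma>"
  proof (rule ccontr)
    assume "\<not> ?thesis"
    then have "(\<Sum>\<gamma>\<in>\<Delta>. (\<alpha> \<bullet> coroot \<gamma>) * (\<omega> \<gamma> \<bullet> \<alpha>)) \<le> 0"
      using pos_coordinate[OF less(2)] by (intro sum_nonpos mult_nonpos_nonneg) (auto simp: not_less)
    then have "\<alpha> \<bullet> \<alpha> \<le> 0" using inner_expand[of \<alpha> \<alpha>] by linarith
    then show False using pos_nonzero[OF less(2)] by (metis inner_gt_zero_iff not_less)
  qed
  then obtain \<gamma> where g: "\<gamma> \<in> \<Delta>" "0 < \<alpha> \<bullet> coroot \<gamma>" by blast
  show ?case
  proof (cases "\<alpha> = \<gamma>")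
    case True
    then show ?thesis using assms(2) g by simp
  next
    case False
    then have p: "s \<gamma> \<alpha> \<in> pos" using simple_reflection_pos g less(2) by blast
    have lt: "\<rho> \<bullet> s \<gamma> \<alpha> < \<rho> \<bullet> \<alpha>"
      using g rho_pos[OF simple_pos[OF g(1)]] by (simp add: reflection_def inner_diff_right)
    have "{\<beta> \<in> R. \<rho> \<bullet> \<beta> < \<rho> \<bullet> s \<gamma> \<alpha>} \<subset> {\<beta> \<in> R. \<rho> \<bullet> \<beta> < \<rho> \<bullet> \<alpha>}"
      using lt pos_root[OF p] by (auto intro: less_trans)
    then have "card {\<beta> \<in> R. \<rho> \<bullet> \<beta> < \<rho> \<bullet> s \<gamma> \<alpha>} < card {\<beta> \<in> R. \<rho> \<bullet> \<beta> < \<rho> \<bullet> \<alpha>}"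
      using finite_R by (intro psubset_card_mono) auto
    then have "Q (s \<gamma> \<alpha>)" using less(1) p by blast
    then show ?thesis using assms(3) less(2) g False p by blast
  qed
qed

text \<open>By \<open>expand_coroots\<close> these are the coefficients of a coroot in the simple
  coroots. Their integrality, proved by moving reflections from the root to the weight, is what puts
  the fundamental weights into \<open>P\<close>.\<close>

lemma coroot_coordinate_integral:
  assumes "\<alpha> \<in> R"
  shows "\<omega> \<gamma> \<bullet> coroot \<alpha> \<in> \<int>"
proof -
  have *: "\<omega> \<gamma> \<bullet> coroot \<alpha> \<in> \<int>" if "\<alpha> \<in> pos" for \<alpha>
    using that
  proof (induct rule: pos_induct)
    case (simple \<delta>)
    then show ?case by (simp add: fundamental_weight_inner)
  next
    case (step \<alpha> \<delta>)
    have "coroot \<alpha> = s \<delta> (coroot (s \<delta> \<alpha>))"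
      by (simp add: orthogonal_coroot[OF reflection_orthogonal] reflection_involution)
    then have "\<omega> \<gamma> \<bullet> coroot \<alpha> = s \<delta> (\<omega> \<gamma>) \<bullet> coroot (s \<delta> \<alpha>)"
      by (simp add: reflection_inner_swap)
    also have "\<dots> = \<omega> \<gamma> \<bullet> coroot (s \<delta> \<alpha>) - (\<omega> \<gamma> \<bullet> coroot \<delta>) * (\<delta> \<bullet> coroot (s \<delta> \<alpha>))"
      by (simp add: reflection_def inner_diff_left)
    also have "\<dots> \<in> \<int>"
      using step root_integral[OF pos_root[OF step(5)] simple_root[OF step(2)]]
      by (auto simp: fundamental_weight_inner)
    finally show ?case .
  qed
  show ?thesis
    using pos_or_neg[OF assms] *[of \<alpha>] *[of "- \<alpha>"] by (auto simp: coroot_uminus minus_in_Ints_iff)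
qed

lemma fundamental_weight_in_P: "\<omega> \<gamma> \<in> P"
  by (simp add: weight_lattice_def coroot_coordinate_integral)

lemma P_add: "x \<in> P \<Longrightarrow> y \<in> P \<Longrightarrow> x + y \<in> P"
  and P_diff: "x \<in> P \<Longrightarrow> y \<in> P \<Longrightarrow> x - y \<in> P"
  and P_uminus: "x \<in> P \<Longrightarrow> - x \<in> P"
  and P_zero: "0 \<in> P"
  by (auto simp: weight_lattice_def inner_add_left inner_diff_left)

lemma P_sum: "(\<And>i. i \<in> I \<Longrightarrow> f i \<in> P) \<Longrightarrow> sum f I \<in> P"
  by (induct I rule: infinite_finite_induct) (auto simp: P_zero P_add)

lemma P_scale_int: "x \<in> P \<Longrightarrow> of_int n *\<^sub>R x \<in> P"
  by (auto simp: weight_lattice_def intro: Ints_mult)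

lemma root_in_P: "\<alpha> \<in> R \<Longrightarrow> \<alpha> \<in> P"
  by (simp add: weight_lattice_def root_integral)

lemma rho_in_P: "\<rho> \<in> P"
  by (simp add: rho_def P_sum fundamental_weight_in_P)

lemma pairing_P: "x \<in> P \<Longrightarrow> \<alpha> \<in> R \<Longrightarrow> of_int (pairing x \<alpha>) = x \<bullet> coroot \<alpha>"
  unfolding weight_lattice_def pairing_def by (auto elim!: Ints_cases)

section \<open>The finite Weyl group: words, exchange, inversions\<close>

lemma W_orthogonal: "w \<in> W \<Longrightarrow> orthogonal_transformation w"
proof (induct rule: weyl_group.induct)
  case weyl_id
  then show ?case unfolding id_def by simp
next
  case (weyl_reflection \<alpha> w)
  then show ?case by (intro orthogonal_transformation_compose reflection_orthogonal)
qed

lemma W_linear: "w \<in> W \<Longrightarrow> linear w"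
  using W_orthogonal orthogonal_transformation_def by blast

lemma W_bij: "w \<in> W \<Longrightarrow> bij w"
  using W_orthogonal orthogonal_transformation_bij by blast

lemma W_inj: "w \<in> W \<Longrightarrow> w x = w y \<longleftrightarrow> x = y"
  using W_bij bij_is_inj inj_eq by metis

lemma W_inner: "w \<in> W \<Longrightarrow> w x \<bullet> w y = x \<bullet> y"
  using W_orthogonal orthogonal_transformation_def by metis

lemma W_inner_swap: "w \<in> W \<Longrightarrow> w x \<bullet> y = x \<bullet> inv w y"
  using W_orthogonal orthogonal_inner_swap by blast

lemma W_root: "w \<in> W \<Longrightarrow> \<alpha> \<in> R \<Longrightarrow> w \<alpha> \<in> R"
  by (induct arbitrary: \<alpha> rule: weyl_group.induct) (auto intro: reflection_root)

lemma W_id: "id \<in> W" by (rule weyl_group.weyl_id)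

lemma W_reflection: "\<alpha> \<in> R \<Longrightarrow> s \<alpha> \<in> W"
  using weyl_group.weyl_reflection[OF _ W_id, of \<alpha>] by (simp only: comp_id)

lemma W_comp: "w \<in> W \<Longrightarrow> u \<in> W \<Longrightarrow> w \<circ> u \<in> W"
  by (induct rule: weyl_group.induct) (auto simp: comp_assoc intro: weyl_group.weyl_reflection)

lemma W_inv: "w \<in> W \<Longrightarrow> inv w \<in> W"
proof (induct rule: weyl_group.induct)
  case (weyl_reflection \<alpha> w)
  have "inv (s \<alpha> \<circ> w) = inv w \<circ> s \<alpha>"
    using W_bij[OF W_reflection[OF weyl_reflection(1)]] W_bij[OF weyl_reflection(2)]
    by (simp add: o_inv_distrib inv_reflection)
  moreover have "inv w \<circ> s \<alpha> \<in> W" using weyl_reflection by (intro W_comp W_reflection)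
  ultimately show ?case by (simp only:)
qed (use W_id in \<open>simp only: inv_id\<close>)

lemma W_inv_apply: "w \<in> W \<Longrightarrow> inv w (w x) = x" and W_apply_inv: "w \<in> W \<Longrightarrow> w (inv w x) = x"
  by (simp_all add: W_bij bij_is_inj bij_is_surj surj_f_inv_f)

lemma W_inv_comp: "w \<in> W \<Longrightarrow> inv w \<circ> w = id" and W_comp_inv: "w \<in> W \<Longrightarrow> w \<circ> inv w = id"
  by (auto simp: fun_eq_iff W_inv_apply W_apply_inv)

lemma W_inv_inv: "w \<in> W \<Longrightarrow> inv (inv w) = w"
  by (simp add: W_bij inv_inv_eq)

lemma W_coroot: "w \<in> W \<Longrightarrow> coroot (w \<alpha>) = w (coroot \<alpha>)"
  using W_orthogonal orthogonal_coroot by blast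

lemma W_inner_coroot: "w \<in> W \<Longrightarrow> w x \<bullet> coroot \<alpha> = x \<bullet> coroot (inv w \<alpha>)"
  by (simp add: W_inner_swap W_coroot W_inv)

lemma W_P: "w \<in> W \<Longrightarrow> x \<in> P \<Longrightarrow> w x \<in> P"
  using W_root W_inv unfolding weight_lattice_def by (auto simp: W_inner_coroot)

lemma W_zero: "w \<in> W \<Longrightarrow> w 0 = 0"
  using W_linear linear_0 by blast

lemma W_add: "w \<in> W \<Longrightarrow> w (x + y) = w x + w y" and W_diff: "w \<in> W \<Longrightarrow> w (x - y) = w x - w y"
  and W_uminus: "w \<in> W \<Longrightarrow> w (- x) = - w x" and W_scale: "w \<in> W \<Longrightarrow> w (c *\<^sub>R x) = c *\<^sub>R w x"
  using W_linear by (auto simp: linear_add linear_diff linear_neg linear_scale)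

lemma W_conj_reflection: "w \<in> W \<Longrightarrow> w \<circ> s \<alpha> = s (w \<alpha>) \<circ> w"
  by (simp add: fun_eq_iff orthogonal_reflection[OF W_orthogonal])

lemma finite_W: "finite W"
proof -
  have "inj_on (\<lambda>w. restrict w R) W"
  proof (rule inj_onI)
    fix w u assume wu: "w \<in> W" "u \<in> W" and eq: "restrict w R = restrict u R"
    have "w x = u x" for x
    proof (rule linear_eq_on_span[OF W_linear[OF wu(1)] W_linear[OF wu(2)], of R])
      show "w x = u x" if "x \<in> R" for x using eq that by (metis restrict_apply')
    qed (simp add: span_R)
    then show "w = u" by blast
  qed
  moreover have "(\<lambda>w. restrict w R) ` W \<subseteq> (\<Pi>\<^sub>E \<alpha>\<in>R. R)"
    using W_root by auto
  ultimately show ?thesis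
    using finite_PiE[of R "\<lambda>_. R"] finite_R by (meson finite_imageD finite_subset)
qed

definition word :: "'v list \<Rightarrow> 'v \<Rightarrow> 'v" where
  "word gs = foldr (\<lambda>\<gamma> w. s \<gamma> \<circ> w) gs id"

lemma word_Nil: "word [] = id" and word_Cons: "word (\<gamma> # gs) = s \<gamma> \<circ> word gs"
  by (simp_all add: word_def)

lemma word_append: "word (gs @ hs) = word gs \<circ> word hs"
  by (induct gs) (auto simp: word_Nil word_Cons fun_eq_iff)

lemma word_W: "set gs \<subseteq> \<Delta> \<Longrightarrow> word gs \<in> W"
  by (induct gs) (auto simp: word_Nil word_Cons simple_root intro: W_id weyl_group.weyl_reflection)

lemma reflection_word:
  assumes "\<alpha> \<in> pos"
  shows "\<exists>gs. set gs \<subseteq> \<Delta> \<and> s \<alpha> = word gs"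
  using assms
proof (induct rule: pos_induct)
  case (simple \<gamma>)
  then show ?case by (intro exI[of _ "[\<gamma>]"]) (simp add: word_Nil word_Cons)
next
  case (step \<alpha> \<gamma>)
  then obtain gs where gs: "set gs \<subseteq> \<Delta>" "s (s \<gamma> \<alpha>) = word gs" by blast
  have "s \<alpha> = word (\<gamma> # gs @ [\<gamma>])"
  proof
    fix x
    have "s (s \<gamma> \<alpha>) (s \<gamma> x) = s \<gamma> (s \<alpha> x)"
      by (rule orthogonal_reflection[OF reflection_orthogonal])
    then have "s \<alpha> x = s \<gamma> (s (s \<gamma> \<alpha>) (s \<gamma> x))" by (simp add: reflection_involution)
    then show "s \<alpha> x = word (\<gamma> # gs @ [\<gamma>]) x"
      by (simp add: gs(2) word_Cons word_append word_Nil)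
  qed
  then show ?case using gs(1) step(2) by (intro exI[of _ "\<gamma> # gs @ [\<gamma>]"]) auto
qed

lemma W_word:
  assumes "w \<in> W"
  shows "\<exists>gs. set gs \<subseteq> \<Delta> \<and> w = word gs"
  using assms
proof (induct rule: weyl_group.induct)
  case weyl_id
  then show ?case by (intro exI[of _ "[]"]) (simp add: word_Nil)
next
  case (weyl_reflection \<alpha> w)
  obtain gs where gs: "set gs \<subseteq> \<Delta>" "w = word gs" using weyl_reflection by blast
  obtain hs where hs: "set hs \<subseteq> \<Delta>" "s \<alpha> = word hs"
    using reflection_word[of \<alpha>] reflection_word[of "- \<alpha>"] pos_or_neg[OF weyl_reflection(1)]
    by (auto simp: reflection_uminus)
  show ?case using gs hs by (intro exI[of _ "hs @ gs"]) (simp add: word_append)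
qed

lemma W_simple_induct [consumes 1, case_names id step]:
  assumes "w \<in> W" "Q id" "\<And>\<gamma> w. \<gamma> \<in> \<Delta> \<Longrightarrow> w \<in> W \<Longrightarrow> Q w \<Longrightarrow> Q (s \<gamma> \<circ> w)"
  shows "Q w"
proof -
  obtain gs where gs: "set gs \<subseteq> \<Delta>" "w = word gs" using W_word[OF assms(1)] by blast
  have "Q (word gs)" using gs(1)
  proof (induct gs)
    case Nil
    then show ?case using assms(2) by (simp only: word_Nil)
  next
    case (Cons \<gamma> gs)
    then show ?case unfolding word_Cons by (intro assms(3) word_W) auto
  qed
  then show ?thesis by (simp add: gs(2))
qed

text \<open>Reading the word from the right, \<open>\<gamma>\<close> starts positive and ends
  negative. At the letter \<open>\<delta>\<close> where the sign changes the root must equal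
  \<open>\<delta>\<close>, since \<open>s \<delta>\<close> permutes the other positive roots;
  conjugation then lets the new letter cancel \<open>\<delta>\<close>.\<close>

lemma word_exchange:
  assumes "set gs \<subseteq> \<Delta>" "\<gamma> \<in> \<Delta>" "word gs \<gamma> \<notin> pos"
  shows "\<exists>hs. set hs \<subseteq> \<Delta> \<and> length hs < length gs \<and> word gs \<circ> s \<gamma> = word hs"
  using assms(1,3)
proof (induct gs)
  case Nil
  then show ?case using simple_pos[OF assms(2)] by (simp add: word_Nil)
next
  case (Cons \<delta> gs)
  show ?case
  proof (cases "word gs \<gamma> \<in> pos")
    case True
    then have "word gs \<gamma> = \<delta>"
      using simple_reflection_pos[of \<delta> "word gs \<gamma>"] Cons(2,3) by (auto simp: word_Cons)
    then have "word gs \<circ> s \<gamma> = s \<delta> \<circ> word gs"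
      using W_conj_reflection[OF word_W, of gs \<gamma>] Cons(2) by simp
    then have "word (\<delta> # gs) \<circ> s \<gamma> = s \<delta> \<circ> (s \<delta> \<circ> word gs)"
      by (simp add: word_Cons comp_assoc)
    also have "\<dots> = word gs" by (simp add: fun_eq_iff reflection_involution)
    finally show ?thesis using Cons(2) by (intro exI[of _ gs]) simp
  next
    case False
    moreover have sub: "set gs \<subseteq> \<Delta>" using Cons(2) by simp
    ultimately obtain hs where hs: "set hs \<subseteq> \<Delta>" "length hs < length gs" "word gs \<circ> s \<gamma> = word hs"
      using Cons(1) by blast
    have "word (\<delta> # gs) \<circ> s \<gamma> = word (\<delta> # hs)"
      unfolding word_Cons hs(3)[symmetric] by (rule comp_assoc)
    then show ?thesis using Cons(2) hs(1,2) by (intro exI[of _ "\<delta> # hs"]) simp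
  qed
qed

lemma W_eq_id:
  assumes "w \<in> W" "\<And>\<gamma>. \<gamma> \<in> \<Delta> \<Longrightarrow> w \<gamma> \<in> pos"
  shows "w = id"
proof -
  \<comment> \<open>A shortest word for \<open>w\<close> is chosen. If it ended in
    \<open>\<gamma>\<close>, positivity of \<open>w \<gamma>\<close> would make its initial part
    send \<open>\<gamma>\<close> to a negative root, and exchange would give a shorter word.\<close>
  define good where "good gs \<longleftrightarrow> set gs \<subseteq> \<Delta> \<and> w = word gs" for gs
  obtain gs where gs: "good gs" and min: "\<And>hs. good hs \<Longrightarrow> length gs \<le> length hs"
    using ex_has_least_nat[of good _ length] W_word[OF assms(1)] unfolding good_def by metis
  show ?thesis
  proof (cases gs rule: rev_cases)
    case Nil
    then show ?thesis using gs by (simp add: good_def word_Nil)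
  next
    case (snoc hs \<gamma>)
    then have h: "set hs \<subseteq> \<Delta>" "\<gamma> \<in> \<Delta>" "w = word hs \<circ> s \<gamma>"
      using gs by (auto simp: good_def word_append word_Cons word_Nil)
    then have "w \<gamma> = - word hs \<gamma>"
      using reflection_self[OF simple_nonzero[OF h(2)]] W_uminus[OF word_W[OF h(1)]] by simp
    then have "word hs \<gamma> \<notin> pos" using assms(2)[OF h(2)] not_pos_uminus[of "word hs \<gamma>"] by auto
    from word_exchange[OF h(1,2) this] obtain hs' where "good hs'" "length hs' < length hs"
      using h(3) unfolding good_def by metis
    then show ?thesis using min[of hs'] snoc by simp
  qed
qed

definition inversions :: "('v \<Rightarrow> 'v) \<Rightarrow> 'v set" where
  "inversions w = {\<alpha> \<in> pos. w \<alpha> \<notin> pos}"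

lemma finite_inversions: "finite (inversions w)"
  using finite_pos by (simp add: inversions_def)

lemma W_simple_neg:
  assumes "w \<in> W" "\<gamma> \<in> \<Delta>" shows "(w \<circ> s \<gamma>) \<gamma> \<in> pos \<longleftrightarrow> w \<gamma> \<notin> pos"
proof -
  have "(w \<circ> s \<gamma>) \<gamma> = - w \<gamma>"
    using reflection_self[OF simple_nonzero[OF assms(2)]] W_uminus[OF assms(1)] by simp
  then show ?thesis using pos_uminus_iff[OF W_root[OF assms(1) simple_root[OF assms(2)]]] by simp
qed

lemma bij_betw_simple_reflection: "\<gamma> \<in> \<Delta> \<Longrightarrow> bij_betw (s \<gamma>) (pos - {\<gamma>}) (pos - {\<gamma>})"
proof (rule bij_betwI[where g = "s \<gamma>"])
  assume g: "\<gamma> \<in> \<Delta>"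
  have "s \<gamma> \<alpha> \<noteq> \<gamma>" if "\<alpha> \<in> pos" for \<alpha>
    using that reflection_involution[of \<gamma> \<alpha>] reflection_self[OF simple_nonzero[OF g]]
      not_pos_uminus[OF simple_pos[OF g]] by auto
  then show "s \<gamma> \<in> pos - {\<gamma>} \<rightarrow> pos - {\<gamma>}" "s \<gamma> \<in> pos - {\<gamma>} \<rightarrow> pos - {\<gamma>}"
    using simple_reflection_pos[OF g] by auto
qed (simp_all add: reflection_involution)

text \<open>\<open>s \<gamma>\<close> matches the inversions other than \<open>\<gamma>\<close>, and
  \<open>\<gamma>\<close> is an inversion of exactly one of the two elements. Indicator terms stand
  on both sides so that no truncated subtraction occurs.\<close>

lemma card_inversions_simple:
  assumes "w \<in> W" "\<gamma> \<in> \<Delta>"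
  shows "card (inversions (w \<circ> s \<gamma>)) + (if w \<gamma> \<in> pos then 0 else 1)
       = card (inversions w) + (if w \<gamma> \<in> pos then 1 else 0)"
proof -
  have "bij_betw (s \<gamma>) (inversions (w \<circ> s \<gamma>) - {\<gamma>}) (inversions w - {\<gamma>})"
  proof (rule bij_betw_imageI)
    show "inj_on (s \<gamma>) (inversions (w \<circ> s \<gamma>) - {\<gamma>})"
      using reflection_involution by (metis inj_onI)
    show "s \<gamma> ` (inversions (w \<circ> s \<gamma>) - {\<gamma>}) = inversions w - {\<gamma>}"
    proof (intro equalityI subsetI)
      fix \<alpha> assume "\<alpha> \<in> s \<gamma> ` (inversions (w \<circ> s \<gamma>) - {\<gamma>})"
      then show "\<alpha> \<in> inversions w - {\<gamma>}"
        using bij_betwE[OF bij_betw_simple_reflection[OF assms(2)]] by (auto simp: inversions_def)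
    next
      fix \<alpha> assume a: "\<alpha> \<in> inversions w - {\<gamma>}"
      then have "s \<gamma> \<alpha> \<in> inversions (w \<circ> s \<gamma>) - {\<gamma>}"
        using bij_betwE[OF bij_betw_simple_reflection[OF assms(2)]]
        by (auto simp: inversions_def reflection_involution)
      then show "\<alpha> \<in> s \<gamma> ` (inversions (w \<circ> s \<gamma>) - {\<gamma>})"
        by (metis reflection_involution imageI)
    qed
  qed
  then have eq: "card (inversions (w \<circ> s \<gamma>) - {\<gamma>}) = card (inversions w - {\<gamma>})"
    by (rule bij_betw_same_card)
  have in1: "\<gamma> \<in> inversions w \<longleftrightarrow> w \<gamma> \<notin> pos" and in2: "\<gamma> \<in> inversions (w \<circ> s \<gamma>) \<longleftrightarrow> w \<gamma> \<in> pos"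
    using simple_pos[OF assms(2)] W_simple_neg[OF assms] by (auto simp: inversions_def)
  have *: "card (A - {\<gamma>}) + (if \<gamma> \<in> A then 1 else 0) = card A" if "finite A" for A :: "'v set"
    using that card.remove[of A \<gamma>] by (cases "\<gamma> \<in> A") simp_all
  from *[OF finite_inversions, of w] *[OF finite_inversions, of "w \<circ> s \<gamma>"]
  show ?thesis using eq in1 in2 by (simp split: if_splits)
qed

text \<open>Induction along reduced words: \<open>w \<gamma> \<in> pos\<close> says that the length
  goes up, so that the corresponding elements \<open>T\<close> multiply.\<close>

lemma W_right_induct [consumes 1, case_names id step]:
  assumes "w \<in> W" "Q id"
    and "\<And>\<gamma> w. \<gamma> \<in> \<Delta> \<Longrightarrow> w \<in> W \<Longrightarrow> w \<gamma> \<in> pos \<Longrightarrow> Q w \<Longrightarrow> Q (w \<circ> s \<gamma>)"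
  shows "Q w"
  using assms(1)
proof (induct "card (inversions w)" arbitrary: w rule: less_induct)
  case less
  show ?case
  proof (cases "w = id")
    case False
    then obtain \<gamma> where g: "\<gamma> \<in> \<Delta>" "w \<gamma> \<notin> pos" using W_eq_id[OF less(2)] by blast
    have W': "w \<circ> s \<gamma> \<in> W" using less(2) g(1) by (intro W_comp W_reflection simple_root)
    have "card (inversions (w \<circ> s \<gamma>)) < card (inversions w)"
      using card_inversions_simple[OF less(2) g(1)] g(2) by simp
    then have "Q (w \<circ> s \<gamma>)" using less(1) W' by blast
    then have "Q ((w \<circ> s \<gamma>) \<circ> s \<gamma>)"
      using assms(3)[OF g(1) W'] W_simple_neg[OF less(2) g(1)] g(2) by blast
    then show ?thesis by (simp add: comp_assoc reflection_comp_self)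
  qed (use assms(2) in \<open>simp only:\<close>)
qed

section \<open>Dominant vectors and their orbits\<close>

definition dominant :: "'v \<Rightarrow> bool" where
  "dominant x \<longleftrightarrow> (\<forall>\<gamma>\<in>\<Delta>. 0 \<le> x \<bullet> coroot \<gamma>)"

lemma dominantD: "dominant x \<Longrightarrow> \<gamma> \<in> \<Delta> \<Longrightarrow> 0 \<le> x \<bullet> coroot \<gamma>"
  by (simp add: dominant_def)

lemma dominant_pos: assumes "dominant x" "\<alpha> \<in> pos" shows "0 \<le> x \<bullet> coroot \<alpha>"
proof -
  have "0 \<le> x \<bullet> \<alpha>"
    unfolding inner_expand[of x \<alpha>] using dominantD[OF assms(1)] pos_coordinate[OF assms(2)]
    by (intro sum_nonneg mult_nonneg_nonneg)
  then show ?thesis using inner_coroot_nonneg_iff[OF pos_nonzero[OF assms(2)]] by blast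
qed

lemma rho_inner_coroot_pos: "\<alpha> \<in> pos \<Longrightarrow> 0 < \<rho> \<bullet> coroot \<alpha>"
  using rho_pos inner_coroot_pos_iff[OF pos_nonzero] by blast

lemma rho_expand: "\<rho> \<bullet> y = (\<Sum>\<gamma>\<in>\<Delta>. \<omega> \<gamma> \<bullet> y)"
  by (simp add: rho_def inner_sum_left)

text \<open>Each letter of a reduced word adds a nonnegative multiple of the positive root
  \<open>w \<gamma>\<close> to the difference. This is the dominance order on an orbit, read off in
  coordinates.\<close>

lemma dominant_diff_coordinate:
  assumes "dominant x" "w \<in> W"
  shows "0 \<le> \<omega> \<delta> \<bullet> (x - w x)"
  using assms(2)
proof (induct rule: W_right_induct)
  case (step \<gamma> w)
  have "x - (w \<circ> s \<gamma>) x = (x - w x) + (x \<bullet> coroot \<gamma>) *\<^sub>R w \<gamma>"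
    using W_diff[OF step(2)] W_scale[OF step(2)] by (simp add: reflection_def)
  then have "\<omega> \<delta> \<bullet> (x - (w \<circ> s \<gamma>) x) = \<omega> \<delta> \<bullet> (x - w x) + (x \<bullet> coroot \<gamma>) * (\<omega> \<delta> \<bullet> w \<gamma>)"
    by (simp only: inner_add_right inner_scaleR_right)
  moreover have "0 \<le> (x \<bullet> coroot \<gamma>) * (\<omega> \<delta> \<bullet> w \<gamma>)"
    using dominantD[OF assms(1) step(1)] pos_coordinate[OF step(3)] by (intro mult_nonneg_nonneg)
  ultimately show ?case using step(4) by linarith
qed simp

text \<open>The coordinates of \<open>x - w x\<close> are nonnegative and not all zero, and pairing
  with \<rho> adds them up. All leading term arguments below compare exponents in this way.\<close>

lemma rho_dominant_less:
  assumes "dominant x" "w \<in> W" "w x \<noteq> x"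
  shows "\<rho> \<bullet> w x < \<rho> \<bullet> x"
proof -
  have "\<exists>\<gamma>\<in>\<Delta>. \<omega> \<gamma> \<bullet> (x - w x) \<noteq> 0"
  proof (rule ccontr)
    assume "\<not> ?thesis"
    then have "x - w x = 0" by (subst expand_coroots[of "x - w x"]) simp
    then show False using assms(3) by simp
  qed
  then obtain \<gamma> where "\<gamma> \<in> \<Delta>" "0 < \<omega> \<gamma> \<bullet> (x - w x)"
    using dominant_diff_coordinate[OF assms(1,2)] less_eq_real_def by metis
  then have "0 < (\<Sum>\<gamma>\<in>\<Delta>. \<omega> \<gamma> \<bullet> (x - w x))"
    using dominant_diff_coordinate[OF assms(1,2)] finite_simple by (intro sum_pos2[of \<Delta> \<gamma>])
  then show ?thesis unfolding rho_expand[symmetric] by (simp add: inner_diff_right)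
qed

lemma dominant_orbit_unique:
  assumes "dominant x" "w \<in> W" "dominant (w x)"
  shows "w x = x"
proof (rule ccontr)
  assume ne: "w x \<noteq> x"
  then have "inv w (w x) \<noteq> w x" using W_inv_apply[OF assms(2)] by simp
  from rho_dominant_less[OF assms(3) W_inv[OF assms(2)] this]
  show False using rho_dominant_less[OF assms(1,2) ne] W_inv_apply[OF assms(2)] by simp
qed

text \<open>If \<open>w\<close> had a right descent \<open>\<gamma>\<close>, the last step would
  contribute a strictly positive multiple of a positive root, and \<open>x - w x\<close> could not
  vanish.\<close>

lemma strictly_dominant_stabilizer:
  assumes "\<And>\<gamma>. \<gamma> \<in> \<Delta> \<Longrightarrow> 0 < x \<bullet> coroot \<gamma>" "w \<in> W" "w x = x"
  shows "w = id"
proof (rule ccontr)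
  assume "w \<noteq> id"
  then obtain \<gamma> where g: "\<gamma> \<in> \<Delta>" "w \<gamma> \<notin> pos" using W_eq_id[OF assms(2)] by blast
  define u where "u = w \<circ> s \<gamma>"
  have u: "u \<in> W" "u \<gamma> \<in> pos" "w = u \<circ> s \<gamma>"
    using g W_simple_neg[OF assms(2) g(1)] W_comp[OF assms(2) W_reflection[OF simple_root[OF g(1)]]]
    by (auto simp: u_def comp_assoc reflection_comp_self)
  have "x - w x = (x - u x) + (x \<bullet> coroot \<gamma>) *\<^sub>R u \<gamma>"
    using W_diff[OF u(1)] W_scale[OF u(1)] by (simp add: reflection_def u(3))
  then have "\<rho> \<bullet> (x - w x) = \<rho> \<bullet> (x - u x) + (x \<bullet> coroot \<gamma>) * (\<rho> \<bullet> u \<gamma>)"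
    by (simp only: inner_add_right inner_scaleR_right)
  moreover have "0 \<le> \<rho> \<bullet> (x - u x)"
    unfolding rho_expand using dominant_diff_coordinate[OF _ u(1)] assms(1)
    by (intro sum_nonneg) (simp add: dominant_def less_imp_le)
  moreover have "0 < (x \<bullet> coroot \<gamma>) * (\<rho> \<bullet> u \<gamma>)"
    using assms(1)[OF g(1)] rho_pos[OF u(2)] by (rule mult_pos_pos)
  moreover have "\<rho> \<bullet> (x - w x) = 0" using assms(3) by simp
  ultimately show False by linarith
qed

text \<open>Reflecting in a simple root on which x is negative removes that root from the finite set
  of positive roots with negative pairing and maps the remaining ones injectively, so their number
  drops.\<close>

lemma dominant_induct [case_names dominant step]:
  assumes "\<And>x. dominant x \<Longrightarrow> Q x"
    and "\<And>\<gamma> x. \<gamma> \<in> \<Delta> \<Longrightarrow> x \<bullet> coroot \<gamma> < 0 \<Longrightarrow> Q (s \<gamma> x) \<Longrightarrow> Q x"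
  shows "Q x"
proof (induct "card {\<alpha> \<in> pos. x \<bullet> coroot \<alpha> < 0}" arbitrary: x rule: less_induct)
  case less
  show ?case
  proof (cases "dominant x")
    case False
    then obtain \<gamma> where g: "\<gamma> \<in> \<Delta>" "x \<bullet> coroot \<gamma> < 0" by (auto simp: dominant_def not_le)
    have eq: "s \<gamma> x \<bullet> coroot \<alpha> = x \<bullet> coroot (s \<gamma> \<alpha>)" for \<alpha>
      by (simp add: reflection_inner_swap orthogonal_coroot[OF reflection_orthogonal])
    let ?A = "{\<alpha> \<in> pos. s \<gamma> x \<bullet> coroot \<alpha> < 0}" and ?B = "{\<alpha> \<in> pos. x \<bullet> coroot \<alpha> < 0}"
    have "\<gamma> \<notin> ?A"
      using g reflection_self[OF simple_nonzero[OF g(1)]] by (simp add: eq coroot_uminus)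
    then have "s \<gamma> ` ?A \<subseteq> ?B - {\<gamma>}"
      using bij_betwE[OF bij_betw_simple_reflection[OF g(1)]] by (auto simp: eq)
    then have "card (s \<gamma> ` ?A) < card ?B"
      using g simple_pos[OF g(1)] finite_pos by (intro psubset_card_mono) auto
    moreover have "card (s \<gamma> ` ?A) = card ?A"
      by (intro card_image inj_onI) (metis reflection_involution)
    ultimately have "Q (s \<gamma> x)" using less by simp
    then show ?thesis using assms(2) g by blast
  qed (rule assms(1))
qed

lemma ex_dominant: "\<exists>w\<in>W. dominant (w x)"
proof (induct x rule: dominant_induct)
  case (dominant x)
  then show ?case using W_id by (intro bexI[of _ id]) auto
next
  case (step \<gamma> x)
  then obtain w where "w \<in> W" "dominant (w (s \<gamma> x))" by blast
  then show ?case
    using W_comp W_reflection simple_root step(1) by (intro bexI[of _ "w \<circ> s \<gamma>"]) auto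
qed

lemma ex_longest: "\<exists>w\<in>W. \<forall>\<alpha>\<in>pos. w \<alpha> \<notin> pos"
proof -
  \<comment> \<open>The inverse of an element that carries \<open>- \<rho>\<close> into the dominant
    chamber makes every positive root negative.\<close>
  obtain w where w: "w \<in> W" "dominant (w (- \<rho>))" using ex_dominant by blast
  have "inv w \<alpha> \<notin> pos" if "\<alpha> \<in> pos" for \<alpha>
  proof
    assume "inv w \<alpha> \<in> pos"
    moreover have "0 \<le> w (- \<rho>) \<bullet> coroot \<alpha>" by (rule dominant_pos[OF w(2) that])
    ultimately show False
      using rho_inner_coroot_pos[of "inv w \<alpha>"] by (simp add: W_inner_coroot w(1))
  qed
  then show ?thesis using W_inv[OF w(1)] by blast
qed

text \<open>This is the determinant of \<open>w\<close>; counting inversions turns the sign rule for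
  simple reflections into a matter of parity.\<close>

definition sgn :: "('v \<Rightarrow> 'v) \<Rightarrow> int" where
  "sgn w = (-1) ^ card (inversions w)"

lemma sgn_id: "sgn id = 1"
  by (simp add: sgn_def inversions_def)

lemma sgn_right_simple:
  assumes "w \<in> W" "\<gamma> \<in> \<Delta>"
  shows "sgn (w \<circ> s \<gamma>) = - sgn w"
proof (cases "w \<gamma> \<in> pos")
  case True
  then show ?thesis using card_inversions_simple[OF assms] by (simp add: sgn_def)
next
  case False
  then show ?thesis using card_inversions_simple[OF assms, symmetric] by (simp add: sgn_def)
qed

lemma inversions_inv: assumes "w \<in> W" shows "card (inversions (inv w)) = card (inversions w)"
proof -
  have "bij_betw (\<lambda>\<alpha>. - w \<alpha>) (inversions w) (inversions (inv w))"
  proof (rule bij_betwI[where g = "\<lambda>\<alpha>. - inv w \<alpha>"])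
    have *: "- u \<alpha> \<in> inversions (inv u)" if "\<alpha> \<in> inversions u" "u \<in> W" for u \<alpha>
      using that pos_root W_root[of u \<alpha>] pos_uminus_iff[of "u \<alpha>"] W_inv_apply[of u] not_pos_uminus[of \<alpha>]
      by (auto simp: inversions_def W_uminus[OF W_inv])
    show "(\<lambda>\<alpha>. - w \<alpha>) \<in> inversions w \<rightarrow> inversions (inv w)" using * assms by blast
    show "(\<lambda>\<alpha>. - inv w \<alpha>) \<in> inversions (inv w) \<rightarrow> inversions w"
      using *[of _ "inv w"] W_inv[OF assms] W_inv_inv[OF assms] by auto
  qed (use assms in \<open>simp_all add: W_uminus W_inv W_inv_apply W_apply_inv\<close>)
  then show ?thesis by (simp add: bij_betw_same_card)
qed

lemma sgn_left_simple: assumes "w \<in> W" "\<gamma> \<in> \<Delta>" shows "sgn (s \<gamma> \<circ> w) = - sgn w"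
proof -
  have sW: "s \<gamma> \<in> W" using assms(2) by (intro W_reflection simple_root)
  have "inv (s \<gamma> \<circ> w) = inv w \<circ> s \<gamma>"
    using o_inv_distrib[OF W_bij[OF sW] W_bij[OF assms(1)]] by (simp add: inv_reflection)
  then have "sgn (s \<gamma> \<circ> w) = sgn (inv w \<circ> s \<gamma>)"
    using inversions_inv[OF W_comp[OF sW assms(1)]] by (simp add: sgn_def)
  also have "\<dots> = - sgn w"
    using sgn_right_simple[OF W_inv[OF assms(1)] assms(2)] inversions_inv[OF assms(1)] by (simp add: sgn_def)
  finally show ?thesis .
qed

section \<open>Lengths in the affine Weyl group\<close>

abbreviation "lng \<equiv> weyl_length R \<Delta>"

text \<open>The length of \<open>(u, x)\<close> counts affine hyperplanes between alcoves. This is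
  the signed number of those orthogonal to \<open>\<alpha>\<close>, between the images of the
  fundamental alcove under \<open>inv u\<close> and under translation by \<open>x\<close>. The
  correction term merges the two sums of the length formula into one.\<close>

definition cross :: "('v \<Rightarrow> 'v) \<Rightarrow> 'v \<Rightarrow> 'v \<Rightarrow> int" where
  "cross u x \<alpha> = pairing x \<alpha> + (if u \<alpha> \<in> pos then 0 else 1)"

lemma weyl_length_cross:
  assumes "u \<in> W" shows "int (lng (u, x)) = (\<Sum>\<alpha>\<in>pos. \<bar>cross u x \<alpha>\<bar>)"
proof -
  have neg: "{\<alpha> \<in> pos. - u \<alpha> \<in> pos} = {\<alpha> \<in> pos. u \<alpha> \<notin> pos}"
    using pos_uminus_iff[OF W_root[OF assms pos_root]] by auto
  have "(\<Sum>\<alpha>\<in>pos. \<bar>cross u x \<alpha>\<bar>) =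
      (\<Sum>\<alpha>\<in>{\<alpha> \<in> pos. u \<alpha> \<notin> pos}. \<bar>cross u x \<alpha>\<bar>) + (\<Sum>\<alpha>\<in>{\<alpha> \<in> pos. u \<alpha> \<in> pos}. \<bar>cross u x \<alpha>\<bar>)"
    using finite_pos by (subst sum.union_disjoint[symmetric]) (auto intro!: sum.cong)
  also have "\<dots> = int (lng (u, x))"
    by (simp add: weyl_length_def neg cross_def cong: conj_cong)
  finally show ?thesis by simp
qed

lemma pairing_zero: "pairing 0 \<alpha> = 0"
  by (simp add: pairing_def)

lemma pairing_add: "x \<in> P \<Longrightarrow> y \<in> P \<Longrightarrow> \<alpha> \<in> R \<Longrightarrow> pairing (x + y) \<alpha> = pairing x \<alpha> + pairing y \<alpha>"
  using pairing_P[of x \<alpha>] pairing_P[of y \<alpha>] pairing_P[of "x + y" \<alpha>] P_add[of x y]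
  by (simp add: inner_add_left flip: of_int_eq_iff[where 'a = real])

lemma pairing_uminus: "x \<in> P \<Longrightarrow> \<alpha> \<in> R \<Longrightarrow> pairing (- x) \<alpha> = - pairing x \<alpha>"
  using pairing_P[of x \<alpha>] pairing_P[of "- x" \<alpha>] P_uminus[of x]
  by (simp flip: of_int_eq_iff[where 'a = real])

lemma pairing_diff: "x \<in> P \<Longrightarrow> y \<in> P \<Longrightarrow> \<alpha> \<in> R \<Longrightarrow> pairing (x - y) \<alpha> = pairing x \<alpha> - pairing y \<alpha>"
  using pairing_add[of x "- y" \<alpha>] pairing_uminus[of y \<alpha>] P_uminus[of y] by simp

lemma pairing_uminus_root: "x \<in> P \<Longrightarrow> \<alpha> \<in> R \<Longrightarrow> pairing x (- \<alpha>) = - pairing x \<alpha>"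
  using pairing_P[of x \<alpha>] pairing_P[of x "- \<alpha>"] root_uminus[of \<alpha>]
  by (simp add: coroot_uminus flip: of_int_eq_iff[where 'a = real])

lemma pairing_W: "w \<in> W \<Longrightarrow> pairing (w x) \<alpha> = pairing x (inv w \<alpha>)"
  by (simp add: pairing_def W_inner_coroot)

lemma pairing_reflection: "pairing (s \<gamma> x) \<alpha> = pairing x (s \<gamma> \<alpha>)"
  by (simp add: pairing_def reflection_inner_swap orthogonal_coroot[OF reflection_orthogonal])

lemma pairing_self: "\<alpha> \<in> R \<Longrightarrow> pairing \<alpha> \<alpha> = 2"
  by (simp add: pairing_def coroot_inner_self root_nonzero)

lemma pairing_eq_iff: "x \<in> P \<Longrightarrow> \<alpha> \<in> R \<Longrightarrow> pairing x \<alpha> = k \<longleftrightarrow> x \<bullet> coroot \<alpha> = of_int k"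
  using pairing_P[of x \<alpha>] by (metis of_int_eq_iff)

lemma pairing_nonneg_iff: "x \<in> P \<Longrightarrow> \<alpha> \<in> R \<Longrightarrow> 0 \<le> pairing x \<alpha> \<longleftrightarrow> 0 \<le> x \<bullet> coroot \<alpha>"
  by (simp add: pairing_def)

lemma dominant_pairing: "dominant x \<Longrightarrow> \<alpha> \<in> pos \<Longrightarrow> 0 \<le> pairing x \<alpha>"
  using dominant_pos by (simp add: pairing_def)

lemma cross_right_simple_self:
  assumes "u \<in> W" "x \<in> P" "\<gamma> \<in> \<Delta>"
  shows "cross (u \<circ> s \<gamma>) (s \<gamma> x) \<gamma> = 1 - cross u x \<gamma>"
  using assms W_simple_neg[OF assms(1,3)] pairing_uminus_root[OF assms(2) simple_root[OF assms(3)]]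
  unfolding cross_def by (simp add: pairing_reflection reflection_self simple_nonzero)

text \<open>Right multiplication by \<open>(s \<gamma>, 0)\<close> permutes the contributions of the
  positive roots other than \<open>\<gamma>\<close> and replaces the contribution c of
  \<open>\<gamma>\<close> by 1 - c. So \<open>\<gamma>\<close> is a right descent exactly if c is at
  least 1.\<close>

lemma lng_right_simple:
  assumes "u \<in> W" "x \<in> P" "\<gamma> \<in> \<Delta>"
  shows "int (lng (u \<circ> s \<gamma>, s \<gamma> x)) = int (lng (u, x)) + (if 1 \<le> cross u x \<gamma> then - 1 else 1)"
proof -
  have W: "u \<circ> s \<gamma> \<in> W" using assms by (intro W_comp W_reflection simple_root)
  have g: "\<gamma> \<in> pos" using simple_pos[OF assms(3)] .
  have "(\<Sum>\<alpha>\<in>pos - {\<gamma>}. \<bar>cross (u \<circ> s \<gamma>) (s \<gamma> x) \<alpha>\<bar>) = (\<Sum>\<alpha>\<in>pos - {\<gamma>}. \<bar>cross u x (s \<gamma> \<alpha>)\<bar>)"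
    by (rule sum.cong) (simp_all add: cross_def pairing_reflection)
  also have "\<dots> = (\<Sum>\<alpha>\<in>pos - {\<gamma>}. \<bar>cross u x \<alpha>\<bar>)"
    by (rule sum.reindex_bij_betw[OF bij_betw_simple_reflection[OF assms(3)]])
  finally have eq: "(\<Sum>\<alpha>\<in>pos - {\<gamma>}. \<bar>cross (u \<circ> s \<gamma>) (s \<gamma> x) \<alpha>\<bar>) = (\<Sum>\<alpha>\<in>pos - {\<gamma>}. \<bar>cross u x \<alpha>\<bar>)" .
  show ?thesis
    unfolding weyl_length_cross[OF W] weyl_length_cross[OF assms(1)] sum.remove[OF finite_pos g] eq
      cross_right_simple_self[OF assms]
    by auto
qed

lemma lng_finite: assumes "w \<in> W" shows "lng (w, 0) = card (inversions w)"
proof -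
  have "int (lng (w, 0)) = (\<Sum>\<alpha>\<in>pos. if w \<alpha> \<notin> pos then 1 else 0)"
    unfolding weyl_length_cross[OF assms] by (rule sum.cong) (simp_all add: cross_def pairing_zero)
  then show ?thesis using finite_pos by (simp add: inversions_def sum.If_cases Int_def)
qed

text \<open>The maximal length is attained exactly where all positive roots are inverted, and two
  such elements differ by one that preserves positivity. This gives meaning to the definite
  description in \<open>longest_element\<close>.\<close>

lemma longest: "longest_element R \<Delta> \<in> W" "inversions (longest_element R \<Delta>) = pos"
proof -
  obtain w0 where w0: "w0 \<in> W" "\<forall>\<alpha>\<in>pos. w0 \<alpha> \<notin> pos" using ex_longest by blast
  have i0: "inversions w0 = pos" using w0(2) by (auto simp: inversions_def)
  have sub: "inversions w \<subseteq> pos" for w by (auto simp: inversions_def)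
  have le: "card (inversions w) \<le> card pos" for w using card_mono[OF finite_pos sub] .
  have max: "inversions w = pos" if "w \<in> W" "\<forall>u\<in>W. lng (u, 0) \<le> lng (w, 0)" for w
  proof -
    have "card pos \<le> card (inversions w)" using that w0(1) i0 by (metis lng_finite)
    then show ?thesis using card_subset_eq[OF finite_pos sub[of w]] le[of w] by linarith
  qed
  have "w = w0" if w: "w \<in> W" "inversions w = pos" for w
  proof -
    have "inversions (inv w) = pos"
      using inversions_inv[OF w(1)] w(2) card_subset_eq[OF finite_pos sub[of "inv w"]] by simp
    then have neg: "inv w \<alpha> \<notin> pos" if "\<alpha> \<in> pos" for \<alpha> using that by (auto simp: inversions_def)
    have "inv w \<circ> w0 = id"
    proof (rule W_eq_id)
      show "inv w \<circ> w0 \<in> W" using w(1) w0(1) by (intro W_comp W_inv)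
      fix \<gamma> assume g: "\<gamma> \<in> \<Delta>"
      have "- w0 \<gamma> \<in> pos" "- w0 \<gamma> \<in> R"
        using w0 simple_pos[OF g] pos_uminus_iff W_root[OF w0(1) simple_root[OF g]] root_uminus by auto
      from neg[OF this(1)] pos_uminus_iff[OF W_root[OF W_inv[OF w(1)] this(2)]]
      show "(inv w \<circ> w0) \<gamma> \<in> pos" by (simp add: W_uminus[OF W_inv[OF w(1)]])
    qed
    then have "w \<circ> (inv w \<circ> w0) = w" by (simp only: comp_id)
    then show "w = w0" by (simp only: comp_assoc[symmetric] W_comp_inv[OF w(1)] id_comp)
  qed
  moreover have "lng (u, 0) \<le> lng (w0, 0)" if "u \<in> W" for u
    using le[of u] i0 by (simp add: lng_finite that w0(1))
  ultimately have "longest_element R \<Delta> = w0"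
    unfolding longest_element_def using w0(1) max by (intro the_equality) blast+
  then show "longest_element R \<Delta> \<in> W" "inversions (longest_element R \<Delta>) = pos"
    using w0(1) i0 by auto
qed

lemma lng_dominant:
  assumes "w \<in> W" "x \<in> P" "dominant x"
  shows "lng (w, x) = lng (w, 0) + lng (id, x)"
proof -
  have "(\<Sum>\<alpha>\<in>pos. \<bar>cross w x \<alpha>\<bar>) = (\<Sum>\<alpha>\<in>pos. \<bar>cross w 0 \<alpha>\<bar> + \<bar>cross id x \<alpha>\<bar>)"
    using dominant_pairing[OF assms(3)] by (intro sum.cong) (auto simp: cross_def pairing_zero)
  then show ?thesis
    unfolding of_nat_eq_iff[where 'a = int, symmetric] of_nat_add weyl_length_cross[OF assms(1)]
      weyl_length_cross[OF W_id] by (simp add: sum.distrib)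
qed

text \<open>Dominance was defined through lengths. Root by root, the defect
  \<open>1 + \<bar>p\<bar> - \<bar>p + 1\<bar>\<close> is nonnegative and vanishes only for
  nonnegative integers p, so equality of the sums decides every term.\<close>

lemma dominant_weights_eq: "dominant_weights R \<Delta> = {x \<in> P. dominant x}"
proof -
  let ?w = "longest_element R \<Delta>"
  have "dominant x" if x: "x \<in> P" and eq: "lng (?w, x) = lng (?w, 0) + lng (id, x)" for x
  proof -
    have neg: "?w \<alpha> \<notin> pos" if "\<alpha> \<in> pos" for \<alpha> using that longest(2) by (auto simp: inversions_def)
    have "(\<Sum>\<alpha>\<in>pos. \<bar>cross ?w x \<alpha>\<bar>) = (\<Sum>\<alpha>\<in>pos. \<bar>cross ?w 0 \<alpha>\<bar> + \<bar>cross id x \<alpha>\<bar>)"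
      using arg_cong[OF eq, of int]
      unfolding of_nat_add weyl_length_cross[OF longest(1)] weyl_length_cross[OF W_id] sum.distrib .
    also have "\<dots> = (\<Sum>\<alpha>\<in>pos. 1 + \<bar>pairing x \<alpha>\<bar>)"
      using neg by (intro sum.cong) (auto simp: cross_def pairing_zero)
    also have "(\<Sum>\<alpha>\<in>pos. \<bar>cross ?w x \<alpha>\<bar>) = (\<Sum>\<alpha>\<in>pos. \<bar>pairing x \<alpha> + 1\<bar>)"
      using neg by (intro sum.cong) (auto simp: cross_def)
    finally have "(\<Sum>\<alpha>\<in>pos. 1 + \<bar>pairing x \<alpha>\<bar> - \<bar>pairing x \<alpha> + 1\<bar>) = 0"
      by (simp add: sum_subtractf)
    moreover have "0 \<le> 1 + \<bar>pairing x \<alpha>\<bar> - \<bar>pairing x \<alpha> + 1\<bar>" for \<alpha> by linarith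
    ultimately have "1 + \<bar>pairing x \<alpha>\<bar> - \<bar>pairing x \<alpha> + 1\<bar> = 0" if "\<alpha> \<in> pos" for \<alpha>
      using that by (subst (asm) sum_nonneg_eq_0_iff[OF finite_pos]) auto
    then have "0 \<le> pairing x \<alpha>" if "\<alpha> \<in> pos" for \<alpha> using that by fastforce
    then show ?thesis
      using pairing_nonneg_iff[OF x] simple_pos pos_root by (auto simp: dominant_def)
  qed
  then show ?thesis using lng_dominant[OF longest(1)] by (auto simp: dominant_weights_def)
qed

lemma lng_dominant_add:
  assumes "x \<in> P" "dominant x" "y \<in> P" "dominant y"
  shows "lng (id, x + y) = lng (id, x) + lng (id, y)"
proof -
  have "(\<Sum>\<alpha>\<in>pos. \<bar>cross id (x + y) \<alpha>\<bar>) = (\<Sum>\<alpha>\<in>pos. \<bar>cross id x \<alpha>\<bar> + \<bar>cross id y \<alpha>\<bar>)"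
    using dominant_pairing[OF assms(2)] dominant_pairing[OF assms(4)]
    by (intro sum.cong) (auto simp: cross_def pairing_add assms pos_root)
  then show ?thesis
    unfolding of_nat_eq_iff[where 'a = int, symmetric] of_nat_add weyl_length_cross[OF W_id]
    by (simp add: sum.distrib)
qed

text \<open>\<open>(inv u, - u x)\<close> is the inverse of \<open>(u, x)\<close>; thus the elements
  of length zero are closed under inversion.\<close>

lemma cross_inverse:
  assumes "u \<in> W" "x \<in> P" "\<And>\<alpha>. \<alpha> \<in> pos \<Longrightarrow> cross u x \<alpha> = 0" "\<alpha> \<in> pos"
  shows "cross (inv u) (- u x) \<alpha> = 0"
proof -
  let ?\<alpha>' = "inv u \<alpha>"
  have R: "?\<alpha>' \<in> R" by (rule W_root[OF W_inv[OF assms(1)] pos_root[OF assms(4)]])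
  have "pairing (- u x) \<alpha> = - pairing x ?\<alpha>'"
    using pairing_uminus[OF W_P[OF assms(1,2)] pos_root[OF assms(4)]] pairing_W[OF assms(1)] by simp
  moreover have "u ?\<alpha>' = \<alpha>" using W_apply_inv[OF assms(1)] .
  moreover have "- \<alpha> \<notin> pos" using not_pos_uminus[OF assms(4)] .
  ultimately show ?thesis
    using assms(3)[of ?\<alpha>'] assms(3)[of "- ?\<alpha>'"] assms(4) pos_or_neg[OF R] not_pos_uminus[of ?\<alpha>']
      pairing_uminus_root[OF assms(2) R] by (auto simp: cross_def W_uminus[OF assms(1)])
qed

lemma simple_inner_nonpos: assumes "\<gamma> \<in> \<Delta>" "\<delta> \<in> \<Delta>" "\<gamma> \<noteq> \<delta>" shows "\<gamma> \<bullet> \<delta> \<le> 0"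
proof -
  have "0 \<le> \<omega> \<gamma> \<bullet> s \<gamma> \<delta>"
    using assms by (intro pos_coordinate simple_reflection_pos simple_pos) auto
  then have "(\<delta> \<bullet> coroot \<gamma>) * (\<gamma> \<bullet> \<gamma>) \<le> 0"
    using assms by (simp add: reflection_def inner_diff_right fundamental_weight_inner_simple)
  then show ?thesis using simple_nonzero[OF assms(1)] by (simp add: inner_coroot inner_commute)
qed

lemma dominant_root_pos: assumes "\<alpha> \<in> R" "dominant \<alpha>" shows "\<alpha> \<in> pos"
proof (rule ccontr)
  assume "\<alpha> \<notin> pos"
  then have "- \<alpha> \<in> pos" using pos_or_neg[OF assms(1)] by blast
  from dominant_pos[OF assms(2) this] show False
    using coroot_inner_self[OF root_nonzero[OF assms(1)]] by (simp add: coroot_uminus)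
qed

lemma coroot_coordinate_nonneg: "\<alpha> \<in> pos \<Longrightarrow> 0 \<le> \<omega> \<gamma> \<bullet> coroot \<alpha>"
  using pos_coordinate pos_nonzero inner_coroot_nonneg_iff by blast

lemma pos_iff_rho_coroot: "\<alpha> \<in> R \<Longrightarrow> \<alpha> \<in> pos \<longleftrightarrow> 0 < \<rho> \<bullet> coroot \<alpha>"
  using pos_iff_rho inner_coroot_pos_iff root_nonzero by metis

end

section \<open>The highest coroot, the affine reflection and elements of length zero\<close>

locale irreducible_based_root_system = based_root_system R \<Delta>
  for R \<Delta> :: "'v::euclidean_space set" +
  assumes irreducible: "irreducible_root_system R"
begin

text \<open>If the support \<open>S\<close> of a dominant root were proper, the simple roots outside
  it would be orthogonal to those in \<open>S\<close>, and the roots supported in \<open>S\<close>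
  and those supported outside would split the root system, against irreducibility.\<close>

lemma dominant_root_coordinate:
  assumes "\<alpha> \<in> R" "dominant \<alpha>" "\<gamma> \<in> \<Delta>"
  shows "0 < \<omega> \<gamma> \<bullet> \<alpha>"
proof (rule ccontr)
  define S where "S = {\<gamma> \<in> \<Delta>. 0 < \<omega> \<gamma> \<bullet> \<alpha>}"
  have apos: "\<alpha> \<in> pos" using dominant_root_pos assms by blast
  have zero: "\<omega> \<delta> \<bullet> \<alpha> = 0" if "\<delta> \<in> \<Delta> - S" for \<delta>
    using that pos_coordinate[OF apos, of \<delta>] by (auto simp: S_def)
  assume "\<not> 0 < \<omega> \<gamma> \<bullet> \<alpha>"
  then have gS: "\<gamma> \<in> \<Delta> - S" using assms(3) by (simp add: S_def)
  \<comment> \<open>For \<open>\<delta>\<close> outside the support every summand of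
    \<open>\<delta> \<bullet> \<alpha>\<close> is nonpositive, because distinct simple roots do not
    form acute angles, whereas dominance makes the total nonnegative. So each summand
    vanishes.\<close>
  have orth: "\<delta> \<bullet> \<epsilon> = 0" if "\<delta> \<in> \<Delta> - S" "\<epsilon> \<in> S" for \<delta> \<epsilon>
  proof -
    have "\<delta> \<bullet> \<alpha> = (\<Sum>\<eta>\<in>\<Delta>. (\<delta> \<bullet> coroot \<eta>) * (\<omega> \<eta> \<bullet> \<alpha>))" by (rule inner_expand)
    also have "\<dots> = (\<Sum>\<eta>\<in>S. (\<delta> \<bullet> coroot \<eta>) * (\<omega> \<eta> \<bullet> \<alpha>))"
      using zero finite_simple by (intro sum.mono_neutral_right) (auto simp: S_def)
    finally have sum: "\<delta> \<bullet> \<alpha> = (\<Sum>\<eta>\<in>S. (\<delta> \<bullet> coroot \<eta>) * (\<omega> \<eta> \<bullet> \<alpha>))" .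
    have nonpos: "(\<delta> \<bullet> coroot \<eta>) * (\<omega> \<eta> \<bullet> \<alpha>) \<le> 0" if "\<eta> \<in> S" for \<eta>
    proof (rule mult_nonpos_nonneg)
      show "\<delta> \<bullet> coroot \<eta> \<le> 0"
        using simple_inner_nonpos[of \<delta> \<eta>] that \<open>\<delta> \<in> \<Delta> - S\<close> simple_nonzero[of \<eta>]
        by (auto simp: S_def inner_coroot divide_le_0_iff)
    qed (use pos_coordinate[OF apos] in simp)
    have "0 \<le> \<alpha> \<bullet> coroot \<delta>" using dominantD[OF assms(2)] that(1) by blast
    then have "0 \<le> \<delta> \<bullet> \<alpha>"
      using inner_coroot_nonneg_iff[of \<delta> \<alpha>] simple_nonzero[of \<delta>] that(1) by (simp add: inner_commute)
    then have "(\<Sum>\<eta>\<in>S. - ((\<delta> \<bullet> coroot \<eta>) * (\<omega> \<eta> \<bullet> \<alpha>))) = 0"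
      using sum sum_nonpos[of S "\<lambda>\<eta>. (\<delta> \<bullet> coroot \<eta>) * (\<omega> \<eta> \<bullet> \<alpha>)"] nonpos by (simp add: sum_negf)
    then have "(\<delta> \<bullet> coroot \<epsilon>) * (\<omega> \<epsilon> \<bullet> \<alpha>) = 0"
      using nonpos that(2) finite_simple by (subst (asm) sum_nonneg_eq_0_iff) (auto simp: S_def)
    then show ?thesis using that(2) simple_nonzero[of \<epsilon>] by (auto simp: S_def inner_coroot)
  qed
  define A where "A = {\<beta> \<in> R. \<forall>\<delta>\<in>\<Delta> - S. \<omega> \<delta> \<bullet> \<beta> = 0}"
  define B where "B = {\<beta> \<in> R. \<forall>\<delta>\<in>S. \<omega> \<delta> \<bullet> \<beta> = 0}"
  have A_orth: "\<delta> \<bullet> \<beta> = 0" if "\<beta> \<in> A" "\<delta> \<in> \<Delta> - S" for \<beta> \<delta>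
    unfolding inner_expand[of \<delta> \<beta>]
  proof (rule sum.neutral, rule ballI)
    fix \<eta> assume "\<eta> \<in> \<Delta>"
    then show "(\<delta> \<bullet> coroot \<eta>) * (\<omega> \<eta> \<bullet> \<beta>) = 0"
      using that orth[of \<delta> \<eta>] by (cases "\<eta> \<in> S") (auto simp: A_def inner_coroot)
  qed
  have B_orth: "\<delta> \<bullet> \<beta> = 0" if "\<beta> \<in> B" "\<delta> \<in> S" for \<beta> \<delta>
    unfolding inner_expand[of \<delta> \<beta>]
  proof (rule sum.neutral, rule ballI)
    fix \<eta> assume "\<eta> \<in> \<Delta>"
    then show "(\<delta> \<bullet> coroot \<eta>) * (\<omega> \<eta> \<bullet> \<beta>) = 0"
      using that orth[of \<eta> \<delta>] by (cases "\<eta> \<in> S") (auto simp: B_def inner_coroot inner_commute)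
  qed
  \<comment> \<open>Induction on height: reflecting in a simple root of the same side keeps the
    support on that side, and reflecting in one of the other side changes nothing.\<close>
  have pos_AB: "\<beta> \<in> A \<union> B" if "\<beta> \<in> pos" for \<beta>
    using that
  proof (induct rule: pos_induct)
    case (simple \<delta>)
    then show ?case
      using simple_root[OF simple] by (cases "\<delta> \<in> S") (auto simp: A_def B_def fundamental_weight_inner_simple)
  next
    case (step \<beta> \<delta>)
    have coord: "\<omega> \<eta> \<bullet> s \<delta> \<beta> = \<omega> \<eta> \<bullet> \<beta>" if "\<eta> \<noteq> \<delta>" for \<eta>
      using that step(2) by (simp add: reflection_def inner_diff_right fundamental_weight_inner_simple)
    have fixd: "\<beta> = s \<delta> \<beta>" if "\<delta> \<bullet> s \<delta> \<beta> = 0"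
    proof -
      have "s \<delta> \<beta> \<bullet> \<delta> = 0" using that by (subst inner_commute)
      then have "s \<delta> \<beta> \<bullet> coroot \<delta> = 0" unfolding inner_coroot by (simp only: mult_zero_right div_0)
      from reflection_fixed[OF this] show ?thesis unfolding reflection_involution .
    qed
    have bR: "\<beta> \<in> R" using pos_root step(1) by blast
    from step(6) show ?case
    proof
      assume a: "s \<delta> \<beta> \<in> A"
      show ?thesis
      proof (cases "\<delta> \<in> S")
        case True
        have "\<omega> \<eta> \<bullet> \<beta> = 0" if "\<eta> \<in> \<Delta> - S" for \<eta>
          using a that coord[of \<eta>] True by (auto simp: A_def)
        then show ?thesis using bR by (simp add: A_def)
      next
        case False
        then have "\<delta> \<bullet> s \<delta> \<beta> = 0" using A_orth[OF a] step(2) by blast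
        then show ?thesis using fixd a by (metis UnI1)
      qed
    next
      assume b: "s \<delta> \<beta> \<in> B"
      show ?thesis
      proof (cases "\<delta> \<in> S")
        case True
        then have "\<delta> \<bullet> s \<delta> \<beta> = 0" using B_orth[OF b] by blast
        then show ?thesis using fixd b by (metis UnI2)
      next
        case False
        have "\<omega> \<eta> \<bullet> \<beta> = 0" if "\<eta> \<in> S" for \<eta>
          using b that coord[of \<eta>] False by (auto simp: B_def)
        then show ?thesis using bR by (simp add: B_def)
      qed
    qed
  qed
  have "A \<union> B = R"
  proof
    show "R \<subseteq> A \<union> B"
    proof
      fix \<beta> assume b: "\<beta> \<in> R"
      show "\<beta> \<in> A \<union> B"
        using pos_or_neg[OF b] pos_AB[of \<beta>] pos_AB[of "- \<beta>"] b by (auto simp: A_def B_def)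
    qed
  qed (auto simp: A_def B_def)
  moreover have "A \<noteq> {}" using zero assms(1) by (auto simp: A_def)
  moreover have "\<gamma> \<in> B"
    using gS simple_root by (auto simp: B_def fundamental_weight_inner_simple)
  moreover have "a \<bullet> b = 0" if "a \<in> A" "b \<in> B" for a b
    unfolding inner_expand[of a b]
  proof (rule sum.neutral, rule ballI)
    fix \<eta> assume "\<eta> \<in> \<Delta>"
    then show "(a \<bullet> coroot \<eta>) * (\<omega> \<eta> \<bullet> b) = 0"
      using that A_orth[of a \<eta>] by (cases "\<eta> \<in> S") (auto simp: B_def inner_coroot inner_commute)
  qed
  ultimately show False using irreducible unfolding irreducible_root_system_def by blast
qed

lemma dominant_roots_inner_pos:
  assumes "\<alpha> \<in> R" "dominant \<alpha>" "\<beta> \<in> R" "dominant \<beta>"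
  shows "0 < \<alpha> \<bullet> \<beta>"
proof -
  have "\<exists>\<gamma>\<in>\<Delta>. \<alpha> \<bullet> coroot \<gamma> \<noteq> 0"
    using eq_if_inner_simple_eq[of \<alpha> 0] root_nonzero[OF assms(1)] by auto
  then obtain \<gamma> where g: "\<gamma> \<in> \<Delta>" "0 < \<alpha> \<bullet> coroot \<gamma>"
    using dominantD[OF assms(2)] by (auto simp: less_le)
  show ?thesis
    unfolding inner_expand[of \<alpha> \<beta>]
    using g dominantD[OF assms(2)] dominant_root_coordinate[OF assms(3,4)] finite_simple
    by (intro sum_pos2[of \<Delta> \<gamma>]) (auto simp: less_imp_le)
qed

definition short_dominant :: "'v \<Rightarrow> bool" where
  "short_dominant \<beta> \<longleftrightarrow> \<beta> \<in> R \<and> (\<forall>\<alpha>\<in>R. norm \<beta> \<le> norm \<alpha>) \<and> dominant \<beta>"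

text \<open>The square norm of \<open>\<alpha> - \<beta>\<close> is positive and
  \<open>\<beta>\<close> is not longer than \<open>\<alpha>\<close>; this bounds the pairing
  strictly by 2, and it is an integer.\<close>

lemma short_pairing:
  assumes "\<beta> \<in> R" "\<forall>\<alpha>\<in>R. norm \<beta> \<le> norm \<alpha>" "\<alpha> \<in> R" "\<alpha> \<noteq> \<beta>"
  shows "\<beta> \<bullet> coroot \<alpha> \<le> 1"
proof -
  obtain k where k: "\<beta> \<bullet> coroot \<alpha> = of_int k" using root_integral[OF assms(3,1)] by (elim Ints_cases)
  have pos: "0 < \<alpha> \<bullet> \<alpha>" using root_nonzero[OF assms(3)] by simp
  have nn: "\<beta> \<bullet> \<beta> \<le> \<alpha> \<bullet> \<alpha>" using assms(2,3) by (simp add: norm_le)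
  have "0 < (\<alpha> - \<beta>) \<bullet> (\<alpha> - \<beta>)" using assms(4) by simp
  then have "2 * (\<beta> \<bullet> \<alpha>) < \<alpha> \<bullet> \<alpha> + \<beta> \<bullet> \<beta>"
    unfolding inner_diff_left inner_diff_right by (simp add: inner_commute)
  then have "2 * (\<beta> \<bullet> \<alpha>) < 2 * (\<alpha> \<bullet> \<alpha>)" using nn by linarith
  then have "\<beta> \<bullet> coroot \<alpha> < 2" using pos by (simp add: inner_coroot field_simps)
  then show ?thesis using k by simp
qed

text \<open>Dominant roots pair positively, here to 1, so reflecting \<open>\<alpha>\<close> in
  \<open>\<beta>\<close> gives a root with coroot \<open>coroot \<alpha> - coroot \<beta>\<close>.
  Were that root positive, \<open>coroot \<alpha>\<close> would be longer than
  \<open>coroot \<beta>\<close>, although a shortest root has a longest coroot.\<close>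

lemma short_dominant_highest_dominant:
  assumes "short_dominant \<beta>" "\<alpha> \<in> R" "dominant \<alpha>"
  shows "\<omega> \<gamma> \<bullet> coroot \<alpha> \<le> \<omega> \<gamma> \<bullet> coroot \<beta>"
proof (cases "\<alpha> = \<beta>")
  case False
  have b: "\<beta> \<in> R" "\<forall>\<alpha>\<in>R. norm \<beta> \<le> norm \<alpha>" "dominant \<beta>" using assms(1) by (auto simp: short_dominant_def)
  have "0 < \<beta> \<bullet> coroot \<alpha>"
    using dominant_roots_inner_pos[OF b(1,3) assms(2,3)] inner_coroot_pos_iff root_nonzero[OF assms(2)] by blast
  moreover obtain k where "\<beta> \<bullet> coroot \<alpha> = of_int k" using root_integral[OF assms(2) b(1)] by (elim Ints_cases)
  ultimately have one: "\<beta> \<bullet> coroot \<alpha> = 1" using short_pairing[OF b(1,2) assms(2) False] by simp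
  have swap: "(coroot \<alpha> \<bullet> coroot \<beta>) *\<^sub>R \<beta> = (\<beta> \<bullet> coroot \<alpha>) *\<^sub>R coroot \<beta>"
    by (simp add: coroot_def inner_commute)
  define \<delta> where "\<delta> = s \<beta> \<alpha>"
  have "coroot \<delta> = s \<beta> (coroot \<alpha>)"
    by (simp only: \<delta>_def orthogonal_coroot[OF reflection_orthogonal])
  also have "\<dots> = coroot \<alpha> - (coroot \<alpha> \<bullet> coroot \<beta>) *\<^sub>R \<beta>" by (rule reflection_def)
  finally have cd: "coroot \<delta> = coroot \<alpha> - coroot \<beta>" by (simp only: swap one scaleR_one)
  have dR: "\<delta> \<in> R" unfolding \<delta>_def by (rule reflection_root[OF b(1) assms(2)])
  have "\<delta> \<notin> pos"
  proof
    assume "\<delta> \<in> pos"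
    from dominant_pos[OF b(3) this] have "0 \<le> coroot \<beta> \<bullet> coroot \<delta>"
      by (simp add: coroot_def[of \<beta>])
    moreover have "0 < coroot \<delta> \<bullet> coroot \<delta>" using root_nonzero[OF dR] by (simp add: coroot_def)
    moreover have "coroot \<alpha> = coroot \<beta> + coroot \<delta>" using cd by simp
    then have "coroot \<alpha> \<bullet> coroot \<alpha> = coroot \<beta> \<bullet> coroot \<beta> + 2 * (coroot \<beta> \<bullet> coroot \<delta>) + coroot \<delta> \<bullet> coroot \<delta>"
      by (simp add: inner_add_left inner_add_right inner_commute[of "coroot \<delta>" "coroot \<beta>"])
    ultimately have "coroot \<beta> \<bullet> coroot \<beta> < coroot \<alpha> \<bullet> coroot \<alpha>" by linarith
    moreover have norm: "coroot \<alpha> \<bullet> coroot \<alpha> = 4 / (\<alpha> \<bullet> \<alpha>)" if "\<alpha> \<noteq> 0" for \<alpha> :: 'v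
      using that by (simp add: coroot_def)
    moreover have "4 / (\<alpha> \<bullet> \<alpha>) \<le> 4 / (\<beta> \<bullet> \<beta>)"
      using b(2) assms(2) root_nonzero[OF b(1)] root_nonzero[OF assms(2)]
      by (intro divide_left_mono mult_pos_pos) (auto simp: norm_le)
    ultimately show False using root_nonzero[OF b(1)] root_nonzero[OF assms(2)] by simp
  qed
  then have "- \<delta> \<in> pos" using pos_or_neg[OF dR] by blast
  then have "0 \<le> \<omega> \<gamma> \<bullet> coroot (- \<delta>)" by (rule coroot_coordinate_nonneg)
  then show ?thesis by (simp add: coroot_uminus cd inner_diff_right)
qed simp

lemma short_dominant_highest:
  assumes "short_dominant \<beta>" "\<alpha> \<in> R"
  shows "\<omega> \<gamma> \<bullet> coroot \<alpha> \<le> \<omega> \<gamma> \<bullet> coroot \<beta>"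
proof -
  obtain w where w: "w \<in> W" "dominant (w \<alpha>)" using ex_dominant by blast
  have "dominant (coroot (w \<alpha>))"
    using w(2) by (auto simp: dominant_def coroot_def[of "w \<alpha>"])
  from dominant_diff_coordinate[OF this W_inv[OF w(1)]]
  have "\<omega> \<gamma> \<bullet> coroot \<alpha> \<le> \<omega> \<gamma> \<bullet> coroot (w \<alpha>)"
    by (simp add: W_coroot[OF w(1)] W_inv_apply[OF w(1)] inner_diff_right)
  also have "\<dots> \<le> \<omega> \<gamma> \<bullet> coroot \<beta>"
    by (rule short_dominant_highest_dominant[OF assms(1) W_root[OF w(1) assms(2)] w(2)])
  finally show ?thesis .
qed

abbreviation "\<beta> \<equiv> dominant_short_root R \<Delta>"

text \<open>Existence comes from the dominant conjugate of a shortest root. Two candidates bound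
  each other in all coroot coordinates, so their coroots agree, and having equal norms they
  coincide.\<close>

lemma short_dominant_root: "short_dominant \<beta>"
proof -
  have "R \<noteq> {}" using irreducible by (simp add: irreducible_root_system_def)
  then obtain \<alpha> where a: "\<alpha> \<in> R" "\<forall>\<gamma>\<in>R. norm \<alpha> \<le> norm \<gamma>"
    using ex_min_if_finite[of "norm ` R"] finite_R
    by (metis (mono_tags, lifting) arg_min_if_finite(1) arg_min_least)
  obtain w where w: "w \<in> W" "dominant (w \<alpha>)" using ex_dominant by blast
  have "norm (w \<alpha>) = norm \<alpha>" using W_inner[OF w(1)] by (simp add: norm_eq_sqrt_inner)
  then have ex: "short_dominant (w \<alpha>)"
    using a w W_root by (auto simp: short_dominant_def)
  have uniq: "\<beta>' = \<beta>''" if "short_dominant \<beta>'" "short_dominant \<beta>''" for \<beta>' \<beta>''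
  proof -
    have R: "\<beta>' \<in> R" "\<beta>'' \<in> R" and nn: "norm \<beta>' = norm \<beta>''"
      using that by (auto simp: short_dominant_def intro: antisym)
    have "\<omega> \<gamma> \<bullet> coroot \<beta>' = \<omega> \<gamma> \<bullet> coroot \<beta>''" for \<gamma>
      using short_dominant_highest that R by (intro antisym) auto
    then have "coroot \<beta>' = coroot \<beta>''"
      by (subst (1 2) expand_coroots) simp
    then show ?thesis
      using nn root_nonzero[OF R(1)] root_nonzero[OF R(2)] by (simp add: coroot_def flip: power2_norm_eq_inner)
  qed
  have "\<beta> = (THE \<beta>. short_dominant \<beta>)"
    by (simp add: dominant_short_root_def short_dominant_def dominant_def)
  then show ?thesis using theI'[of short_dominant] ex uniq by metis
qed

lemma beta_root: "\<beta> \<in> R" and beta_dominant: "dominant \<beta>" and beta_short: "\<forall>\<alpha>\<in>R. norm \<beta> \<le> norm \<alpha>"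
  using short_dominant_root by (auto simp: short_dominant_def)

lemma beta_pos: "\<beta> \<in> pos"
  using dominant_root_pos beta_root beta_dominant by blast

lemma beta_coordinate_ge_1: assumes "\<gamma> \<in> \<Delta>" shows "1 \<le> \<omega> \<gamma> \<bullet> coroot \<beta>"
proof -
  have "0 < \<omega> \<gamma> \<bullet> coroot \<beta>"
    using dominant_root_coordinate[OF beta_root beta_dominant assms] inner_coroot_pos_iff
      root_nonzero[OF beta_root] by blast
  then show ?thesis using coroot_coordinate_integral[OF beta_root, of \<gamma>] by (auto elim!: Ints_cases)
qed

lemma beta_pairing: assumes "\<alpha> \<in> pos" "\<alpha> \<noteq> \<beta>" shows "pairing \<beta> \<alpha> = 0 \<or> pairing \<beta> \<alpha> = 1"
proof -
  have "0 \<le> pairing \<beta> \<alpha>" using dominant_pairing[OF beta_dominant assms(1)] .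
  moreover have "pairing \<beta> \<alpha> \<le> 1"
    using short_pairing[OF beta_root beta_short pos_root[OF assms(1)] assms(2)]
    unfolding pairing_def by linarith
  ultimately show ?thesis by linarith
qed

text \<open>The affine reflection is \<open>(s \<beta>, - \<beta>)\<close>. An involution permutes
  the contributions of the other positive roots up to sign, and the contribution c of
  \<open>\<beta>\<close> becomes -(c + 1). So there is a descent exactly if c is negative.\<close>

lemma lng_right_affine:
  assumes "u \<in> W" "x \<in> P"
  shows "int (lng (u \<circ> s \<beta>, s \<beta> x - \<beta>)) = int (lng (u, x)) - \<bar>cross u x \<beta>\<bar> + \<bar>cross u x \<beta> + 1\<bar>"
proof -
  have W: "u \<circ> s \<beta> \<in> W" using assms beta_root by (intro W_comp W_reflection)
  have bP: "\<beta> \<in> P" and sP: "s \<beta> x \<in> P"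
    using root_in_P[OF beta_root] W_P[OF W_reflection[OF beta_root] assms(2)] by auto
  \<comment> \<open>Roots orthogonal to \<open>\<beta>\<close> are fixed by
    \<open>s \<beta>\<close>; the others, pairing to 1 by \<open>beta_pairing\<close>, become
    negative, and the sign brings them back.\<close>
  define \<tau> where "\<tau> \<alpha> = (if pairing \<beta> \<alpha> = 0 then \<alpha> else - s \<beta> \<alpha>)" for \<alpha>
  have pair: "pairing (s \<beta> x - \<beta>) \<alpha> = pairing x (s \<beta> \<alpha>) - pairing \<beta> \<alpha>" if "\<alpha> \<in> R" for \<alpha>
    using pairing_diff[OF sP bP that] by (simp add: pairing_reflection)
  have sself: "s \<beta> \<beta> = - \<beta>" by (rule reflection_self[OF root_nonzero[OF beta_root]])
  have cross_beta: "cross (u \<circ> s \<beta>) (s \<beta> x - \<beta>) \<beta> = - (cross u x \<beta> + 1)"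
    using pair[OF beta_root] pairing_self[OF beta_root] pairing_uminus_root[OF assms(2) beta_root]
      pos_uminus_iff[OF W_root[OF assms(1) beta_root]]
    by (auto simp: cross_def sself W_uminus[OF assms(1)])
  have tau: "\<tau> \<alpha> \<in> pos - {\<beta>}" "\<tau> (\<tau> \<alpha>) = \<alpha>"
    "\<bar>cross (u \<circ> s \<beta>) (s \<beta> x - \<beta>) \<alpha>\<bar> = \<bar>cross u x (\<tau> \<alpha>)\<bar>" if "\<alpha> \<in> pos - {\<beta>}" for \<alpha>
  proof -
    have a: "\<alpha> \<in> pos" "\<alpha> \<in> R" "\<alpha> \<noteq> \<beta>" using that pos_root by auto
    have sR: "s \<beta> \<alpha> \<in> R" by (rule reflection_root[OF beta_root a(2)])
    have "\<tau> \<alpha> \<in> pos - {\<beta>} \<and> \<tau> (\<tau> \<alpha>) = \<alpha> \<and> \<bar>cross (u \<circ> s \<beta>) (s \<beta> x - \<beta>) \<alpha>\<bar> = \<bar>cross u x (\<tau> \<alpha>)\<bar>"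
    proof (cases "pairing \<beta> \<alpha> = 0")
      case True
      then have "\<beta> \<bullet> coroot \<alpha> = 0" using pairing_eq_iff[OF bP a(2)] by simp
      then have "\<beta> \<bullet> \<alpha> = 0" using inner_coroot_eq_0_iff[OF root_nonzero[OF a(2)]] by blast
      then have "\<alpha> \<bullet> \<beta> = 0" by (subst inner_commute)
      then have "\<alpha> \<bullet> coroot \<beta> = 0" using inner_coroot_eq_0_iff[OF root_nonzero[OF beta_root]] by blast
      then have "s \<beta> \<alpha> = \<alpha>" by (rule reflection_fixed)
      then show ?thesis using True pair[OF a(2)] that by (simp add: \<tau>_def cross_def)
    next
      case False
      then have one: "pairing \<beta> \<alpha> = 1" using beta_pairing[OF a(1,3)] by blast
      have m1: "pairing \<beta> (s \<beta> \<alpha>) = -1"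
        using pairing_reflection[of \<beta> \<beta> \<alpha>] pairing_uminus[OF bP a(2)] one by (simp add: sself)
      then have "s \<beta> \<alpha> \<notin> pos" using dominant_pairing[OF beta_dominant] by fastforce
      then have p: "- s \<beta> \<alpha> \<in> pos" using pos_or_neg[OF sR] by blast
      have p1: "pairing \<beta> (- s \<beta> \<alpha>) = 1" using pairing_uminus_root[OF bP sR] m1 by simp
      have "- s \<beta> \<alpha> \<noteq> \<beta>"
      proof
        assume "- s \<beta> \<alpha> = \<beta>"
        then have "s \<beta> (s \<beta> \<alpha>) = s \<beta> (s \<beta> \<beta>)" by (simp add: sself flip: minus_equation_iff)
        then show False using a(3) unfolding reflection_involution by blast
      qed
      moreover have "- s \<beta> (- s \<beta> \<alpha>) = \<alpha>"
        using W_uminus[OF W_reflection[OF beta_root]] by (simp add: reflection_involution)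
      moreover have "cross (u \<circ> s \<beta>) (s \<beta> x - \<beta>) \<alpha> = - cross u x (- s \<beta> \<alpha>)"
        using pair[OF a(2)] one pairing_uminus_root[OF assms(2) sR] pos_uminus_iff[OF W_root[OF assms(1) sR]]
        by (auto simp: cross_def W_uminus[OF assms(1)])
      ultimately show ?thesis using p one p1 by (simp add: \<tau>_def)
    qed
    then show "\<tau> \<alpha> \<in> pos - {\<beta>}" "\<tau> (\<tau> \<alpha>) = \<alpha>"
      "\<bar>cross (u \<circ> s \<beta>) (s \<beta> x - \<beta>) \<alpha>\<bar> = \<bar>cross u x (\<tau> \<alpha>)\<bar>" by auto
  qed
  have "bij_betw \<tau> (pos - {\<beta>}) (pos - {\<beta>})"
    by (rule bij_betwI[where g = \<tau>]) (use tau in auto)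
  from sum.reindex_bij_betw[OF this, of "\<lambda>\<alpha>. \<bar>cross u x \<alpha>\<bar>"]
  have eq: "(\<Sum>\<alpha>\<in>pos - {\<beta>}. \<bar>cross (u \<circ> s \<beta>) (s \<beta> x - \<beta>) \<alpha>\<bar>) = (\<Sum>\<alpha>\<in>pos - {\<beta>}. \<bar>cross u x \<alpha>\<bar>)"
    using tau(3) by simp
  show ?thesis
    unfolding weyl_length_cross[OF W] weyl_length_cross[OF assms(1)] sum.remove[OF finite_pos beta_pos] eq
      cross_beta by simp
qed

text \<open>The pairings \<open>a \<gamma>\<close> of \<open>x\<close> with the simple coroots are
  nonpositive integers, but weighted with the coordinates \<open>m \<gamma>\<close> of the highest
  coroot they add up to at least -1. Hence \<open>x\<close> is zero or minus a fundamental weight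
  whose coordinate \<open>m\<close> equals 1, and \<open>u\<close> is constrained
  accordingly.\<close>

lemma no_descents:
  assumes u: "u \<in> W" and x: "x \<in> P" and simple: "\<And>\<gamma>. \<gamma> \<in> \<Delta> \<Longrightarrow> cross u x \<gamma> \<le> 0"
    and beta: "0 \<le> cross u x \<beta>" and a: "\<alpha> \<in> pos"
  shows "cross u x \<alpha> = 0"
proof -
  define a where "a \<gamma> = x \<bullet> coroot \<gamma>" for \<gamma>
  define m where "m \<gamma> = \<omega> \<gamma> \<bullet> coroot \<beta>" for \<gamma>
  have a_int: "a \<gamma> \<in> \<int>" if "\<gamma> \<in> \<Delta>" for \<gamma>
    using x simple_root[OF that] by (simp add: a_def weight_lattice_def)
  have a_le: "a \<gamma> \<le> - (if u \<gamma> \<in> pos then 0 else 1)" if "\<gamma> \<in> \<Delta>" for \<gamma>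
    using simple[OF that] pairing_P[OF x simple_root[OF that]] by (auto simp: cross_def a_def split: if_splits)
  then have a_nonpos: "a \<gamma> \<le> 0" if "\<gamma> \<in> \<Delta>" for \<gamma> using a_le[OF that] by (auto split: if_splits)
  have m_ge: "1 \<le> m \<gamma>" if "\<gamma> \<in> \<Delta>" for \<gamma> using beta_coordinate_ge_1[OF that] by (simp add: m_def)
  have pair: "x \<bullet> coroot \<alpha> = (\<Sum>\<gamma>\<in>\<Delta>. (\<omega> \<gamma> \<bullet> coroot \<alpha>) * a \<gamma>)" for \<alpha>
    by (subst inner_expand) (simp add: a_def mult.commute)
  have beta_ge: "- (if u \<beta> \<in> pos then 0 else 1) \<le> (\<Sum>\<gamma>\<in>\<Delta>. m \<gamma> * a \<gamma>)"
    using beta pairing_P[OF x beta_root] pair[of \<beta>] by (auto simp: cross_def m_def)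
  have ma: "m \<gamma> * a \<gamma> \<le> a \<gamma>" if "\<gamma> \<in> \<Delta>" for \<gamma>
    using mult_right_mono_neg[OF m_ge[OF that] a_nonpos[OF that]] by simp
  have all_zero: "u = id" "x = 0" if z: "\<And>\<gamma>. \<gamma> \<in> \<Delta> \<Longrightarrow> a \<gamma> = 0"
  proof -
    show "x = 0" using z eq_if_inner_simple_eq[of x 0] by (simp add: a_def)
    have "u \<gamma> \<in> pos" if "\<gamma> \<in> \<Delta>" for \<gamma> using a_le[OF that] z[OF that] by (auto split: if_splits)
    then show "u = id" using W_eq_id[OF u] by blast
  qed
  show ?thesis
  proof (cases "\<forall>\<gamma>\<in>\<Delta>. a \<gamma> = 0")
    case True
    then have "u = id" "x = 0" using all_zero by auto
    then show ?thesis using \<open>\<alpha> \<in> pos\<close> by (simp add: cross_def pairing_zero)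
  next
    case False
    then obtain \<gamma>\<^sub>0 where g0: "\<gamma>\<^sub>0 \<in> \<Delta>" "a \<gamma>\<^sub>0 \<noteq> 0" by blast
    then have a0: "a \<gamma>\<^sub>0 \<le> -1" using a_int[OF g0(1)] a_nonpos[OF g0(1)] by (auto elim!: Ints_cases)
    have split: "(\<Sum>\<gamma>\<in>\<Delta>. m \<gamma> * a \<gamma>) = m \<gamma>\<^sub>0 * a \<gamma>\<^sub>0 + (\<Sum>\<gamma>\<in>\<Delta> - {\<gamma>\<^sub>0}. m \<gamma> * a \<gamma>)"
      by (rule sum.remove[OF finite_simple g0(1)])
    have rest: "(\<Sum>\<gamma>\<in>\<Delta> - {\<gamma>\<^sub>0}. m \<gamma> * a \<gamma>) \<le> (\<Sum>\<gamma>\<in>\<Delta> - {\<gamma>\<^sub>0}. a \<gamma>)" using ma by (intro sum_mono) auto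
    have rest': "(\<Sum>\<gamma>\<in>\<Delta> - {\<gamma>\<^sub>0}. a \<gamma>) \<le> 0" using a_nonpos by (intro sum_nonpos) auto
    note bounds = split rest rest' ma[OF g0(1)] a0
    have ub: "u \<beta> \<notin> pos"
    proof
      assume "u \<beta> \<in> pos"
      then have "0 \<le> (\<Sum>\<gamma>\<in>\<Delta>. m \<gamma> * a \<gamma>)" using beta_ge by (simp only: if_True minus_zero)
      then show False using bounds by linarith
    qed
    then have "- 1 \<le> (\<Sum>\<gamma>\<in>\<Delta>. m \<gamma> * a \<gamma>)" using beta_ge by (simp only: if_False)
    then have m0: "m \<gamma>\<^sub>0 * a \<gamma>\<^sub>0 = -1" and r0: "(\<Sum>\<gamma>\<in>\<Delta> - {\<gamma>\<^sub>0}. a \<gamma>) = 0" and a01: "a \<gamma>\<^sub>0 = -1"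
      using bounds by linarith+
    have m01: "m \<gamma>\<^sub>0 = 1" using m0 a01 by simp
    have others: "a \<gamma> = 0" if "\<gamma> \<in> \<Delta>" "\<gamma> \<noteq> \<gamma>\<^sub>0" for \<gamma>
    proof -
      have "(\<Sum>\<gamma>\<in>\<Delta> - {\<gamma>\<^sub>0}. - a \<gamma>) = 0" using r0 by (simp add: sum_negf)
      then show ?thesis using that a_nonpos finite_simple by (subst (asm) sum_nonneg_eq_0_iff) auto
    qed
    have upos: "u \<gamma> \<in> pos" if "\<gamma> \<in> \<Delta>" "\<gamma> \<noteq> \<gamma>\<^sub>0" for \<gamma>
      using a_le[OF that(1)] others[OF that] by (auto split: if_splits)
    \<comment> \<open>\<open>c\<close> is 0 or 1, being bounded by the coordinate 1 of the highest
      coroot, and \<open>x\<close> pairs with \<open>\<alpha>\<close> to \<open>- c\<close>. It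
      remains to see that \<open>u\<close> inverts \<open>\<alpha>\<close> exactly if
      \<open>c\<close> is 1.\<close>
    define c where "c = \<omega> \<gamma>\<^sub>0 \<bullet> coroot \<alpha>"
    have aR: "\<alpha> \<in> R" using pos_root \<open>\<alpha> \<in> pos\<close> by blast
    have "0 \<le> c" "c \<le> 1" "c \<in> \<int>"
      using coroot_coordinate_nonneg[OF \<open>\<alpha> \<in> pos\<close>] short_dominant_highest[OF short_dominant_root aR, of \<gamma>\<^sub>0] m01
        coroot_coordinate_integral[OF aR] by (auto simp: c_def m_def)
    then have c01: "c = 0 \<or> c = 1" by (auto elim!: Ints_cases)
    have "x \<bullet> coroot \<alpha> = c * a \<gamma>\<^sub>0 + (\<Sum>\<gamma>\<in>\<Delta> - {\<gamma>\<^sub>0}. (\<omega> \<gamma> \<bullet> coroot \<alpha>) * a \<gamma>)"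
      unfolding pair[of \<alpha>] c_def by (rule sum.remove[OF finite_simple g0(1)])
    also have "\<dots> = - c" using others a01 by simp
    finally have xc: "x \<bullet> coroot \<alpha> = - c" .
    have rho_u: "\<rho> \<bullet> u y = (\<omega> \<gamma>\<^sub>0 \<bullet> y) * (\<rho> \<bullet> u (coroot \<gamma>\<^sub>0)) + (\<Sum>\<gamma>\<in>\<Delta> - {\<gamma>\<^sub>0}. (\<omega> \<gamma> \<bullet> y) * (\<rho> \<bullet> u (coroot \<gamma>)))" for y
    proof -
      have "\<rho> \<bullet> u y = \<rho> \<bullet> u (\<Sum>\<gamma>\<in>\<Delta>. (\<omega> \<gamma> \<bullet> y) *\<^sub>R coroot \<gamma>)" using expand_coroots[of y] by simp
      also have "\<dots> = (\<Sum>\<gamma>\<in>\<Delta>. (\<omega> \<gamma> \<bullet> y) * (\<rho> \<bullet> u (coroot \<gamma>)))"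
        using W_linear[OF u] by (simp add: linear_sum linear_scale inner_sum_right)
      finally show ?thesis using sum.remove[OF finite_simple g0(1)] by simp
    qed
    have upos': "0 \<le> \<rho> \<bullet> u (coroot \<gamma>)" if "\<gamma> \<in> \<Delta> - {\<gamma>\<^sub>0}" for \<gamma>
      using upos[of \<gamma>] that rho_inner_coroot_pos[of "u \<gamma>"] W_coroot[OF u] by auto
    have tail: "0 \<le> (\<Sum>\<gamma>\<in>\<Delta> - {\<gamma>\<^sub>0}. k \<gamma> * (\<rho> \<bullet> u (coroot \<gamma>)))"
      if "\<And>\<gamma>. \<gamma> \<in> \<Delta> - {\<gamma>\<^sub>0} \<Longrightarrow> 0 \<le> k \<gamma>" for k
      using that upos' by (intro sum_nonneg mult_nonneg_nonneg)
    have ua: "u \<alpha> \<in> pos \<longleftrightarrow> 0 < \<rho> \<bullet> u (coroot \<alpha>)"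
      using pos_iff_rho_coroot[OF W_root[OF u aR]] by (simp add: W_coroot[OF u])
    show ?thesis
    proof (cases "c = 0")
      case True
      have "0 \<le> \<rho> \<bullet> u (coroot \<alpha>)"
        unfolding rho_u[of "coroot \<alpha>"] c_def[symmetric] True
        using tail[OF coroot_coordinate_nonneg[OF \<open>\<alpha> \<in> pos\<close>]] by simp
      moreover have "u \<alpha> \<in> pos \<or> 0 < \<rho> \<bullet> coroot (- u \<alpha>)"
        using pos_or_neg[OF W_root[OF u aR]] rho_inner_coroot_pos by blast
      ultimately have "u \<alpha> \<in> pos" by (auto simp: coroot_uminus W_coroot[OF u])
      then show ?thesis using xc True pairing_eq_iff[OF x aR, of 0] by (simp add: cross_def)
    next
      case False
      then have c1: "c = 1" using c01 by blast
      \<comment> \<open>The coordinate at \<open>\<gamma>\<^sub>0\<close> cancels and the others are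
        nonnegative because \<open>coroot \<beta>\<close> is highest; so \<open>u \<alpha>\<close>
        is negative together with \<open>u \<beta>\<close>.\<close>
      have "0 \<le> \<rho> \<bullet> u (coroot \<beta> - coroot \<alpha>)"
        unfolding rho_u[of "coroot \<beta> - coroot \<alpha>"]
        using tail[of "\<lambda>\<gamma>. \<omega> \<gamma> \<bullet> (coroot \<beta> - coroot \<alpha>)"] c1 m01
          short_dominant_highest[OF short_dominant_root aR]
        by (simp add: c_def m_def inner_diff_right)
      moreover have "\<not> 0 < \<rho> \<bullet> u (coroot \<beta>)"
        using pos_iff_rho_coroot[OF W_root[OF u beta_root]] ub by (simp add: W_coroot[OF u])
      ultimately have "u \<alpha> \<notin> pos" unfolding ua by (simp add: W_diff[OF u] inner_diff_right)
      then show ?thesis using xc c1 pairing_eq_iff[OF x aR, of "-1"] by (simp add: cross_def)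
    qed
  qed
qed

end

section \<open>The group algebra of the weight lattice\<close>

text \<open>Exponents range over the whole vector space and are restricted to \<open>P\<close>
  later, by \<open>kP\<close>. Coefficients form a commutative ring, so the arguments below cannot
  appeal to unique factorisation or to the absence of zero divisors.\<close>

abbreviation mon :: "'a \<Rightarrow> 'a \<Rightarrow>\<^sub>0 'k::comm_ring_1" where
  "mon x \<equiv> Poly_Mapping.single x 1"

abbreviation coeff_at :: "('a \<Rightarrow>\<^sub>0 'k::zero) \<Rightarrow> 'a \<Rightarrow> 'k" where
  "coeff_at \<equiv> Poly_Mapping.lookup"

abbreviation supp :: "('a \<Rightarrow>\<^sub>0 'k::zero) \<Rightarrow> 'a set" where
  "supp \<equiv> Poly_Mapping.keys"

lemma coeff_at_sum: "coeff_at (sum f I) x = (\<Sum>i\<in>I. coeff_at (f i) x)"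
  by (induct I rule: infinite_finite_induct) (auto simp: lookup_add)

lemma single_expansion: "f = (\<Sum>x\<in>supp f. Poly_Mapping.single x (coeff_at f x))"
proof (rule poly_mapping_eqI)
  fix y
  show "coeff_at f y = coeff_at (\<Sum>x\<in>supp f. Poly_Mapping.single x (coeff_at f x)) y"
    by (simp add: coeff_at_sum lookup_single when_def sum.delta in_keys_iff)
qed

lemma single_induct [case_names zero add]:
  fixes h :: "'a \<Rightarrow>\<^sub>0 'k::comm_monoid_add"
  assumes "Q 0"
    and "\<And>x c f. x \<in> supp h \<Longrightarrow> supp f \<subseteq> supp h \<Longrightarrow> Q f \<Longrightarrow> Q (Poly_Mapping.single x c + f)"
  shows "Q h"
proof -
  have "Q (\<Sum>x\<in>A. Poly_Mapping.single x (coeff_at h x)) \<and> supp (\<Sum>x\<in>A. Poly_Mapping.single x (coeff_at h x)) \<subseteq> supp h"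
    if "A \<subseteq> supp h" for A
  proof -
    have "finite A" using that finite_keys finite_subset by blast
    then show ?thesis using that
    proof (induct A)
      case (insert x A)
      let ?S = "\<Sum>x\<in>A. Poly_Mapping.single x (coeff_at h x)"
      have IH: "Q ?S" "supp ?S \<subseteq> supp h" using insert by auto
      have "supp (Poly_Mapping.single x (coeff_at h x) + ?S) \<subseteq> supp h"
        using Poly_Mapping.keys_add[of "Poly_Mapping.single x (coeff_at h x)" ?S] IH(2) insert(4)
        by (auto split: if_splits)
      then show ?case using assms(2)[OF _ IH(2,1), of x "coeff_at h x"] insert by simp
    qed (use assms(1) in simp)
  qed
  then show ?thesis using single_expansion[of h] by (metis order_refl)
qed

lemma coeff_at_mon_mult:
  fixes f :: "'a::ab_group_add \<Rightarrow>\<^sub>0 'k::comm_ring_1"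
  shows "coeff_at (Poly_Mapping.single x c * f) y = c * coeff_at f (y - x)"
proof (induct f rule: single_induct)
  case (add z d f)
  have "x + z = y \<longleftrightarrow> z = y - x" by (auto simp: algebra_simps)
  then show ?case using add(3) by (simp add: distrib_left mult_single lookup_add lookup_single when_def)
qed simp

definition act :: "('a \<Rightarrow> 'a) \<Rightarrow> ('a \<Rightarrow>\<^sub>0 'k::comm_ring_1) \<Rightarrow> 'a \<Rightarrow>\<^sub>0 'k" where
  "act w f = (\<Sum>x\<in>supp f. Poly_Mapping.single (w x) (coeff_at f x))"

lemma act_supset:
  assumes "finite A" "supp f \<subseteq> A"
  shows "act w f = (\<Sum>x\<in>A. Poly_Mapping.single (w x) (coeff_at f x))"
  unfolding act_def using assms by (intro sum.mono_neutral_left) (auto simp: in_keys_iff)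

lemma act_zero: "act w 0 = 0"
  by (simp add: act_def)

lemma act_add: "act w (f + g) = act w f + act w g"
proof -
  let ?A = "supp f \<union> supp g"
  have "act w (f + g) = (\<Sum>x\<in>?A. Poly_Mapping.single (w x) (coeff_at (f + g) x))"
    by (rule act_supset) (use Poly_Mapping.keys_add[of f g] in auto)
  also have "\<dots> = act w f + act w g"
    by (simp add: act_supset[of ?A f] act_supset[of ?A g] lookup_add single_add sum.distrib)
  finally show ?thesis .
qed

lemma act_single: "act w (Poly_Mapping.single x c) = Poly_Mapping.single (w x) c"
  by (cases "c = 0") (simp_all add: act_def)

lemma act_sum: "act w (sum f I) = (\<Sum>i\<in>I. act w (f i))"
  by (induct I rule: infinite_finite_induct) (auto simp: act_zero act_add)

lemma act_uminus: "act w (- f) = - act w f"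
  using act_add[of w f "- f"] by (simp add: act_zero eq_neg_iff_add_eq_0 add.commute)

lemma act_diff: "act w (f - g) = act w f - act w g"
  using act_add[of w f "- g"] by (simp add: act_uminus)

lemma act_comp: "act u (act w f) = act (u \<circ> w) f"
  by (induct f rule: single_induct) (simp_all add: act_zero act_add act_single)

lemma act_id: "act id f = f"
  by (induct f rule: single_induct) (simp_all add: act_zero act_add act_single)

lemma act_mult:
  fixes w :: "'a::ab_group_add \<Rightarrow> 'a"
  assumes "\<And>x y. w (x + y) = w x + w y"
  shows "act w (f * g) = act w f * act w g"
proof (induct f rule: single_induct)
  case (add x c f)
  have "act w (Poly_Mapping.single x c * g) = Poly_Mapping.single (w x) c * act w g"
    by (induct g rule: single_induct)
      (simp_all add: act_zero act_add act_single distrib_left mult_single assms)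
  then show ?case using add by (simp add: distrib_right act_add act_single)
qed (simp add: act_zero)

lemma supp_act: "supp (act w f) \<subseteq> w ` supp f"
proof
  fix y assume "y \<in> supp (act w f)"
  then have "(\<Sum>x\<in>supp f. coeff_at (Poly_Mapping.single (w x) (coeff_at f x)) y) \<noteq> 0"
    by (simp add: act_def in_keys_iff coeff_at_sum)
  then obtain x where "x \<in> supp f" "coeff_at (Poly_Mapping.single (w x) (coeff_at f x)) y \<noteq> 0"
    by (rule sum.not_neutral_contains_not_neutral)
  then show "y \<in> w ` supp f" by (auto simp: lookup_single when_def split: if_splits)
qed

definition slice :: "('a \<Rightarrow> bool) \<Rightarrow> ('a \<Rightarrow>\<^sub>0 'k::comm_ring_1) \<Rightarrow> 'a \<Rightarrow>\<^sub>0 'k" where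
  "slice B f = (\<Sum>x\<in>{x \<in> supp f. B x}. Poly_Mapping.single x (coeff_at f x))"

lemma coeff_at_slice: "coeff_at (slice B f) x = (if B x then coeff_at f x else 0)"
  by (simp add: slice_def coeff_at_sum lookup_single when_def in_keys_iff)

lemma supp_slice: "supp (slice B f) = {x \<in> supp f. B x}"
  by (auto simp: in_keys_iff coeff_at_slice split: if_splits)

lemma slice_diff: "slice B (f - g) = slice B f - slice B g"
  by (rule poly_mapping_eqI) (simp add: coeff_at_slice lookup_minus)

lemma slice_mon_mult:
  fixes f :: "'a::ab_group_add \<Rightarrow>\<^sub>0 'k::comm_ring_1"
  shows "slice B (mon y * f) = mon y * slice (\<lambda>x. B (y + x)) f"
  by (rule poly_mapping_eqI) (simp add: coeff_at_slice coeff_at_mon_mult)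

text \<open>For nonparallel exponents \<open>1 - mon a\<close> and \<open>1 - mon b\<close> behave
  as coprime elements. Let \<open>c\<close> be the part of \<open>b\<close> orthogonal to
  \<open>a\<close> and grade by \<open>c \<bullet> x\<close>: multiplication by
  \<open>1 - mon a\<close> preserves the grading and \<open>mon b\<close> raises it, so the top
  component of \<open>h\<close> is divisible and can be subtracted. The subgroup \<open>L\<close>
  keeps the quotient in the lattice.\<close>

lemma coprime_factor:
  fixes a b :: "'v::euclidean_space" and h g :: "'v \<Rightarrow>\<^sub>0 'k::comm_ring_1"
  assumes nonpar: "\<And>k. b \<noteq> k *\<^sub>R a" and eq: "(1 - mon b) * h = (1 - mon a) * g"
    and supp: "supp g \<subseteq> L" and L: "\<And>x y. x \<in> L \<Longrightarrow> y \<in> L \<Longrightarrow> x - y \<in> L" "a \<in> L" "b \<in> L"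
  shows "\<exists>h'. supp h' \<subseteq> L \<and> h = (1 - mon a) * h'"
  using eq supp
proof (induct "card (supp h)" arbitrary: h g rule: less_induct)
  case less
  have L0: "0 \<in> L" using L(1)[OF L(2) L(2)] by simp
  have Ladd: "x + y \<in> L" if "x \<in> L" "y \<in> L" for x y
    using L(1)[OF that(1) L(1)[OF L0 that(2)]] by simp
  have supp_mult: "supp (p * r) \<subseteq> L" if "supp p \<subseteq> L" "supp r \<subseteq> L" for p r :: "'v \<Rightarrow>\<^sub>0 'k"
    using keys_mult[of p r] Ladd that by blast
  have supp_diff: "supp (p - r) \<subseteq> L" if "supp p \<subseteq> L" "supp r \<subseteq> L" for p r :: "'v \<Rightarrow>\<^sub>0 'k"
    using keys_diff[of p r] that by blast
  show ?case
  proof (cases "h = 0")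
    case True
    then show ?thesis by (intro exI[of _ 0]) simp
  next
    case False
    define c where "c = b - ((b \<bullet> a) / (a \<bullet> a)) *\<^sub>R a"
    have ca: "c \<bullet> a = 0" by (simp add: c_def inner_diff_left)
    have cb: "0 < c \<bullet> b"
    proof -
      have "c \<noteq> 0" using nonpar[of "(b \<bullet> a) / (a \<bullet> a)"] by (simp add: c_def)
      moreover have "c \<bullet> c = c \<bullet> b - ((b \<bullet> a) / (a \<bullet> a)) * (c \<bullet> a)"
        by (subst (2) c_def) (simp add: inner_diff_right)
      ultimately show ?thesis using ca by (metis diff_zero inner_gt_zero_iff mult_zero_right)
    qed
    have ne: "(\<lambda>x. c \<bullet> x) ` supp h \<noteq> {}" using False by simp
    define M where "M = Max ((\<lambda>x. c \<bullet> x) ` supp h)"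
    have M_max: "c \<bullet> x \<le> M" if "x \<in> supp h" for x using that by (simp add: M_def)
    have M_in: "M \<in> (\<lambda>x. c \<bullet> x) ` supp h" unfolding M_def using ne by (intro Max_in) auto
    define hM where "hM = slice (\<lambda>x. c \<bullet> x = M) h"
    define gM where "gM = slice (\<lambda>x. c \<bullet> x = M + c \<bullet> b) g"
    \<comment> \<open>In degree \<open>M + c \<bullet> b\<close> the left side of the equation
      consists only of \<open>- mon b\<close> times the top component of \<open>h\<close>.\<close>
    have "slice (\<lambda>x. c \<bullet> x = M + c \<bullet> b) h = 0"
      using M_max cb by (intro poly_mapping_eqI) (force simp: coeff_at_slice in_keys_iff)
    moreover have "slice (\<lambda>x. c \<bullet> x = M + c \<bullet> b) ((1 - mon b) * h) = slice (\<lambda>x. c \<bullet> x = M + c \<bullet> b) h - mon b * hM"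
      by (simp add: left_diff_distrib slice_diff slice_mon_mult hM_def inner_add_right add.commute)
    moreover have "slice (\<lambda>x. c \<bullet> x = M + c \<bullet> b) ((1 - mon a) * g) = (1 - mon a) * gM"
      by (simp add: left_diff_distrib slice_diff slice_mon_mult gM_def inner_add_right ca)
    ultimately have "- (mon b * hM) = (1 - mon a) * gM" using less(2) by simp
    then have "mon (- b) * (mon b * hM) = - (mon (- b) * ((1 - mon a) * gM))"
      by (metis minus_minus mult_minus_right)
    moreover define K where "K = - (mon (- b) * gM)"
    ultimately have hM: "hM = (1 - mon a) * K"
      by (simp add: mult_single algebra_simps flip: mult.assoc)
    have sM: "supp K \<subseteq> L"
    proof -
      have "supp gM \<subseteq> L" using less(3) by (auto simp: gM_def supp_slice)
      moreover have "supp (mon (- b) :: 'v \<Rightarrow>\<^sub>0 'k) \<subseteq> L" using L(1)[OF L0 L(3)] by simp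
      ultimately show ?thesis using supp_diff[of 0] supp_mult by (simp add: K_def)
    qed
    have "supp (h - hM) \<subset> supp h"
    proof -
      have "coeff_at (h - hM) x = (if c \<bullet> x = M then 0 else coeff_at h x)" for x
        by (simp add: lookup_minus hM_def coeff_at_slice)
      then have "supp (h - hM) = {x \<in> supp h. c \<bullet> x \<noteq> M}" by (auto simp: in_keys_iff split: if_splits)
      then show ?thesis using M_in by auto
    qed
    then have "card (supp (h - hM)) < card (supp h)" by (simp add: psubset_card_mono)
    moreover have "(1 - mon b) * (h - hM) = (1 - mon a) * (g - (1 - mon b) * K)"
      using less(2) by (simp add: hM right_diff_distrib mult.left_commute)
    moreover have "supp (g - (1 - mon b) * K) \<subseteq> L"
      using less(3) sM L0 L(3) by (intro supp_diff supp_mult) (auto intro: supp_diff)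
    ultimately obtain h' where h': "supp h' \<subseteq> L" "h - hM = (1 - mon a) * h'" using less(1) by blast
    have "h = (1 - mon a) * (h' + K)"
      unfolding distrib_left h'(2)[symmetric] hM[symmetric] by simp
    moreover have "supp (h' + K) \<subseteq> L"
      using Poly_Mapping.keys_add[of h' K] h'(1) sM by blast
    ultimately show ?thesis by blast
  qed
qed

section \<open>Lattice exponents, leading terms and Demazure quotients\<close>

context based_root_system
begin

definition kP :: "('v \<Rightarrow>\<^sub>0 'k::comm_ring_1) set" where
  "kP = {f. supp f \<subseteq> P}"

definition kPW :: "('v \<Rightarrow>\<^sub>0 'k::comm_ring_1) set" where
  "kPW = {f \<in> kP. \<forall>w\<in>W. act w f = f}"

lemma kP_zero: "0 \<in> kP" and kP_one: "1 \<in> kP" and kP_single: "x \<in> P \<Longrightarrow> Poly_Mapping.single x c \<in> kP"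
  by (auto simp: kP_def P_zero keys_one split: if_splits)

lemma kP_add: "f \<in> kP \<Longrightarrow> g \<in> kP \<Longrightarrow> f + g \<in> kP"
  using Poly_Mapping.keys_add[of f g] by (auto simp: kP_def)

lemma kP_uminus: "f \<in> kP \<Longrightarrow> - f \<in> kP"
  by (auto simp: kP_def in_keys_iff)

lemma kP_mult: "f \<in> kP \<Longrightarrow> g \<in> kP \<Longrightarrow> f * g \<in> kP"
  using keys_mult[of f g] P_add by (fastforce simp: kP_def)

lemma kP_sum: "(\<And>i. i \<in> I \<Longrightarrow> f i \<in> kP) \<Longrightarrow> sum f I \<in> kP"
  by (induct I rule: infinite_finite_induct) (auto simp: kP_zero kP_add)

lemma kP_prod: "(\<And>i. i \<in> I \<Longrightarrow> f i \<in> kP) \<Longrightarrow> prod f I \<in> kP"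
  by (induct I rule: infinite_finite_induct) (auto simp: kP_one kP_mult)

lemma kP_of_int: "of_int n \<in> kP"
  using kP_single[OF P_zero, of "of_int n"] by simp

lemma kP_act: "w \<in> W \<Longrightarrow> f \<in> kP \<Longrightarrow> act w f \<in> kP"
  using supp_act[of w f] W_P by (fastforce simp: kP_def)

lemma kP_induct [consumes 1, case_names zero add]:
  fixes h :: "'v \<Rightarrow>\<^sub>0 'k::comm_ring_1"
  assumes "h \<in> kP" "Q 0"
    and "\<And>x c f. x \<in> P \<Longrightarrow> f \<in> kP \<Longrightarrow> Q f \<Longrightarrow> Q (Poly_Mapping.single x c + f)"
  shows "Q h"
  using assms(2)
proof (rule single_induct[of Q])
  fix x c f assume "x \<in> supp h" "supp f \<subseteq> supp h" "Q f"
  then show "Q (Poly_Mapping.single x c + f)" using assms(1) by (intro assms(3)) (auto simp: kP_def)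
qed

lemma act_mult_W: "w \<in> W \<Longrightarrow> act w (f * g) = act w f * act w g"
  using W_add by (intro act_mult)

lemma act_one_W: assumes "w \<in> W" shows "act w 1 = 1"
  using act_single[of w 0 1] W_zero[OF assms] by simp

lemma act_prod_W: "w \<in> W \<Longrightarrow> act w (prod f I) = (\<Prod>i\<in>I. act w (f i))"
  by (induct I rule: infinite_finite_induct) (auto simp: act_one_W act_mult_W)

lemma act_of_int_W: assumes "w \<in> W" shows "act w (of_int n) = of_int n"
  using act_single[of w 0 "of_int n"] W_zero[OF assms] by simp

lemma act_reflection_involution: "act (s \<gamma>) (act (s \<gamma>) f) = f"
  by (simp only: act_comp reflection_comp_self act_id)

lemma act_fixed_if_simple:
  assumes "\<And>\<gamma>. \<gamma> \<in> \<Delta> \<Longrightarrow> act (s \<gamma>) f = f" "w \<in> W"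
  shows "act w f = f"
  using assms(2)
proof (induct rule: W_simple_induct)
  case (step \<gamma> w)
  then show ?case using assms(1) by (metis act_comp)
qed (rule act_id)

text \<open>Pairing with \<rho> only preorders the exponents, so it is part of the condition that no
  other exponent has the same height as \<open>x\<close>. The coefficient \<open>c\<close> may be
  zero.\<close>

definition lead :: "('v \<Rightarrow>\<^sub>0 'k::comm_ring_1) \<Rightarrow> 'v \<Rightarrow> 'k \<Rightarrow> bool" where
  "lead f x c \<longleftrightarrow> (\<exists>f'. f = Poly_Mapping.single x c + f' \<and> (\<forall>y\<in>supp f'. \<rho> \<bullet> y < \<rho> \<bullet> x))"

lemma leadI: "f = Poly_Mapping.single x c + f' \<Longrightarrow> (\<And>y. y \<in> supp f' \<Longrightarrow> \<rho> \<bullet> y < \<rho> \<bullet> x) \<Longrightarrow> lead f x c"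
  unfolding lead_def by blast

lemma lead_single: "lead (Poly_Mapping.single x c) x c"
  by (rule leadI[of _ _ _ 0]) auto

lemma lead_one: "lead 1 0 1"
  using lead_single[of 0 1] by simp

lemma lead_mult:
  assumes "lead f x c" "lead g y d"
  shows "lead (f * g) (x + y) (c * d)"
proof -
  obtain f' where f': "f = Poly_Mapping.single x c + f'" "\<And>z. z \<in> supp f' \<Longrightarrow> \<rho> \<bullet> z < \<rho> \<bullet> x"
    using assms(1) unfolding lead_def by blast
  obtain g' where g': "g = Poly_Mapping.single y d + g'" "\<And>z. z \<in> supp g' \<Longrightarrow> \<rho> \<bullet> z < \<rho> \<bullet> y"
    using assms(2) unfolding lead_def by blast
  let ?r = "Poly_Mapping.single x c * g' + f' * Poly_Mapping.single y d + f' * g'"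
  show ?thesis
  proof (rule leadI[of _ _ _ ?r])
    show "f * g = Poly_Mapping.single (x + y) (c * d) + ?r"
      unfolding f'(1) g'(1) by (simp add: distrib_left distrib_right mult_single add.assoc)
    fix z assume "z \<in> supp ?r"
    then have "z \<in> supp (Poly_Mapping.single x c * g') \<union> supp (f' * Poly_Mapping.single y d) \<union> supp (f' * g')"
      using Poly_Mapping.keys_add[of "Poly_Mapping.single x c * g' + f' * Poly_Mapping.single y d" "f' * g'"]
        Poly_Mapping.keys_add[of "Poly_Mapping.single x c * g'" "f' * Poly_Mapping.single y d"] by blast
    then consider a b where "z = a + b" "a \<in> supp (Poly_Mapping.single x c)" "b \<in> supp g'"
      | a b where "z = a + b" "a \<in> supp f'" "b \<in> supp (Poly_Mapping.single y d)"
      | a b where "z = a + b" "a \<in> supp f'" "b \<in> supp g'"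
      using keys_mult[of "Poly_Mapping.single x c" g'] keys_mult[of f' "Poly_Mapping.single y d"] keys_mult[of f' g']
      by blast
    then show "\<rho> \<bullet> z < \<rho> \<bullet> (x + y)"
    proof cases
      case 1
      then show ?thesis using g'(2)[of b] by (simp add: inner_add_right split: if_splits)
    next
      case 2
      then show ?thesis using f'(2)[of a] by (simp add: inner_add_right split: if_splits)
    next
      case 3
      then show ?thesis using f'(2)[of a] g'(2)[of b] by (simp add: inner_add_right)
    qed
  qed
qed

lemma lead_prod:
  "finite I \<Longrightarrow> (\<And>i. i \<in> I \<Longrightarrow> lead (f i) (x i) (c i)) \<Longrightarrow> lead (prod f I) (sum x I) (prod c I)"
  by (induct I rule: finite_induct) (auto intro: lead_mult lead_one)

lemma lead_power: "lead f x c \<Longrightarrow> lead (f ^ n) (real n *\<^sub>R x) (c ^ n)"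
proof (induct n)
  case (Suc n)
  then show ?case using lead_mult[of f x c "f ^ n" "real n *\<^sub>R x" "c ^ n"] by (simp add: scaleR_add_left algebra_simps)
qed (simp add: lead_one)

text \<open>The factor \<open>h\<close> may have several exponents of top height, but
  \<open>f\<close> has only one, so an exponent \<open>x + z\<close> with \<open>z\<close> of top
  height arises in a single way.\<close>

lemma coeff_at_lead_mult:
  fixes f h :: "'v \<Rightarrow>\<^sub>0 'k::comm_ring_1"
  assumes "lead f x c" "\<And>z'. z' \<in> supp h \<Longrightarrow> \<rho> \<bullet> z' \<le> \<rho> \<bullet> z"
  shows "coeff_at (f * h) (x + z) = c * coeff_at h z"
proof -
  obtain f' where f': "f = Poly_Mapping.single x c + f'" "\<And>z. z \<in> supp f' \<Longrightarrow> \<rho> \<bullet> z < \<rho> \<bullet> x"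
    using assms(1) unfolding lead_def by blast
  have "x + z \<notin> supp (f' * h)"
  proof
    assume "x + z \<in> supp (f' * h)"
    then obtain a b where ab: "x + z = a + b" "a \<in> supp f'" "b \<in> supp h" using keys_mult by blast
    have "\<rho> \<bullet> x + \<rho> \<bullet> z = \<rho> \<bullet> a + \<rho> \<bullet> b" using arg_cong[OF ab(1), of "\<lambda>y. \<rho> \<bullet> y"] by (simp add: inner_add_right)
    then show False using f'(2)[OF ab(2)] assms(2)[OF ab(3)] by linarith
  qed
  then show ?thesis
    by (simp add: f'(1) distrib_right lookup_add coeff_at_mon_mult in_keys_iff)
qed

lemma ex_top_exponent:
  fixes h :: "'v \<Rightarrow>\<^sub>0 'k::comm_ring_1"
  assumes "h \<noteq> 0" obtains z where "z \<in> supp h" "\<And>z'. z' \<in> supp h \<Longrightarrow> \<rho> \<bullet> z' \<le> \<rho> \<bullet> z"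
proof -
  have ne: "(\<lambda>z. \<rho> \<bullet> z) ` supp h \<noteq> {}" using assms by simp
  have "Max ((\<lambda>z. \<rho> \<bullet> z) ` supp h) \<in> (\<lambda>z. \<rho> \<bullet> z) ` supp h" using ne by (intro Max_in) auto
  then obtain z where "z \<in> supp h" "Max ((\<lambda>z. \<rho> \<bullet> z) ` supp h) = \<rho> \<bullet> z" by blast
  moreover have "\<rho> \<bullet> z' \<le> Max ((\<lambda>z. \<rho> \<bullet> z) ` supp h)" if "z' \<in> supp h" for z' using that by simp
  ultimately show ?thesis using that by metis
qed

text \<open>Leading coefficient 1 substitutes for the absence of zero divisors: a top exponent of
  \<open>h\<close> would survive in the product.\<close>

lemma lead_cancel:
  fixes f h :: "'v \<Rightarrow>\<^sub>0 'k::comm_ring_1"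
  assumes "lead f x 1" "f * h = 0"
  shows "h = 0"
proof (rule ccontr)
  assume "h \<noteq> 0"
  from ex_top_exponent[OF this] obtain z
    where z: "z \<in> supp h" "\<And>z'. z' \<in> supp h \<Longrightarrow> \<rho> \<bullet> z' \<le> \<rho> \<bullet> z" by blast
  have "coeff_at (f * h) (x + z) = 1 * coeff_at h z"
    by (rule coeff_at_lead_mult[OF assms(1)]) (rule z(2))
  then have "coeff_at h z = 0" using assms(2) by simp
  then show False using z(1) by (simp add: in_keys_iff)
qed

lemma lead_cancel_eq:
  fixes f g h :: "'v \<Rightarrow>\<^sub>0 'k::comm_ring_1"
  assumes "lead f x 1" "f * g = f * h"
  shows "g = h"
  using lead_cancel[OF assms(1), of "g - h"] assms(2) by (simp add: right_diff_distrib)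

lemma lead_root: assumes "\<alpha> \<in> pos" shows "lead (1 - mon (- \<alpha>) :: 'v \<Rightarrow>\<^sub>0 'k::comm_ring_1) 0 1"
proof (rule leadI[of _ _ _ "- mon (- \<alpha>)"])
  fix y assume "y \<in> supp (- mon (- \<alpha>) :: 'v \<Rightarrow>\<^sub>0 'k)"
  then have "y = - \<alpha>" by (simp add: in_keys_iff lookup_single when_def split: if_splits)
  then show "\<rho> \<bullet> y < \<rho> \<bullet> 0" using rho_pos[OF assms] by simp
qed simp

lemma kPW_kP: "f \<in> kPW \<Longrightarrow> f \<in> kP" and kPW_act: "f \<in> kPW \<Longrightarrow> w \<in> W \<Longrightarrow> act w f = f"
  by (auto simp: kPW_def)

text \<open>Summing \<open>w z\<close> over the group gives a fixed vector, hence zero, so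
  nonpositive heights along an orbit are all zero. Then the dominant member of the orbit is fixed by
  the group, which leaves only the weight zero.\<close>

lemma invariant_constant:
  fixes p :: "'v \<Rightarrow>\<^sub>0 'k::comm_ring_1"
  assumes inv: "\<And>w. w \<in> W \<Longrightarrow> act w p = p" and top: "\<And>z. z \<in> supp p \<Longrightarrow> \<rho> \<bullet> z \<le> 0"
  shows "p = Poly_Mapping.single 0 (coeff_at p 0)"
proof -
  have closed: "w z \<in> supp p" if "w \<in> W" "z \<in> supp p" for w z
  proof -
    have "z \<in> supp (act (inv w) p)" using inv[OF W_inv[OF that(1)]] that(2) by simp
    then obtain y where "y \<in> supp p" "z = inv w y" using supp_act[of "inv w" p] by blast
    then show ?thesis using W_apply_inv[OF that(1)] by simp
  qed
  have zero: "z = 0" if z: "z \<in> supp p" for z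
  proof -
    let ?S = "\<Sum>w\<in>W. w z"
    have "?S \<bullet> coroot \<gamma> = 0" if g: "\<gamma> \<in> \<Delta>" for \<gamma>
    proof -
      have sW: "s \<gamma> \<in> W" using g by (intro W_reflection simple_root)
      have bij: "bij_betw (\<lambda>w. s \<gamma> \<circ> w) W W"
        using sW by (intro bij_betwI[where g = "\<lambda>w. s \<gamma> \<circ> w"])
          (auto intro!: W_comp simp: comp_assoc[symmetric] reflection_comp_self)
      have "s \<gamma> ?S = (\<Sum>w\<in>W. (s \<gamma> \<circ> w) z)" using W_linear[OF sW] by (simp add: linear_sum)
      also have "\<dots> = ?S" by (rule sum.reindex_bij_betw[OF bij])
      finally have "(?S \<bullet> coroot \<gamma>) *\<^sub>R \<gamma> = 0" by (simp add: reflection_def)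
      then show ?thesis using simple_nonzero[OF g] by simp
    qed
    then have "?S = 0" using eq_if_inner_simple_eq[of ?S 0] by simp
    then have "(\<Sum>w\<in>W. - (\<rho> \<bullet> w z)) = 0" by (metis inner_sum_right inner_zero_right neg_0_equal_iff_equal sum_negf)
    then have flat: "\<rho> \<bullet> w z = 0" if "w \<in> W" for w
      using top closed z finite_W that by (subst (asm) sum_nonneg_eq_0_iff) auto
    obtain u where u: "u \<in> W" "dominant (u z)" using ex_dominant by blast
    have "w (u z) = u z" if "w \<in> W" for w
      using rho_dominant_less[OF u(2) that] flat[OF u(1)] flat[OF W_comp[OF that u(1)]] by force
    then have "u z \<bullet> coroot \<gamma> = 0" if "\<gamma> \<in> \<Delta>" for \<gamma>
      using that W_reflection[OF simple_root] simple_nonzero[of \<gamma>] unfolding reflection_def by fastforce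
    then have "u z = 0" using eq_if_inner_simple_eq[of "u z" 0] by simp
    then show ?thesis using W_inj[OF u(1), of z 0] W_zero[OF u(1)] by simp
  qed
  show ?thesis
  proof (rule poly_mapping_eqI)
    fix z show "coeff_at p z = coeff_at (Poly_Mapping.single 0 (coeff_at p 0)) z"
      using zero[of z] by (cases "z = 0") (auto simp: lookup_single when_def in_keys_iff)
  qed
qed

text \<open>The quotient is the geometric sum along the string of weights from \<open>x\<close>
  downwards in steps of \<open>\<alpha>\<close>.\<close>

lemma string_divisible:
  assumes "x \<in> P" "\<alpha> \<in> P"
  shows "\<exists>d\<in>kP. mon x - mon (x - real n *\<^sub>R \<alpha>) = (1 - mon (- \<alpha>)) * (d :: 'v \<Rightarrow>\<^sub>0 'k::comm_ring_1)"
proof (induct n)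
  case 0
  then show ?case by (intro bexI[of _ 0]) (simp_all add: kP_zero)
next
  case (Suc n)
  then obtain d :: "'v \<Rightarrow>\<^sub>0 'k"
    where d: "d \<in> kP" "mon x - mon (x - real n *\<^sub>R \<alpha>) = (1 - mon (- \<alpha>)) * d" by blast
  let ?y = "x - real n *\<^sub>R \<alpha>"
  have y: "?y \<in> P" using P_diff[OF assms(1) P_scale_int[OF assms(2), of "int n"]] by simp
  have "mon x - mon (x - real (Suc n) *\<^sub>R \<alpha>) = (mon x - mon ?y) + (mon ?y - mon (- \<alpha>) * mon ?y)"
    by (simp add: mult_single algebra_simps)
  also have "\<dots> = (1 - mon (- \<alpha>)) * (d + mon ?y)"
    unfolding d(2) by (simp add: algebra_simps)
  finally have "mon x - mon (x - real (Suc n) *\<^sub>R \<alpha>) = (1 - mon (- \<alpha>)) * (d + mon ?y)" .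
  then show ?case using d(1) kP_add kP_single[OF y] by blast
qed

text \<open>Each monomial and its reflection are the ends of a string in direction
  \<open>\<alpha>\<close>, run downwards or upwards according to the sign of the pairing. The
  quotient is the Demazure operator.\<close>

lemma reflection_divisible:
  fixes f :: "'v \<Rightarrow>\<^sub>0 'k::comm_ring_1"
  assumes "f \<in> kP" "\<alpha> \<in> R"
  shows "\<exists>d\<in>kP. f - act (s \<alpha>) f = (1 - mon (- \<alpha>)) * d"
  using assms(1)
proof (induct rule: kP_induct)
  case zero
  then show ?case by (intro bexI[of _ 0]) (simp_all add: kP_zero act_zero)
next
  case (add x c f)
  have aP: "\<alpha> \<in> P" using root_in_P assms(2) .
  obtain n where n: "x \<bullet> coroot \<alpha> = of_int n" using add(1) assms(2) by (auto simp: weight_lattice_def elim: Ints_cases)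
  have "\<exists>d\<in>kP. mon x - mon (s \<alpha> x) = (1 - mon (- \<alpha>)) * (d :: 'v \<Rightarrow>\<^sub>0 'k)"
  proof (cases "0 \<le> n")
    case True
    then have "s \<alpha> x = x - real (nat n) *\<^sub>R \<alpha>" by (simp add: reflection_def n)
    then show ?thesis using string_divisible[OF add(1) aP, of "nat n"] by simp
  next
    case False
    have e: "s \<alpha> x - real (nat (- n)) *\<^sub>R \<alpha> = x" using False by (simp add: reflection_def n)
    obtain d :: "'v \<Rightarrow>\<^sub>0 'k" where d: "d \<in> kP" "mon (s \<alpha> x) - mon x = (1 - mon (- \<alpha>)) * d"
      using string_divisible[OF W_P[OF W_reflection[OF assms(2)] add(1)] aP, of "nat (- n)"] unfolding e by blast
    have "mon x - mon (s \<alpha> x) = - (mon (s \<alpha> x) - mon x :: 'v \<Rightarrow>\<^sub>0 'k)" by simp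
    also have "\<dots> = (1 - mon (- \<alpha>)) * (- d)" unfolding d(2) by simp
    finally show ?thesis using d(1) kP_uminus by blast
  qed
  then obtain d where d: "d \<in> kP" "mon x - mon (s \<alpha> x) = (1 - mon (- \<alpha>)) * (d :: 'v \<Rightarrow>\<^sub>0 'k)" by blast
  obtain d' where d': "d' \<in> kP" "f - act (s \<alpha>) f = (1 - mon (- \<alpha>)) * d'" using add(3) by blast
  have c: "Poly_Mapping.single y c = Poly_Mapping.single 0 c * mon y" for y :: 'v by (simp add: mult_single)
  have "Poly_Mapping.single x c + f - act (s \<alpha>) (Poly_Mapping.single x c + f)
      = Poly_Mapping.single 0 c * (mon x - mon (s \<alpha> x)) + (f - act (s \<alpha>) f)"
    unfolding act_add act_single right_diff_distrib c[symmetric] by simp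
  also have "\<dots> = (1 - mon (- \<alpha>)) * (Poly_Mapping.single 0 c * d + d')"
    unfolding d(2) d'(2) by (simp add: algebra_simps)
  finally show ?case using d(1) d'(1) by (blast intro: kP_add kP_mult kP_single P_zero)
qed

end

section \<open>Alternating sums and dual bases\<close>

text \<open>Meant for sums over \<open>W\<close> with \<open>\<tau>\<close> a multiplication by a
  reflection; \<open>p\<close> selects one member of each pair, so no factor 2 appears.\<close>

lemma sum_involution_split:
  fixes F :: "'a \<Rightarrow> 'b::comm_monoid_add"
  assumes "finite A" "\<And>a. a \<in> A \<Longrightarrow> \<tau> a \<in> A" "\<And>a. a \<in> A \<Longrightarrow> \<tau> (\<tau> a) = a"
    and "\<And>a. a \<in> A \<Longrightarrow> p (\<tau> a) \<longleftrightarrow> \<not> p a"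
  shows "sum F A = (\<Sum>a\<in>{a \<in> A. p a}. F a + F (\<tau> a))"
proof -
  have "bij_betw \<tau> {a \<in> A. p a} {a \<in> A. \<not> p a}"
    by (rule bij_betwI[where g = \<tau>]) (use assms in auto)
  from sum.reindex_bij_betw[OF this, of F]
  have "(\<Sum>a\<in>{a \<in> A. p a}. F (\<tau> a)) = (\<Sum>a\<in>{a \<in> A. \<not> p a}. F a)" .
  moreover have "sum F A = (\<Sum>a\<in>{a \<in> A. p a}. F a) + (\<Sum>a\<in>{a \<in> A. \<not> p a}. F a)"
    using assms(1) by (subst sum.union_disjoint[symmetric]) (auto intro!: sum.cong)
  ultimately show ?thesis by (simp add: sum.distrib)
qed

context based_root_system
begin

definition alternator :: "('v \<Rightarrow>\<^sub>0 'k::comm_ring_1) \<Rightarrow> 'v \<Rightarrow>\<^sub>0 'k" where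
  "alternator f = (\<Sum>w\<in>W. of_int (sgn w) * act w f)"

lemma alternator_zero: "alternator 0 = 0"
  by (simp add: alternator_def act_zero)

lemma alternator_add: "alternator (f + g) = alternator f + alternator g"
  by (simp add: alternator_def act_add distrib_left sum.distrib)

lemma alternator_uminus: "alternator (- f) = - alternator f"
  by (simp add: alternator_def act_uminus sum_negf)

lemma alternator_kP: "f \<in> kP \<Longrightarrow> alternator f \<in> kP"
  unfolding alternator_def by (intro kP_sum kP_mult kP_of_int kP_act)

lemma alternator_invariant_mult: "f \<in> kPW \<Longrightarrow> alternator (f * g) = f * alternator g"
  unfolding alternator_def sum_distrib_left
  by (rule sum.cong) (simp_all add: act_mult_W kPW_act mult.left_commute)

lemma W_left_mult_bij: assumes "u \<in> W" shows "bij_betw (\<lambda>w. u \<circ> w) W W"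
proof (rule bij_betwI[where g = "\<lambda>w. inv u \<circ> w"])
  show "inv u \<circ> (u \<circ> w) = w" for w by (simp only: comp_assoc[symmetric] W_inv_comp[OF assms] id_comp)
  show "u \<circ> (inv u \<circ> w) = w" for w by (simp only: comp_assoc[symmetric] W_comp_inv[OF assms] id_comp)
qed (use assms in \<open>auto intro!: W_comp W_inv\<close>)

lemma W_right_mult_bij: assumes "u \<in> W" shows "bij_betw (\<lambda>w. w \<circ> u) W W"
proof (rule bij_betwI[where g = "\<lambda>w. w \<circ> inv u"])
  show "(w \<circ> u) \<circ> inv u = w" for w by (simp only: comp_assoc W_comp_inv[OF assms] comp_id)
  show "(w \<circ> inv u) \<circ> u = w" for w by (simp only: comp_assoc W_inv_comp[OF assms] comp_id)
qed (use assms in \<open>auto intro!: W_comp W_inv\<close>)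

lemma W_simple: "\<gamma> \<in> \<Delta> \<Longrightarrow> s \<gamma> \<in> W"
  by (intro W_reflection simple_root)

lemma act_alternator_simple:
  assumes "\<gamma> \<in> \<Delta>" shows "act (s \<gamma>) (alternator f) = - alternator f"
proof -
  have "act (s \<gamma>) (alternator f) = (\<Sum>w\<in>W. - (of_int (sgn (s \<gamma> \<circ> w)) * act (s \<gamma> \<circ> w) f))"
    unfolding alternator_def act_sum
    by (rule sum.cong) (simp_all add: act_mult_W act_of_int_W W_simple assms sgn_left_simple act_comp)
  also have "\<dots> = (\<Sum>w\<in>W. - (of_int (sgn w) * act w f))"
    by (rule sum.reindex_bij_betw[OF W_left_mult_bij[OF W_simple[OF assms]], of "\<lambda>w. - (of_int (sgn w) * act w f)"])
  finally show ?thesis by (simp add: alternator_def sum_negf)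
qed

lemma alternator_act_simple:
  assumes "\<gamma> \<in> \<Delta>" shows "alternator (act (s \<gamma>) f) = - alternator f"
proof -
  have "alternator (act (s \<gamma>) f) = (\<Sum>w\<in>W. - (of_int (sgn (w \<circ> s \<gamma>)) * act (w \<circ> s \<gamma>) f))"
    unfolding alternator_def
    by (rule sum.cong) (simp_all add: assms sgn_right_simple act_comp)
  also have "\<dots> = (\<Sum>w\<in>W. - (of_int (sgn w) * act w f))"
    by (rule sum.reindex_bij_betw[OF W_right_mult_bij[OF W_simple[OF assms]], of "\<lambda>w. - (of_int (sgn w) * act w f)"])
  finally show ?thesis by (simp add: alternator_def sum_negf)
qed

text \<open>The sign is left undetermined because the only use is divisibility, which does not see
  it.\<close>

lemma act_alternator:
  assumes "w \<in> W" shows "act w (alternator f) = alternator f \<or> act w (alternator f) = - alternator f"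
  using assms
proof (induct rule: W_simple_induct)
  case (step \<gamma> w)
  have "act (s \<gamma> \<circ> w) (alternator f) = act (s \<gamma>) (act w (alternator f))" by (simp only: act_comp)
  then show ?case
    using step(3) act_alternator_simple[OF step(1), of f] act_uminus[of "s \<gamma>" "alternator f"]
    by (metis minus_minus)
qed (simp only: act_id simp_thms)

text \<open>Pairing \<open>w\<close> with \<open>w s\<^sub>\<gamma>\<close> makes this true in characteristic two as well.\<close>

lemma alternator_singular:
  assumes "\<gamma> \<in> \<Delta>" "s \<gamma> x = x"
  shows "alternator (Poly_Mapping.single x c) = 0"
  unfolding alternator_def
proof (subst sum_involution_split[where \<tau> = "\<lambda>w. w \<circ> s \<gamma>" and p = "\<lambda>w. w \<gamma> \<in> pos"])
  show "w \<circ> s \<gamma> \<in> W" "(w \<circ> s \<gamma>) \<circ> s \<gamma> = w" "(w \<circ> s \<gamma>) \<gamma> \<in> pos \<longleftrightarrow> w \<gamma> \<notin> pos" if "w \<in> W" for w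
    using that W_comp[OF that W_simple[OF assms(1)]] W_simple_neg[OF that assms(1)]
    by (auto simp only: comp_assoc reflection_comp_self comp_id)
  show "(\<Sum>w\<in>{w \<in> W. w \<gamma> \<in> pos}. of_int (sgn w) * act w (Poly_Mapping.single x c) +
      of_int (sgn (w \<circ> s \<gamma>)) * act (w \<circ> s \<gamma>) (Poly_Mapping.single x c)) = 0"
    by (intro sum.neutral ballI) (simp add: act_single sgn_right_simple assms)
qed (rule finite_W)

lemma W_left_flip:
  assumes "w \<in> W" "\<gamma> \<in> \<Delta>" shows "inv (s \<gamma> \<circ> w) \<gamma> \<in> pos \<longleftrightarrow> inv w \<gamma> \<notin> pos"
proof -
  have "inv (s \<gamma> \<circ> w) = inv w \<circ> s \<gamma>"
    using o_inv_distrib[OF W_bij[OF W_simple[OF assms(2)]] W_bij[OF assms(1)]] by (simp only: inv_reflection)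
  then show ?thesis using W_simple_neg[OF W_inv[OF assms(1)] assms(2)] by (simp only:)
qed

text \<open>The alternating sum is \<open>h - act (s \<gamma>) h\<close>, with \<open>h\<close> the
  part over one half of \<open>W\<close>, so \<open>reflection_divisible\<close> applies in every
  characteristic.\<close>

lemma alternator_divisible_simple:
  fixes f :: "'v \<Rightarrow>\<^sub>0 'k::comm_ring_1"
  assumes "f \<in> kP" "\<gamma> \<in> \<Delta>"
  shows "\<exists>d\<in>kP. alternator f = (1 - mon (- \<gamma>)) * d"
proof -
  define h where "h = (\<Sum>w\<in>{w \<in> W. inv w \<gamma> \<in> pos}. of_int (sgn w) * act w f)"
  have "h \<in> kP" unfolding h_def using assms(1) by (intro kP_sum kP_mult kP_of_int kP_act) auto
  moreover have "alternator f = h - act (s \<gamma>) h"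
    unfolding alternator_def
  proof (subst sum_involution_split[where \<tau> = "\<lambda>w. s \<gamma> \<circ> w" and p = "\<lambda>w. inv w \<gamma> \<in> pos"])
    show "s \<gamma> \<circ> w \<in> W" "s \<gamma> \<circ> (s \<gamma> \<circ> w) = w" "inv (s \<gamma> \<circ> w) \<gamma> \<in> pos \<longleftrightarrow> inv w \<gamma> \<notin> pos" if "w \<in> W" for w
      using that W_comp[OF W_simple[OF assms(2)] that] W_left_flip[OF that assms(2)]
      by (auto simp only: comp_assoc[symmetric] reflection_comp_self id_comp)
    have "act (s \<gamma>) h = (\<Sum>w\<in>{w \<in> W. inv w \<gamma> \<in> pos}. - (of_int (sgn (s \<gamma> \<circ> w)) * act (s \<gamma> \<circ> w) f))"
      unfolding h_def act_sum
      by (rule sum.cong) (simp_all add: act_mult_W act_of_int_W W_simple assms sgn_left_simple act_comp)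
    then show "(\<Sum>w\<in>{w \<in> W. inv w \<gamma> \<in> pos}. of_int (sgn w) * act w f +
        of_int (sgn (s \<gamma> \<circ> w)) * act (s \<gamma> \<circ> w) f) = h - act (s \<gamma>) h"
      by (simp add: h_def sum.distrib sum_negf)
  qed (rule finite_W)
  ultimately show ?thesis using reflection_divisible[OF _ simple_root[OF assms(2)]] by metis
qed

lemma pos_conjugate_simple: assumes "\<alpha> \<in> pos" shows "\<exists>w\<in>W. \<exists>\<gamma>\<in>\<Delta>. \<alpha> = w \<gamma>"
  using assms
proof (induct rule: pos_induct)
  case (simple \<gamma>)
  then show ?case using W_id by (metis id_apply)
next
  case (step \<alpha> \<gamma>)
  then obtain w \<delta> where "w \<in> W" "\<delta> \<in> \<Delta>" "s \<gamma> \<alpha> = w \<delta>" by blast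
  then have "\<alpha> = (s \<gamma> \<circ> w) \<delta>" using reflection_involution[of \<gamma> \<alpha>] by simp
  then show ?case using W_comp[OF W_simple[OF step(2)] \<open>w \<in> W\<close>] \<open>\<delta> \<in> \<Delta>\<close> by blast
qed

lemma alternator_divisible:
  fixes f :: "'v \<Rightarrow>\<^sub>0 'k::comm_ring_1"
  assumes "f \<in> kP" "\<alpha> \<in> pos"
  shows "\<exists>d\<in>kP. alternator f = (1 - mon (- \<alpha>)) * d"
proof -
  obtain w \<gamma> where w: "w \<in> W" "\<gamma> \<in> \<Delta>" "\<alpha> = w \<gamma>" using pos_conjugate_simple[OF assms(2)] by blast
  obtain d :: "'v \<Rightarrow>\<^sub>0 'k" where d: "d \<in> kP" "alternator f = (1 - mon (- \<gamma>)) * d"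
    using alternator_divisible_simple[OF assms(1) w(2)] by blast
  have "act w (alternator f) = (1 - mon (- \<alpha>)) * act w d"
    unfolding d(2) act_mult_W[OF w(1)] act_diff act_one_W[OF w(1)] act_single W_uminus[OF w(1)] w(3) ..
  then have "alternator f = (1 - mon (- \<alpha>)) * act w d \<or> alternator f = (1 - mon (- \<alpha>)) * (- act w d)"
    using act_alternator[OF w(1), of f] by (metis minus_minus mult_minus_right)
  then show ?thesis using kP_act[OF w(1) d(1)] kP_uminus by blast
qed

text \<open>The factors of the product are removed one at a time by \<open>coprime_factor\<close>;
  distinct positive roots are not parallel because the root system is reduced.\<close>

lemma prod_roots_divisible:
  fixes g d :: "'v \<Rightarrow>\<^sub>0 'k::comm_ring_1"
  assumes "finite S" "S \<subseteq> pos" "\<alpha> \<in> pos" "\<alpha> \<notin> S" "g \<in> kP" "d \<in> kP"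
    and "g * (\<Prod>\<beta>\<in>S. 1 - mon (- \<beta>)) = (1 - mon (- \<alpha>)) * d"
  shows "\<exists>h\<in>kP. g = (1 - mon (- \<alpha>)) * h"
  using assms(1,2,4,6,7)
proof (induct S arbitrary: d rule: finite_induct)
  case empty
  then show ?case by auto
next
  case (insert \<beta> S)
  let ?Q = "g * (\<Prod>\<beta>\<in>S. 1 - mon (- \<beta>))"
  have b: "\<beta> \<in> pos" "\<beta> \<noteq> \<alpha>" using insert by auto
  have aP: "- \<alpha> \<in> P" "- \<beta> \<in> P" using root_in_P[OF pos_root] assms(3) b(1) P_uminus by auto
  have nonpar: "- \<beta> \<noteq> k *\<^sub>R (- \<alpha>)" for k
  proof
    assume "- \<beta> = k *\<^sub>R (- \<alpha>)"
    then have eq: "\<beta> = k *\<^sub>R \<alpha>" by simp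
    then have "k = 1 \<or> k = -1" using root_reduced pos_root assms(3) b(1) by blast
    then show False using eq b not_pos_uminus[OF assms(3)] by auto
  qed
  have "(1 - mon (- \<beta>)) * ?Q = g * (\<Prod>\<beta>\<in>insert \<beta> S. 1 - mon (- \<beta>))"
    unfolding prod.insert[OF insert(1,2)] by (simp only: mult_ac)
  then have "(1 - mon (- \<beta>)) * ?Q = (1 - mon (- \<alpha>)) * d" unfolding insert(7) .
  from coprime_factor[OF nonpar this, of P] obtain h where h: "h \<in> kP" "?Q = (1 - mon (- \<alpha>)) * h"
    using insert(6) aP P_diff unfolding kP_def by blast
  then show ?case using insert(3)[OF _ _ h] insert(4,5) by blast
qed

section \<open>The Weyl denominator and the character formula\<close>

definition weyl_denominator :: "'v \<Rightarrow>\<^sub>0 'k::comm_ring_1" where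
  "weyl_denominator = mon \<rho> * (\<Prod>\<alpha>\<in>pos. 1 - mon (- \<alpha>))"

lemma lead_weyl_denominator: "lead (weyl_denominator :: 'v \<Rightarrow>\<^sub>0 'k::comm_ring_1) \<rho> 1"
proof -
  have "lead (\<Prod>\<alpha>\<in>pos. 1 - mon (- \<alpha>) :: 'v \<Rightarrow>\<^sub>0 'k) (\<Sum>\<alpha>\<in>pos. 0) (\<Prod>\<alpha>\<in>pos. 1)"
    by (rule lead_prod[OF finite_pos lead_root])
  from lead_mult[OF lead_single[of \<rho> 1] this] show ?thesis by (simp add: weyl_denominator_def)
qed

text \<open>\<open>s \<gamma>\<close> permutes the factors other than that of
  \<open>\<gamma>\<close>, and since it sends \<open>\<rho>\<close> to
  \<open>\<rho> - \<gamma>\<close> it turns \<open>mon \<rho> * (1 - mon (- \<gamma>))\<close> into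
  its negative.\<close>

lemma act_weyl_denominator:
  assumes "\<gamma> \<in> \<Delta>"
  shows "act (s \<gamma>) weyl_denominator = - (weyl_denominator :: 'v \<Rightarrow>\<^sub>0 'k::comm_ring_1)"
proof -
  let ?f = "\<lambda>\<alpha>. 1 - mon (- \<alpha>) :: 'v \<Rightarrow>\<^sub>0 'k"
  have W: "s \<gamma> \<in> W" by (rule W_simple[OF assms])
  have act_f: "act (s \<gamma>) (?f \<alpha>) = ?f (s \<gamma> \<alpha>)" for \<alpha>
    by (simp add: act_diff act_one_W[OF W] act_single W_uminus[OF W])
  have sr: "s \<gamma> \<rho> = \<rho> - \<gamma>" by (simp add: reflection_def rho_inner[OF assms])
  have "act (s \<gamma>) weyl_denominator = mon (\<rho> - \<gamma>) * (\<Prod>\<alpha>\<in>pos. ?f (s \<gamma> \<alpha>))"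
    unfolding weyl_denominator_def by (simp only: act_mult_W[OF W] act_single act_prod_W[OF W] act_f sr)
  also have "(\<Prod>\<alpha>\<in>pos. ?f (s \<gamma> \<alpha>)) = ?f (s \<gamma> \<gamma>) * (\<Prod>\<alpha>\<in>pos - {\<gamma>}. ?f (s \<gamma> \<alpha>))"
    by (rule prod.remove[OF finite_pos simple_pos[OF assms]])
  also have "(\<Prod>\<alpha>\<in>pos - {\<gamma>}. ?f (s \<gamma> \<alpha>)) = (\<Prod>\<alpha>\<in>pos - {\<gamma>}. ?f \<alpha>)"
    by (rule prod.reindex_bij_betw[OF bij_betw_simple_reflection[OF assms]])
  also have "?f (s \<gamma> \<gamma>) = 1 - mon \<gamma>" by (simp add: reflection_self[OF simple_nonzero[OF assms]])
  also have "mon (\<rho> - \<gamma>) * ((1 - mon \<gamma>) * (\<Prod>\<alpha>\<in>pos - {\<gamma>}. ?f \<alpha>))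
      = - (mon \<rho> * (?f \<gamma> * (\<Prod>\<alpha>\<in>pos - {\<gamma>}. ?f \<alpha>)))"
    by (simp add: algebra_simps mult_single flip: mult.assoc)
  also have "?f \<gamma> * (\<Prod>\<alpha>\<in>pos - {\<gamma>}. ?f \<alpha>) = (\<Prod>\<alpha>\<in>pos. ?f \<alpha>)"
    by (rule prod.remove[OF finite_pos simple_pos[OF assms], symmetric])
  finally show ?thesis by (simp add: weyl_denominator_def)
qed

text \<open>The factors of the positive roots are split off one by one. The quotient is invariant
  since numerator and denominator change sign together and the denominator can be cancelled, having
  leading coefficient 1.\<close>

lemma alternator_quotient_denominator:
  fixes f :: "'v \<Rightarrow>\<^sub>0 'k::comm_ring_1"
  assumes "f \<in> kP"
  shows "\<exists>p\<in>kPW. alternator f = p * weyl_denominator"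
proof -
  have "\<exists>g\<in>kP. alternator f = g * (\<Prod>\<alpha>\<in>S. 1 - mon (- \<alpha>))" if "finite S" "S \<subseteq> pos" for S
    using that
  proof (induct S rule: finite_induct)
    case empty
    then show ?case using alternator_kP[OF assms] by (intro bexI[of _ "alternator f"]) simp_all
  next
    case (insert \<alpha> S)
    then obtain g :: "'v \<Rightarrow>\<^sub>0 'k" where g: "g \<in> kP" "alternator f = g * (\<Prod>\<alpha>\<in>S. 1 - mon (- \<alpha>))" by blast
    obtain d :: "'v \<Rightarrow>\<^sub>0 'k" where d: "d \<in> kP" "alternator f = (1 - mon (- \<alpha>)) * d"
      using alternator_divisible[OF assms, of \<alpha>] insert by blast
    obtain h :: "'v \<Rightarrow>\<^sub>0 'k" where h: "h \<in> kP" "g = (1 - mon (- \<alpha>)) * h"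
      using prod_roots_divisible[of S \<alpha> g d] insert g d by auto
    have "alternator f = h * (\<Prod>\<alpha>\<in>insert \<alpha> S. 1 - mon (- \<alpha>))"
      unfolding g(2) h(2) prod.insert[OF insert(1,2)] by (simp only: mult_ac)
    then show ?case using h(1) by blast
  qed
  then obtain g :: "'v \<Rightarrow>\<^sub>0 'k" where g: "g \<in> kP" "alternator f = g * (\<Prod>\<alpha>\<in>pos. 1 - mon (- \<alpha>))"
    using finite_pos by blast
  define p where "p = mon (- \<rho>) * g"
  have eq: "alternator f = weyl_denominator * p"
  proof -
    have "weyl_denominator * p = (mon \<rho> * mon (- \<rho>)) * (g * (\<Prod>\<alpha>\<in>pos. 1 - mon (- \<alpha>)))"
      unfolding weyl_denominator_def p_def by (simp only: mult_ac)
    then show ?thesis by (simp add: mult_single g(2))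
  qed
  have "p \<in> kP" unfolding p_def by (intro kP_mult kP_single P_uminus rho_in_P g(1))
  moreover have "act w p = p" if "w \<in> W" for w
  proof (rule act_fixed_if_simple[OF _ that])
    fix \<gamma> assume d: "\<gamma> \<in> \<Delta>"
    have "weyl_denominator * p = - act (s \<gamma>) (alternator f)"
      unfolding act_alternator_simple[OF d] minus_minus by (rule eq[symmetric])
    also have "\<dots> = weyl_denominator * act (s \<gamma>) p"
      unfolding eq act_mult_W[OF W_simple[OF d]] act_weyl_denominator[OF d] by simp
    finally have "weyl_denominator * p = weyl_denominator * act (s \<gamma>) p" .
    from lead_cancel_eq[OF lead_weyl_denominator this] show "act (s \<gamma>) p = p" by (rule sym)
  qed
  ultimately have "p \<in> kPW" by (simp add: kPW_def)
  moreover have "alternator f = p * weyl_denominator" unfolding eq by (rule mult.commute)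
  ultimately show ?thesis by blast
qed

lemma strict_rho: "w \<in> W \<Longrightarrow> w \<rho> = \<rho> \<Longrightarrow> w = id"
  by (rule strictly_dominant_stabilizer[of \<rho>]) (simp_all add: rho_inner)

lemma dominant_rho: "dominant \<rho>"
  by (simp add: dominant_def rho_inner)

lemma lead_alternator_rho: "lead (alternator (mon \<rho>) :: 'v \<Rightarrow>\<^sub>0 'k::comm_ring_1) \<rho> 1"
proof (rule leadI)
  let ?r = "\<Sum>w\<in>W - {id}. of_int (sgn w) * act w (mon \<rho>) :: 'v \<Rightarrow>\<^sub>0 'k"
  show "alternator (mon \<rho>) = Poly_Mapping.single \<rho> 1 + ?r"
    unfolding alternator_def by (subst sum.remove[OF finite_W W_id]) (simp add: sgn_id act_id)
  fix y assume "y \<in> supp ?r"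
  then obtain w where w: "w \<in> W - {id}" "y \<in> supp (of_int (sgn w) * act w (mon \<rho>) :: 'v \<Rightarrow>\<^sub>0 'k)"
    unfolding in_keys_iff coeff_at_sum by (rule sum.not_neutral_contains_not_neutral)
  have "of_int (sgn w) * act w (mon \<rho>) = (Poly_Mapping.single (w \<rho>) (of_int (sgn w)) :: 'v \<Rightarrow>\<^sub>0 'k)"
    by (simp add: act_single mult_single flip: single_of_int)
  then have "y = w \<rho>" using w(2) by (auto split: if_splits)
  then show "\<rho> \<bullet> y < \<rho> \<bullet> \<rho>"
    using w(1) strict_rho by (auto intro!: rho_dominant_less dominant_rho)
qed

text \<open>Weyl's denominator formula. Both sides have top exponent \<rho>, so the invariant
  quotient has exponents of height at most 0 and is constant; comparing leading coefficients makes
  it 1.\<close>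

lemma alternator_rho: "alternator (mon \<rho>) = (weyl_denominator :: 'v \<Rightarrow>\<^sub>0 'k::comm_ring_1)"
proof -
  obtain p :: "'v \<Rightarrow>\<^sub>0 'k" where p: "p \<in> kPW" "alternator (mon \<rho>) = p * weyl_denominator"
    using alternator_quotient_denominator[OF kP_single[OF rho_in_P]] by blast
  have eq: "alternator (mon \<rho>) = weyl_denominator * p" using p(2) by (simp add: mult.commute)
  obtain r :: "'v \<Rightarrow>\<^sub>0 'k" where r: "alternator (mon \<rho>) = Poly_Mapping.single \<rho> 1 + r" "\<And>y. y \<in> supp r \<Longrightarrow> \<rho> \<bullet> y < \<rho> \<bullet> \<rho>"
    using lead_alternator_rho unfolding lead_def by blast
  have top: "\<rho> \<bullet> z \<le> 0" if z: "z \<in> supp p" for z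
  proof -
    from z have "p \<noteq> 0" by auto
    from ex_top_exponent[OF this] obtain z0
      where z0: "z0 \<in> supp p" "\<And>z'. z' \<in> supp p \<Longrightarrow> \<rho> \<bullet> z' \<le> \<rho> \<bullet> z0" by blast
    have "coeff_at (weyl_denominator * p) (\<rho> + z0) = 1 * coeff_at p z0"
      by (rule coeff_at_lead_mult[OF lead_weyl_denominator]) (rule z0(2))
    then have "\<rho> + z0 \<in> supp (Poly_Mapping.single \<rho> 1 + r)"
      unfolding r(1)[symmetric] eq using z0(1) by (simp add: in_keys_iff)
    then have "\<rho> + z0 = \<rho> \<or> \<rho> + z0 \<in> supp r"
      using Poly_Mapping.keys_add[of "Poly_Mapping.single \<rho> 1" r] by (auto split: if_splits)
    then have "\<rho> \<bullet> (\<rho> + z0) \<le> \<rho> \<bullet> \<rho>" using r(2) by (auto simp: less_imp_le)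
    then show ?thesis using z0(2)[OF z] by (simp add: inner_add_right)
  qed
  have const: "p = Poly_Mapping.single 0 (coeff_at p 0)"
    using invariant_constant[OF kPW_act[OF p(1)] top] .
  have "coeff_at (weyl_denominator * p) (\<rho> + 0) = 1 * coeff_at p 0"
    by (rule coeff_at_lead_mult[OF lead_weyl_denominator]) (use top in simp)
  moreover have "coeff_at (alternator (mon \<rho>) :: 'v \<Rightarrow>\<^sub>0 'k) \<rho> = 1"
    using r(2)[of \<rho>] by (auto simp: r(1) lookup_add in_keys_iff)
  ultimately have "coeff_at p 0 = 1" by (simp add: eq)
  then show ?thesis using const p(2) by (metis mult_1 single_one)
qed

lemma alternator_quotient:
  fixes f :: "'v \<Rightarrow>\<^sub>0 'k::comm_ring_1"
  assumes "f \<in> kP"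
  shows "\<exists>p\<in>kPW. alternator f = p * alternator (mon \<rho>)"
  using alternator_quotient_denominator[OF assms] unfolding alternator_rho .

text \<open>A strictly dominant weight has trivial stabiliser and is the only dominant member of its
  orbit, so the terms of nontrivial \<open>w\<close> do not reach \<open>x\<close>.\<close>

lemma coeff_at_alternator_strict:
  fixes g :: "'v \<Rightarrow>\<^sub>0 'k::comm_ring_1"
  assumes "\<And>y \<gamma>. y \<in> supp g \<Longrightarrow> \<gamma> \<in> \<Delta> \<Longrightarrow> 0 < y \<bullet> coroot \<gamma>" "x \<in> supp g"
  shows "coeff_at (alternator g) x = coeff_at g x"
proof -
  have dom: "dominant y" if "y \<in> supp g" for y using assms(1)[OF that] by (simp add: dominant_def less_imp_le)
  have "coeff_at (act w g) x = 0" if w: "w \<in> W" "w \<noteq> id" for w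
  proof (rule ccontr)
    assume "coeff_at (act w g) x \<noteq> 0"
    then have "x \<in> w ` supp g" using supp_act[of w g] by (auto simp: in_keys_iff)
    then obtain y where y: "y \<in> supp g" "x = w y" by blast
    then have "w y = y" using dominant_orbit_unique[OF dom w(1)] dom assms(2) by blast
    then show False using strictly_dominant_stabilizer[OF assms(1) w(1)] y(1) w(2) by blast
  qed
  moreover have "coeff_at (of_int (sgn w) * act w g) x = of_int (sgn w) * coeff_at (act w g) x" for w
    using coeff_at_mon_mult[of 0 "of_int (sgn w)" "act w g" x] by simp
  ultimately have "coeff_at (alternator g) x = (\<Sum>w\<in>W. if w = id then coeff_at g x else 0)"
    unfolding alternator_def coeff_at_sum by (intro sum.cong) (auto simp: sgn_id act_id)
  then show ?thesis using finite_W W_id by simp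
qed

text \<open>
  Every element of the group algebra is congruent, modulo relations killed by antisymmetric
  functionals, to a combination of strictly dominant weights, and the alternator is injective on those.
\<close>

lemma antisymmetric_vanish:
  fixes \<Phi> :: "('v \<Rightarrow>\<^sub>0 'k::comm_ring_1) \<Rightarrow> 'h::ab_group_add"
  assumes add: "\<And>f g. f \<in> kP \<Longrightarrow> g \<in> kP \<Longrightarrow> \<Phi> (f + g) = \<Phi> f + \<Phi> g"
    and anti: "\<And>f \<gamma>. f \<in> kP \<Longrightarrow> \<gamma> \<in> \<Delta> \<Longrightarrow> \<Phi> (act (s \<gamma>) f) = - \<Phi> f"
    and sing: "\<And>x c \<gamma>. x \<in> P \<Longrightarrow> \<gamma> \<in> \<Delta> \<Longrightarrow> s \<gamma> x = x \<Longrightarrow> \<Phi> (Poly_Mapping.single x c) = 0"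
    and f: "f \<in> kP" "alternator f = 0"
  shows "\<Phi> f = 0"
proof -
  define strict where "strict g \<longleftrightarrow> g \<in> kP \<and> (\<forall>y\<in>supp g. \<forall>\<gamma>\<in>\<Delta>. 0 < y \<bullet> coroot \<gamma>)" for g :: "'v \<Rightarrow>\<^sub>0 'k"
  have zero: "\<Phi> 0 = 0" using add[OF kP_zero kP_zero] by simp
  have neg: "\<Phi> (- g) = - \<Phi> g" if "g \<in> kP" for g
    using add[OF that kP_uminus[OF that]] zero by (simp add: eq_neg_iff_add_eq_0 add.commute)
  \<comment> \<open>Weights are folded into the dominant chamber: a reflection costs a sign for
    \<open>\<Phi>\<close> and for the alternator alike, and a dominant weight on a wall is killed by
    both.\<close>
  have mono: "\<exists>g. strict g \<and> \<Phi> (Poly_Mapping.single x c) = \<Phi> g \<and> alternator (Poly_Mapping.single x c) = alternator g"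
    if "x \<in> P" for x c
    using that
  proof (induct x rule: dominant_induct)
    case (dominant x)
    show ?case
    proof (cases "\<forall>\<gamma>\<in>\<Delta>. 0 < x \<bullet> coroot \<gamma>")
      case True
      then show ?thesis
        using dominant(2) kP_single by (intro exI[of _ "Poly_Mapping.single x c"]) (auto simp: strict_def kP_zero split: if_splits)
    next
      case False
      then obtain \<gamma> where g: "\<gamma> \<in> \<Delta>" "\<not> 0 < x \<bullet> coroot \<gamma>" by blast
      then have "x \<bullet> coroot \<gamma> = 0" using dominantD[OF dominant(1) g(1)] by linarith
      then have fx: "s \<gamma> x = x" by (intro reflection_fixed)
      show ?thesis
        using sing[OF dominant(2) g(1) fx] alternator_singular[OF g(1) fx, of c] zero alternator_zero kP_zero
        by (intro exI[of _ 0]) (simp add: strict_def)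
    qed
  next
    case (step \<gamma> x)
    have sP: "s \<gamma> x \<in> P" using W_P[OF W_simple[OF step(1)] step(4)] .
    then obtain g where g: "strict g" "\<Phi> (Poly_Mapping.single (s \<gamma> x) c) = \<Phi> g"
        "alternator (Poly_Mapping.single (s \<gamma> x) c) = alternator g" using step(3) by blast
    have gP: "g \<in> kP" using g(1) by (simp add: strict_def)
    have e: "Poly_Mapping.single x c = act (s \<gamma>) (Poly_Mapping.single (s \<gamma> x) c)"
      by (simp add: act_single reflection_involution)
    have "\<Phi> (Poly_Mapping.single x c) = \<Phi> (- g)"
      unfolding e anti[OF kP_single[OF sP] step(1)] g(2) neg[OF gP] ..
    moreover have "alternator (Poly_Mapping.single x c) = alternator (- g)"
      unfolding e alternator_act_simple[OF step(1)] g(3) alternator_uminus ..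
    moreover have "strict (- g)" using g(1) by (auto simp: strict_def kP_uminus in_keys_iff)
    ultimately show ?case by blast
  qed
  have "\<exists>g. strict g \<and> \<Phi> f = \<Phi> g \<and> alternator f = alternator g"
    using f(1)
  proof (induct rule: kP_induct)
    case zero
    then show ?case using kP_zero by (intro exI[of _ 0]) (simp add: strict_def)
  next
    case (add x c f)
    obtain g where g: "strict g" "\<Phi> f = \<Phi> g" "alternator f = alternator g" using add(3) by blast
    obtain g' where g': "strict g'" "\<Phi> (Poly_Mapping.single x c) = \<Phi> g'"
        "alternator (Poly_Mapping.single x c) = alternator g'" using mono[OF add(1)] by blast
    have gP: "g \<in> kP" "g' \<in> kP" using g(1) g'(1) by (auto simp: strict_def)
    have "strict (g' + g)"
      using g(1) g'(1) kP_add Poly_Mapping.keys_add[of g' g] unfolding strict_def by blast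
    moreover have "\<Phi> (Poly_Mapping.single x c + f) = \<Phi> (g' + g)"
      using assms(1)[OF kP_single[OF add(1)] add(2)] assms(1)[OF gP(2,1)] g g' by simp
    moreover have "alternator (Poly_Mapping.single x c + f) = alternator (g' + g)"
      using g g' by (simp add: alternator_add)
    ultimately show ?case by blast
  qed
  then obtain g where g: "strict g" "\<Phi> f = \<Phi> g" "alternator f = alternator g" by blast
  have "g = 0"
  proof (rule ccontr)
    assume "g \<noteq> 0"
    from ex_top_exponent[OF this] obtain x where x: "x \<in> supp g" by blast
    then have "coeff_at (alternator g) x = coeff_at g x"
      using g(1) by (intro coeff_at_alternator_strict) (auto simp: strict_def)
    then show False using x f(2) g(3) by (simp add: in_keys_iff)
  qed
  then show ?thesis using g(2) zero by simp
qed

end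

lemma mon_prod: "(\<Prod>i\<in>I. Poly_Mapping.single (x i) (c i)) = (Poly_Mapping.single (\<Sum>i\<in>I. x i) (\<Prod>i\<in>I. c i) :: _ \<Rightarrow>\<^sub>0 'k::comm_ring_1)"
  by (induct I rule: infinite_finite_induct) (auto simp: mult_single)

section \<open>Steinberg's weights and the Gram matrix\<close>

context based_root_system
begin

text \<open>The condition picks the right descents of \<open>u\<close>. These are the weights in
  Steinberg's theorem that the group algebra is free over its invariants.\<close>

definition steinberg_weight :: "('v \<Rightarrow> 'v) \<Rightarrow> 'v" where
  "steinberg_weight u = (\<Sum>\<gamma>\<in>{\<gamma> \<in> \<Delta>. u \<gamma> \<notin> pos}. \<omega> \<gamma>)"

lemma steinberg_weight_P: "steinberg_weight u \<in> P"
  unfolding steinberg_weight_def by (intro P_sum fundamental_weight_in_P)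

lemma steinberg_weight_inner:
  assumes "\<gamma> \<in> \<Delta>" shows "steinberg_weight u \<bullet> coroot \<gamma> = (if u \<gamma> \<in> pos then 0 else 1)"
  unfolding steinberg_weight_def inner_sum_left
  using assms finite_simple by (simp add: fundamental_weight_inner)

lemma steinberg_weight_dominant: "dominant (steinberg_weight u)"
  by (simp add: dominant_def steinberg_weight_inner)

text \<open>Exactly one of \<open>u\<close> and \<open>u \<circ> s \<gamma>\<close> has
  \<open>\<gamma>\<close> as a descent. In \<open>dual_basis\<close> this matches the top exponent
  of a power of the Weyl denominator.\<close>

lemma steinberg_weight_sum: "2 *\<^sub>R (\<Sum>u\<in>W. steinberg_weight u) = real (card W) *\<^sub>R \<rho>"
proof (rule eq_if_inner_simple_eq)
  fix \<gamma> assume g: "\<gamma> \<in> \<Delta>"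
  let ?c = "\<lambda>u. steinberg_weight u \<bullet> coroot \<gamma>"
  have "(\<Sum>u\<in>W. ?c u) = (\<Sum>u\<in>W. ?c (u \<circ> s \<gamma>))"
    by (rule sum.reindex_bij_betw[OF W_right_mult_bij[OF W_simple[OF g]], symmetric])
  also have "\<dots> = (\<Sum>u\<in>W. 1 - ?c u)"
    using W_simple_neg[OF _ g] by (intro sum.cong) (auto simp: steinberg_weight_inner g)
  also have "\<dots> = real (card W) - (\<Sum>u\<in>W. ?c u)" by (simp add: sum_subtractf)
  finally show "2 *\<^sub>R (\<Sum>u\<in>W. steinberg_weight u) \<bullet> coroot \<gamma> = real (card W) *\<^sub>R \<rho> \<bullet> coroot \<gamma>"
    by (simp add: inner_sum_left rho_inner[OF g])
qed

text \<open>The element \<open>z = inv v \<circ> u\<close> fixes the Steinberg weight of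
  \<open>v\<close>, so \<open>\<rho> - z \<rho>\<close> is orthogonal to that weight and involves
  only simple coroots that are not descents of \<open>v\<close>. These stay positive under
  \<open>v\<close>; hence \<open>v (\<rho> - z \<rho>)\<close> has nonnegative height, and height
  zero only if \<open>z\<close> fixes \<rho>.\<close>

lemma steinberg_fixed:
  assumes "u \<in> W" "v \<in> W" "(inv u \<circ> v) (steinberg_weight v) = steinberg_weight v"
  shows "\<rho> \<bullet> u \<rho> \<le> \<rho> \<bullet> v \<rho>" "\<rho> \<bullet> u \<rho> = \<rho> \<bullet> v \<rho> \<Longrightarrow> u = v"
proof -
  define z where "z = inv v \<circ> u"
  have zW: "z \<in> W" unfolding z_def by (intro W_comp W_inv assms)
  have uz: "u = v \<circ> z" unfolding z_def by (simp only: comp_assoc[symmetric] W_comp_inv[OF assms(2)] id_comp)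
  define \<kappa> where "\<kappa> = \<rho> - z \<rho>"
  have nonneg: "0 \<le> \<omega> \<delta> \<bullet> \<kappa>" for \<delta> unfolding \<kappa>_def by (rule dominant_diff_coordinate[OF dominant_rho zW])
  let ?l = "steinberg_weight v"
  have "z ?l = ?l"
    using assms(3) W_apply_inv[OF assms(1), of "v ?l"] W_inv_apply[OF assms(2), of ?l] by (simp add: z_def)
  then have "?l \<bullet> z \<rho> = ?l \<bullet> \<rho>" using W_inner[OF zW, of ?l \<rho>] by simp
  then have "(\<Sum>\<delta>\<in>\<Delta>. (?l \<bullet> coroot \<delta>) * (\<omega> \<delta> \<bullet> \<kappa>)) = 0"
    unfolding inner_expand[symmetric] \<kappa>_def by (simp add: inner_diff_right)
  then have prods: "(?l \<bullet> coroot \<delta>) * (\<omega> \<delta> \<bullet> \<kappa>) = 0" if "\<delta> \<in> \<Delta>" for \<delta>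
    using that nonneg finite_simple dominantD[OF steinberg_weight_dominant]
    by (subst (asm) sum_nonneg_eq_0_iff) auto
  have zero: "\<omega> \<delta> \<bullet> \<kappa> = 0" if "\<delta> \<in> \<Delta>" "v \<delta> \<notin> pos" for \<delta>
    using prods[OF that(1)] steinberg_weight_inner[OF that(1), of v] that(2) by simp
  have "v \<kappa> = (\<Sum>\<delta>\<in>\<Delta>. (\<omega> \<delta> \<bullet> \<kappa>) *\<^sub>R v (coroot \<delta>))"
    using W_linear[OF assms(2)] by (subst expand_coroots[of \<kappa>]) (simp add: linear_sum linear_scale)
  then have expand: "\<rho> \<bullet> v \<kappa> = (\<Sum>\<delta>\<in>\<Delta>. (\<omega> \<delta> \<bullet> \<kappa>) * (\<rho> \<bullet> v (coroot \<delta>)))"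
    by (simp add: inner_sum_right)
  have vpos: "0 < \<rho> \<bullet> v (coroot \<delta>)" if "v \<delta> \<in> pos" for \<delta>
    using rho_inner_coroot_pos[OF that] by (simp add: W_coroot[OF assms(2)])
  have terms: "0 \<le> (\<omega> \<delta> \<bullet> \<kappa>) * (\<rho> \<bullet> v (coroot \<delta>))" if "\<delta> \<in> \<Delta>" for \<delta>
    using that zero[OF that] nonneg[of \<delta>] vpos[of \<delta>] by (cases "v \<delta> \<in> pos") (auto simp: less_imp_le)
  have diff: "\<rho> \<bullet> v \<rho> - \<rho> \<bullet> u \<rho> = \<rho> \<bullet> v \<kappa>"
    by (simp add: \<kappa>_def uz W_diff[OF assms(2)] inner_diff_right)
  have "0 \<le> (\<Sum>\<delta>\<in>\<Delta>. (\<omega> \<delta> \<bullet> \<kappa>) * (\<rho> \<bullet> v (coroot \<delta>)))" by (rule sum_nonneg) (rule terms)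
  then show "\<rho> \<bullet> u \<rho> \<le> \<rho> \<bullet> v \<rho>" using expand diff by linarith
  assume "\<rho> \<bullet> u \<rho> = \<rho> \<bullet> v \<rho>"
  then have "(\<Sum>\<delta>\<in>\<Delta>. (\<omega> \<delta> \<bullet> \<kappa>) * (\<rho> \<bullet> v (coroot \<delta>))) = 0" using diff expand by simp
  then have prods': "(\<omega> \<delta> \<bullet> \<kappa>) * (\<rho> \<bullet> v (coroot \<delta>)) = 0" if "\<delta> \<in> \<Delta>" for \<delta>
    using that terms finite_simple by (subst (asm) sum_nonneg_eq_0_iff) auto
  have "\<omega> \<delta> \<bullet> \<kappa> = 0" if "\<delta> \<in> \<Delta>" for \<delta>
  proof (cases "v \<delta> \<in> pos")
    case True
    then show ?thesis using prods'[OF that] vpos[OF True] by simp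
  qed (rule zero[OF that])
  then have "\<kappa> = 0" by (subst expand_coroots[of \<kappa>]) simp
  then have "z = id" using strict_rho[OF zW] by (simp add: \<kappa>_def)
  then show "u = v" using uz by (simp only: comp_id)
qed

lemma det_kP:
  assumes "A \<in> carrier_mat n n" "\<And>i j. i < n \<Longrightarrow> j < n \<Longrightarrow> A $$ (i, j) \<in> kP"
  shows "det A \<in> kP"
  unfolding det_def'[OF assms(1)]
proof (intro kP_sum kP_mult kP_prod)
  fix p assume "p \<in> {p. p permutes {0..<n}}"
  then show "A $$ (i, p i) \<in> kP" if "i \<in> {0..<n}" for i
    using that assms(2)[of i "p i"] permutes_in_image[of p "{0..<n}" i] by auto
  show "signof p \<in> kP" by (rule kP_of_int)
qed

lemma act_det:
  assumes "w \<in> W" "A \<in> carrier_mat n n" "\<And>i j. i < n \<Longrightarrow> j < n \<Longrightarrow> act w (A $$ (i, j)) = A $$ (i, j)"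
  shows "act w (det A) = det A"
  unfolding det_def'[OF assms(2)] act_sum
proof (rule sum.cong[OF refl])
  fix p assume "p \<in> {p. p permutes {0..<n}}"
  then have "act w (A $$ (i, p i)) = A $$ (i, p i)" if "i \<in> {0..<n}" for i
    using that assms(3)[of i "p i"] permutes_in_image[of p "{0..<n}" i] by auto
  then show "act w (signof p * (\<Prod>i = 0..<n. A $$ (i, p i))) = signof p * (\<Prod>i = 0..<n. A $$ (i, p i))"
    using assms(1) by (simp add: act_mult_W act_prod_W act_of_int_W)
qed

text \<open>
  The monomials \<open>u (steinberg_weight u)\<close> are Steinberg's basis of the group algebra over its invariants.
  In the determinant below only the identity permutation contributes to the top exponent.
\<close>

lemma lead_det_steinberg:
  fixes c :: "nat \<Rightarrow> 'k::comm_ring_1"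
  assumes us: "distinct us" "set us = W" and n: "n = length us"
  shows "lead (det (mat n n (\<lambda>(i, j). Poly_Mapping.single (inv (us ! i) ((us ! j) (steinberg_weight (us ! j)))) (c i))))
    (\<Sum>u\<in>W. steinberg_weight u) (\<Prod>i<n. c i)"
proof -
  define u where "u i = us ! i" for i
  define l where "l i = steinberg_weight (u i)" for i
  define A where "A = mat n n (\<lambda>(i, j). Poly_Mapping.single (inv (u i) (u j (l j))) (c i))"
  have uW: "u i \<in> W" if "i < n" for i using nth_mem[of i us] that unfolding us(2) n u_def by blast
  have A: "A \<in> carrier_mat n n" by (simp add: A_def)
  let ?U = "{0..<n}"
  have top: "(\<Sum>i\<in>?U. l i) = (\<Sum>u\<in>W. steinberg_weight u)"
  proof -
    have "bij_betw u ?U W" unfolding u_def by (rule bij_betw_nth[OF us(1)]) (simp_all add: us(2) n lessThan_atLeast0)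
    from sum.reindex_bij_betw[OF this, of steinberg_weight] show ?thesis by (simp add: l_def)
  qed
  define x where "x p = (\<Sum>i\<in>?U. inv (u i) (u (p i) (l (p i))))" for p
  have summand: "signof p * (\<Prod>i = 0..<n. A $$ (i, p i)) = Poly_Mapping.single (x p) (signof p * (\<Prod>i\<in>?U. c i))"
    if p: "p permutes ?U" for p
  proof -
    have "(\<Prod>i = 0..<n. A $$ (i, p i)) = (\<Prod>i\<in>?U. Poly_Mapping.single (inv (u i) (u (p i) (l (p i)))) (c i))"
      using permutes_in_image[OF p] by (intro prod.cong) (auto simp: A_def)
    also have "\<dots> = Poly_Mapping.single (x p) (\<Prod>i\<in>?U. c i)" by (simp add: mon_prod x_def)
    finally show ?thesis by (simp add: mult_single flip: single_of_int)
  qed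
  have x_id: "x id = (\<Sum>u\<in>W. steinberg_weight u)"
  proof -
    have "x id = (\<Sum>i\<in>?U. l i)" unfolding x_def by (rule sum.cong) (simp_all add: W_inv_apply uW)
    then show ?thesis using top by simp
  qed
  have x_less: "\<rho> \<bullet> x p < \<rho> \<bullet> (\<Sum>u\<in>W. steinberg_weight u)" if p: "p permutes ?U" "p \<noteq> id" for p
  proof -
    have pU: "p i < n" if "i < n" for i using permutes_in_image[OF p(1), of i] that by auto
    \<comment> \<open>Each exponent lies in the orbit of a dominant weight, so its height is at most
      that of the weight, with equality only if the weight is fixed.\<close>
    have le: "\<rho> \<bullet> inv (u i) (u (p i) (l (p i))) \<le> \<rho> \<bullet> l (p i)" and
      eq: "\<rho> \<bullet> inv (u i) (u (p i) (l (p i))) = \<rho> \<bullet> l (p i) \<Longrightarrow> (inv (u i) \<circ> u (p i)) (l (p i)) = l (p i)"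
      if "i < n" for i
    proof -
      have "inv (u i) \<circ> u (p i) \<in> W" by (intro W_comp W_inv uW pU that)
      from rho_dominant_less[OF steinberg_weight_dominant this, of "u (p i)"]
      show "\<rho> \<bullet> inv (u i) (u (p i) (l (p i))) \<le> \<rho> \<bullet> l (p i)"
        "\<rho> \<bullet> inv (u i) (u (p i) (l (p i))) = \<rho> \<bullet> l (p i) \<Longrightarrow> (inv (u i) \<circ> u (p i)) (l (p i)) = l (p i)"
        by (fastforce simp: l_def)+
    qed
    have reindex: "(\<Sum>i\<in>?U. F (p i)) = (\<Sum>i\<in>?U. F i)" for F :: "nat \<Rightarrow> real"
      by (rule sum.reindex_bij_betw[OF permutes_imp_bij[OF p(1)]])
    have sum_l: "\<rho> \<bullet> (\<Sum>u\<in>W. steinberg_weight u) = (\<Sum>i\<in>?U. \<rho> \<bullet> l (p i))"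
      unfolding top[symmetric] inner_sum_right reindex[of "\<lambda>i. \<rho> \<bullet> l i"] ..
    have px: "\<rho> \<bullet> x p = (\<Sum>i\<in>?U. \<rho> \<bullet> inv (u i) (u (p i) (l (p i))))"
      unfolding x_def inner_sum_right ..
    show ?thesis
    proof (rule ccontr)
      assume "\<not> ?thesis"
      then have "(\<Sum>i\<in>?U. \<rho> \<bullet> l (p i)) \<le> (\<Sum>i\<in>?U. \<rho> \<bullet> inv (u i) (u (p i) (l (p i))))"
        using sum_l px by linarith
      then have "(\<Sum>i\<in>?U. \<rho> \<bullet> l (p i) - \<rho> \<bullet> inv (u i) (u (p i) (l (p i)))) = 0"
        using le sum_mono[of ?U "\<lambda>i. \<rho> \<bullet> inv (u i) (u (p i) (l (p i)))" "\<lambda>i. \<rho> \<bullet> l (p i)"]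
        by (simp add: sum_subtractf)
      then have tight: "\<rho> \<bullet> inv (u i) (u (p i) (l (p i))) = \<rho> \<bullet> l (p i)" if "i < n" for i
        using that le by (subst (asm) sum_nonneg_eq_0_iff) auto
      have fx: "(inv (u i) \<circ> u (p i)) (steinberg_weight (u (p i))) = steinberg_weight (u (p i))" if "i < n" for i
        using eq[OF that tight[OF that]] by (simp add: l_def)
      have le': "\<rho> \<bullet> u i \<rho> \<le> \<rho> \<bullet> u (p i) \<rho>" if "i < n" for i
        by (rule steinberg_fixed(1)[OF uW[OF that] uW[OF pU[OF that]] fx[OF that]])
      \<comment> \<open>As \<open>p\<close> permutes the indices, the inequalities
        \<open>le'\<close> have total defect zero, so all are equalities and
        \<open>u i = u (p i)\<close> follows.\<close>
      have "(\<Sum>i\<in>?U. \<rho> \<bullet> u (p i) \<rho> - \<rho> \<bullet> u i \<rho>) = 0"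
        unfolding sum_subtractf reindex[of "\<lambda>i. \<rho> \<bullet> u i \<rho>"] by simp
      then have "\<rho> \<bullet> u i \<rho> = \<rho> \<bullet> u (p i) \<rho>" if "i < n" for i
        using that le' by (subst (asm) sum_nonneg_eq_0_iff) auto
      then have "u i = u (p i)" if "i < n" for i
        using steinberg_fixed(2)[OF uW[OF that] uW[OF pU[OF that]] fx[OF that]] that by blast
      then have "p i = i" if "i < n" for i
        using that pU[OF that] nth_eq_iff_index_eq[OF us(1), of i "p i"] n unfolding u_def by simp
      moreover have "p i = i" if "\<not> i < n" for i
        using permutes_not_in[OF p(1), of i] that by simp
      ultimately have "p = id" unfolding fun_eq_iff id_apply by blast
      then show False using p(2) by blast
    qed
  qed
  have fin: "finite {p. p permutes ?U}" by (rule finite_permutations) simp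
  have "det A = (\<Sum>p\<in>{p. p permutes ?U}. Poly_Mapping.single (x p) (signof p * (\<Prod>i\<in>?U. c i)))"
    unfolding det_def'[OF A] by (rule sum.cong) (simp_all add: summand)
  also have "\<dots> = Poly_Mapping.single (x id) (signof id * (\<Prod>i\<in>?U. c i))
      + (\<Sum>p\<in>{p. p permutes ?U} - {id}. Poly_Mapping.single (x p) (signof p * (\<Prod>i\<in>?U. c i)))"
    using permutes_id by (intro sum.remove[OF fin]) simp
  finally have det: "det A = Poly_Mapping.single (\<Sum>u\<in>W. steinberg_weight u) (\<Prod>i<n. c i)
      + (\<Sum>p\<in>{p. p permutes ?U} - {id}. Poly_Mapping.single (x p) (signof p * (\<Prod>i\<in>?U. c i)))"
    by (simp add: x_id lessThan_atLeast0)
  have "lead (det A) (\<Sum>u\<in>W. steinberg_weight u) (\<Prod>i<n. c i)"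
  proof (rule leadI[OF det])
    fix y assume "y \<in> supp (\<Sum>p\<in>{p. p permutes ?U} - {id}. Poly_Mapping.single (x p) (signof p * (\<Prod>i\<in>?U. c i)))"
    then obtain p where p: "p \<in> {p. p permutes ?U} - {id}" "y \<in> supp (Poly_Mapping.single (x p) (signof p * (\<Prod>i\<in>?U. c i)))"
      unfolding in_keys_iff coeff_at_sum by (rule sum.not_neutral_contains_not_neutral)
    then show "\<rho> \<bullet> y < \<rho> \<bullet> (\<Sum>u\<in>W. steinberg_weight u)"
      using x_less by (auto split: if_splits)
  qed
  then show ?thesis by (simp add: A_def u_def l_def)
qed

lemma sgn_square: "sgn w * sgn w = 1"
  by (simp add: sgn_def flip: power_mult_distrib)

text \<open>
  The Gram matrix \<open>N\<close> of Steinberg's basis under \<open>(f, g) \<mapsto> alternator (f g) / alternator (mon \<rho>)\<close> has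
  an invariant determinant whose top exponent is \<open>0\<close>, so it is a constant \<open>\<plusminus>1\<close>.
\<close>

lemma dual_basis:
  "\<exists>(n::nat) (e :: nat \<Rightarrow> 'v \<Rightarrow>\<^sub>0 'k::comm_ring_1) F. (\<forall>i<n. e i \<in> kP \<and> F i \<in> kP) \<and>
     (\<forall>f\<in>kP. \<forall>p. (\<forall>i<n. alternator (f * e i) = p i * alternator (mon \<rho>)) \<longrightarrow> f = (\<Sum>i<n. p i * F i))"
proof -
  obtain us where us: "set us = W" "distinct us" using finite_distinct_list[OF finite_W] by blast
  define n where "n = length us"
  define u where "u i = us ! i" for i
  define e where "e i = (mon (u i (steinberg_weight (u i))) :: 'v \<Rightarrow>\<^sub>0 'k)" for i
  define D where "D = (alternator (mon \<rho>) :: 'v \<Rightarrow>\<^sub>0 'k)"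
  have leadD: "lead D \<rho> 1" unfolding D_def by (rule lead_alternator_rho)
  have uW: "u i \<in> W" if "i < n" for i using nth_mem[of i us] that unfolding us(1) n_def u_def by blast
  have eP: "e i \<in> kP" if "i < n" for i
    unfolding e_def by (rule kP_single[OF W_P[OF uW[OF that] steinberg_weight_P]])
  have bij_u: "bij_betw u {0..<n} W"
    unfolding u_def by (rule bij_betw_nth[OF us(2)]) (simp_all add: us(1) n_def lessThan_atLeast0)
  have "bij_betw (\<lambda>w. inv w) W W"
    by (rule bij_betwI[where g = "\<lambda>w. inv w"]) (auto simp: W_inv W_inv_inv)
  from bij_betw_trans[OF bij_u this] have bij_inv: "bij_betw (\<lambda>i. inv (u i)) {0..<n} W" by (simp add: comp_def)
  \<comment> \<open>The rows of \<open>A\<close> are the conjugates of the basis. \<open>B\<close>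
    carries the signs in addition, so that the transpose of \<open>A\<close> times \<open>B\<close>
    computes alternating sums of products.\<close>
  define A where "A = mat n n (\<lambda>(i, j). Poly_Mapping.single (inv (us ! i) ((us ! j) (steinberg_weight (us ! j)))) (1 :: 'k))"
  define c where "c i = (of_int (sgn (inv (u i))) :: 'k)" for i
  define B where "B = mat n n (\<lambda>(i, j). Poly_Mapping.single (inv (us ! i) ((us ! j) (steinberg_weight (us ! j)))) (c i))"
  have cA: "A \<in> carrier_mat n n" and cB: "B \<in> carrier_mat n n" by (simp_all add: A_def B_def)
  have A_entry: "A $$ (i, j) = act (inv (u i)) (e j)" if "i < n" "j < n" for i j
    using that by (simp add: A_def e_def u_def act_single)
  have B_entry: "B $$ (i, j) = of_int (sgn (inv (u i))) * act (inv (u i)) (e j)" if "i < n" "j < n" for i j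
    using that by (simp add: B_def e_def u_def c_def act_single mult_single flip: single_of_int)
  define top where "top = (\<Sum>u\<in>W. steinberg_weight u)"
  have leadA: "lead (det A) top 1"
    using lead_det_steinberg[OF us(2,1), of n "\<lambda>_. 1 :: 'k"] by (simp add: A_def top_def n_def)
  define \<epsilon> where "\<epsilon> = (\<Prod>i<n. c i)"
  have leadB: "lead (det B) top \<epsilon>"
    using lead_det_steinberg[OF us(2,1), of n c] by (simp add: B_def top_def n_def \<epsilon>_def)
  have eps: "\<epsilon> * \<epsilon> = 1"
    unfolding \<epsilon>_def prod.distrib[symmetric] c_def of_int_mult[symmetric] sgn_square by simp
  have alternator_sum: "alternator f = (\<Sum>k = 0..<n. of_int (sgn (inv (u k))) * act (inv (u k)) f)" for f :: "'v \<Rightarrow>\<^sub>0 'k"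
    unfolding alternator_def by (rule sum.reindex_bij_betw[OF bij_inv, symmetric])
  have "\<forall>i j. \<exists>p. i < n \<longrightarrow> j < n \<longrightarrow> p \<in> kPW \<and> alternator (e i * e j) = p * D"
    using alternator_quotient[OF kP_mult[OF eP eP]] unfolding D_def by blast
  then obtain Nf where Nf: "\<And>i j. i < n \<Longrightarrow> j < n \<Longrightarrow> Nf i j \<in> kPW \<and> alternator (e i * e j) = Nf i j * D"
    by metis
  define N where "N = mat n n (\<lambda>(i, j). Nf i j)"
  have cN: "N \<in> carrier_mat n n" by (simp add: N_def)
  have N_entry: "N $$ (i, j) = Nf i j" if "i < n" "j < n" for i j using that by (simp add: N_def)
  have gram: "transpose_mat A * B = D \<cdot>\<^sub>m N"
  proof (rule eq_matI)
    fix i j assume "i < dim_row (D \<cdot>\<^sub>m N)" "j < dim_col (D \<cdot>\<^sub>m N)"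
    then have ij: "i < n" "j < n" using cN by auto
    have "(transpose_mat A * B) $$ (i, j) = (\<Sum>k = 0..<n. A $$ (k, i) * B $$ (k, j))"
      using ij cA cB by (simp add: scalar_prod_def)
    also have "\<dots> = alternator (e i * e j)"
      unfolding alternator_sum
      by (rule sum.cong) (simp_all add: A_entry B_entry ij act_mult_W W_inv uW mult.left_commute)
    also have "\<dots> = (D \<cdot>\<^sub>m N) $$ (i, j)" using Nf[OF ij] ij cN by (simp add: N_entry mult.commute)
    finally show "(transpose_mat A * B) $$ (i, j) = (D \<cdot>\<^sub>m N) $$ (i, j)" .
  qed (use cA cB cN in auto)
  have detN: "det A * det B = D ^ n * det N"
    using arg_cong[OF gram, of det] det_mult[of "transpose_mat A" n B] det_transpose[OF cA] cA cB cN by simp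
  have inv_detN: "act w (det N) = det N" if "w \<in> W" for w
    using that Nf by (intro act_det[OF that cN]) (auto simp: N_entry kPW_act)
  have cardW: "card W = n" using us distinct_card[of us] by (simp add: n_def)
  \<comment> \<open>The top exponent of \<open>D ^ n\<close> is n times \<rho>, which by
    \<open>steinberg_weight_sum\<close> is \<open>top + top\<close>, as for
    \<open>det A * det B\<close>. This leaves height at most 0 for \<open>det N\<close>.\<close>
  have leadDn: "lead (D ^ n) (top + top) 1"
    using lead_power[OF leadD, of n] steinberg_weight_sum by (simp add: top_def cardW scaleR_2)
  obtain r where r: "det A * det B = Poly_Mapping.single (top + top) \<epsilon> + r" "\<And>y. y \<in> supp r \<Longrightarrow> \<rho> \<bullet> y < \<rho> \<bullet> (top + top)"
    using lead_mult[OF leadA leadB] unfolding lead_def by auto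
  have top_detN: "\<rho> \<bullet> z \<le> 0" if z: "z \<in> supp (det N)" for z
  proof -
    from z have "det N \<noteq> 0" by auto
    from ex_top_exponent[OF this] obtain z0
      where z0: "z0 \<in> supp (det N)" "\<And>z'. z' \<in> supp (det N) \<Longrightarrow> \<rho> \<bullet> z' \<le> \<rho> \<bullet> z0" by blast
    have "coeff_at (D ^ n * det N) (top + top + z0) = 1 * coeff_at (det N) z0"
      by (rule coeff_at_lead_mult[OF leadDn]) (rule z0(2))
    then have "top + top + z0 \<in> supp (Poly_Mapping.single (top + top) \<epsilon> + r)"
      unfolding r(1)[symmetric] detN using z0(1) by (simp add: in_keys_iff)
    then have "top + top + z0 = top + top \<or> top + top + z0 \<in> supp r"
      using Poly_Mapping.keys_add[of "Poly_Mapping.single (top + top) \<epsilon>" r] by (auto split: if_splits)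
    then have "\<rho> \<bullet> (top + top + z0) \<le> \<rho> \<bullet> (top + top)" using r(2) by (auto intro: less_imp_le)
    then show ?thesis using z0(2)[OF z] unfolding inner_add_right[of _ _ z0] by linarith
  qed
  have "coeff_at (D ^ n * det N) (top + top + 0) = 1 * coeff_at (det N) 0"
    by (rule coeff_at_lead_mult[OF leadDn]) (use top_detN in simp)
  moreover have "coeff_at (det A * det B) (top + top) = \<epsilon>"
    using r(2)[of "top + top"] by (auto simp: r(1) lookup_add in_keys_iff)
  ultimately have "coeff_at (det N) 0 = \<epsilon>" by (simp add: detN)
  then have detN_const: "det N = Poly_Mapping.single 0 \<epsilon>"
    using invariant_constant[OF inv_detN top_detN] by simp
  \<comment> \<open>The constant \<open>\<epsilon>\<close> is its own inverse, so this is the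
    inverse matrix of \<open>N\<close>, with entries still supported in \<open>P\<close>.\<close>
  define K where "K = Poly_Mapping.single 0 \<epsilon> \<cdot>\<^sub>m adj_mat N"
  have cadj: "adj_mat N \<in> carrier_mat n n" and cK: "K \<in> carrier_mat n n"
    using adj_mat(1)[OF cN] by (simp_all add: K_def)
  have NK: "N * K = 1\<^sub>m n"
  proof -
    have "N * K = Poly_Mapping.single 0 \<epsilon> \<cdot>\<^sub>m (det N \<cdot>\<^sub>m 1\<^sub>m n)"
      unfolding K_def adj_mat(2)[OF cN, symmetric] by (rule mult_smult_distrib[OF cN cadj])
    also have "\<dots> = 1\<^sub>m n"
      by (rule eq_matI) (simp_all add: detN_const mult_single eps mult.assoc[symmetric])
    finally show ?thesis .
  qed
  have K_kP: "K $$ (i, j) \<in> kP" if "i < n" "j < n" for i j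
  proof -
    have "mat_delete N j i \<in> carrier_mat (n - 1) (n - 1)" using mat_delete_carrier[OF cN] .
    moreover have "mat_delete N j i $$ (a, b) \<in> kP" if "a < n - 1" "b < n - 1" for a b
      using that cN Nf by (auto simp: mat_delete_def N_entry kPW_kP)
    ultimately have "det (mat_delete N j i) \<in> kP" by (rule det_kP)
    moreover have "(- 1) ^ m \<in> kP" for m
      using kP_of_int[of "(-1) ^ m"] by simp
    ultimately have "Poly_Mapping.single 0 \<epsilon> * ((- 1) ^ (j + i) * det (mat_delete N j i)) \<in> kP"
      by (intro kP_mult kP_single P_zero)
    moreover have "K $$ (i, j) = Poly_Mapping.single 0 \<epsilon> * ((- 1) ^ (j + i) * det (mat_delete N j i))"
      using that cN cadj by (simp add: K_def adj_mat_def cofactor_def)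
    ultimately show ?thesis by (simp only:)
  qed
  define M where "M = transpose_mat A"
  have cM: "M \<in> carrier_mat n n" using cA by (simp add: M_def)
  have cBK: "B * K \<in> carrier_mat n n" and cKX: "K * M \<in> carrier_mat n n" using cB cK cM by auto
  have XY: "M * (B * K) = D \<cdot>\<^sub>m 1\<^sub>m n"
  proof -
    have "M * (B * K) = (M * B) * K" using assoc_mult_mat[OF cM cB cK] by simp
    also have "\<dots> = D \<cdot>\<^sub>m (N * K)" unfolding M_def gram using mult_smult_assoc_mat[OF cN cK] by simp
    finally show ?thesis by (simp add: NK)
  qed
  have cadjX: "adj_mat M \<in> carrier_mat n n" using adj_mat(1)[OF cM] .
  have cYX: "(B * K) * M \<in> carrier_mat n n" using cBK cM by auto
  \<comment> \<open>\<open>B * K\<close> is a right inverse of \<open>M\<close> up to the factor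
    \<open>D\<close>. Multiplying by the adjugate makes it a left inverse after cancelling
    \<open>det M\<close>, which has leading coefficient 1.\<close>
  have detX: "det M \<cdot>\<^sub>m ((B * K) * M) = D \<cdot>\<^sub>m (det M \<cdot>\<^sub>m 1\<^sub>m n)"
  proof -
    have "det M \<cdot>\<^sub>m ((B * K) * M) = (det M \<cdot>\<^sub>m 1\<^sub>m n) * ((B * K) * M)"
      using mult_smult_assoc_mat[OF one_carrier_mat cYX, of "det M"] left_mult_one_mat[OF cYX] by simp
    also have "\<dots> = adj_mat M * (M * ((B * K) * M))"
      unfolding adj_mat(3)[OF cM, symmetric] by (rule assoc_mult_mat[OF cadjX cM cYX])
    also have "M * ((B * K) * M) = (M * (B * K)) * M" by (rule assoc_mult_mat[OF cM cBK cM, symmetric])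
    also have "\<dots> = D \<cdot>\<^sub>m M"
      unfolding XY using mult_smult_assoc_mat[OF one_carrier_mat cM, of D] left_mult_one_mat[OF cM] by simp
    also have "adj_mat M * (D \<cdot>\<^sub>m M) = D \<cdot>\<^sub>m (det M \<cdot>\<^sub>m 1\<^sub>m n)"
      unfolding adj_mat(3)[OF cM, symmetric] by (rule mult_smult_distrib[OF cadjX cM])
    finally show ?thesis .
  qed
  have YX: "((B * K) * M) $$ (k, l) = (if k = l then D else 0)" if "k < n" "l < n" for k l
  proof -
    have "det M * ((B * K) * M) $$ (k, l) = det M * (if k = l then D else 0)"
      using arg_cong[OF detX, of "\<lambda>Q. Q $$ (k, l)"] that cYX cBK cM by (auto simp: mult.commute)
    moreover have "lead (det M) top 1" using leadA det_transpose[OF cA] by (simp add: M_def)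
    ultimately show ?thesis using lead_cancel_eq by blast
  qed
  \<comment> \<open>The index of the identity of \<open>W\<close>: there the conjugate of
    \<open>f\<close> is \<open>f\<close> itself.\<close>
  obtain l where l: "l < n" "u l = id"
    using W_id us(1) unfolding n_def u_def by (metis in_set_conv_nth)
  define F where "F i = (K * M) $$ (i, l)" for i
  have F_kP: "F i \<in> kP" if "i < n" for i
  proof -
    have "F i = (\<Sum>j = 0..<n. K $$ (i, j) * A $$ (l, j))"
      using that l(1) cK cM cA by (simp add: F_def M_def scalar_prod_def)
    moreover have "A $$ (l, j) \<in> kP" if "j < n" for j
      using A_entry[OF l(1) that] kP_act[OF W_inv[OF uW[OF l(1)]] eP[OF that]] by simp
    ultimately show ?thesis using K_kP[OF that] by (auto intro!: kP_sum kP_mult)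
  qed
  have BF: "(\<Sum>i<n. B $$ (k, i) * F i) = (if k = l then D else 0)" if "k < n" for k
  proof -
    have "(Q * Q') $$ (k, l) = (\<Sum>i<n. Q $$ (k, i) * Q' $$ (i, l))"
      if "Q \<in> carrier_mat n n" "Q' \<in> carrier_mat n n" for Q Q' :: "('v \<Rightarrow>\<^sub>0 'k) mat"
      using that \<open>k < n\<close> l(1) by (simp add: scalar_prod_def lessThan_atLeast0)
    from this[OF cB cKX] have "(\<Sum>i<n. B $$ (k, i) * F i) = (B * (K * M)) $$ (k, l)"
      by (simp only: F_def)
    then show ?thesis using YX[OF that l(1)] assoc_mult_mat[OF cB cK cM] by simp
  qed
  have main: "f = (\<Sum>i<n. p i * F i)" if f: "f \<in> kP" and p: "\<And>i. i < n \<Longrightarrow> alternator (f * e i) = p i * D" for f p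
  proof (rule lead_cancel_eq[OF leadD])
    \<comment> \<open>Writing the alternating sums over conjugates and exchanging summations brings
      in \<open>B\<close> times \<open>F\<close>, which is \<open>D\<close> at \<open>l\<close> and
      zero elsewhere.\<close>
    have "D * (\<Sum>i<n. p i * F i) = (\<Sum>i<n. alternator (f * e i) * F i)"
      unfolding sum_distrib_left by (rule sum.cong) (simp_all add: p mult_ac)
    also have "\<dots> = (\<Sum>i<n. \<Sum>k = 0..<n. act (inv (u k)) f * (B $$ (k, i) * F i))"
      unfolding alternator_sum sum_distrib_right
      by (intro sum.cong) (simp_all add: B_entry act_mult_W W_inv uW mult_ac)
    also have "\<dots> = (\<Sum>k = 0..<n. act (inv (u k)) f * (\<Sum>i<n. B $$ (k, i) * F i))"
      unfolding sum_distrib_left by (rule sum.swap)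
    also have "\<dots> = (\<Sum>k = 0..<n. if k = l then act (inv (u l)) f * D else 0)"
      by (rule sum.cong) (simp_all add: BF)
    also have "\<dots> = f * D"
    proof -
      have "inv (u l) = id" unfolding l(2) by (rule inv_id)
      then show ?thesis using l(1) by (simp add: sum.delta act_id)
    qed
    finally show "D * f = D * (\<Sum>i<n. p i * F i)" by (simp add: mult.commute)
  qed
  show ?thesis
    using eP F_kP main unfolding D_def by (intro exI[of _ n] exI[of _ e] exI[of _ F]) auto
qed

end

section \<open>The Bernstein presentation\<close>

locale affine_hecke_setup =
  affine_hecke_algebra smul R \<Delta> q T + irreducible_based_root_system R \<Delta>
  for smul :: "'k::field \<Rightarrow> 'h::ring_1 \<Rightarrow> 'h" and R \<Delta> :: "'v::euclidean_space set"
    and q :: 'k and T :: "('v \<Rightarrow> 'v) \<times> 'v \<Rightarrow> 'h" +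
  fixes v :: 'k
  assumes q_nonzero: "q \<noteq> 0" and v_square: "v ^ 2 = q"
begin

lemma v_nonzero: "v \<noteq> 0"
  using q_nonzero v_square by auto

lemma T_prod:
  assumes "u \<in> W" "w \<in> W" "x \<in> P" "y \<in> P"
    and "lng (u \<circ> w, inv w x + y) = lng (u, x) + lng (w, y)"
  shows "T (u, x) * T (w, y) = T (u \<circ> w, inv w x + y)"
  using T_mult[of "(u, x)" "(w, y)"] assms by (simp add: affine_weyl_group_def)

lemma span_T_induct [case_names zero add T]:
  assumes "Q 0" "\<And>c h h'. Q h \<Longrightarrow> Q h' \<Longrightarrow> Q (smul c h + h')"
    and "\<And>u x. u \<in> W \<Longrightarrow> x \<in> P \<Longrightarrow> Q (T (u, x))"
  shows "Q h"
proof -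
  have "h \<in> span (T ` carrier (affine_weyl_group R))" by (simp add: T_span)
  then show ?thesis
  proof (induct rule: span_induct_alt)
    case (step c b h)
    then obtain g where "g \<in> carrier (affine_weyl_group R)" "b = T g" by blast
    then have "Q b" using assms(3)[of "fst g" "snd g"] by (auto simp: affine_weyl_group_def)
    then show ?case using assms(2) step(2) by blast
  qed (rule assms(1))
qed

lemma lng_one: "lng (id, 0) = 0"
  using lng_finite[OF W_id] by (simp add: inversions_def)

lemma T_one: "T (id, 0) = 1"
proof -
  have "T (id, 0) * h = h" for h
  proof (induct h rule: span_T_induct)
    case (T u x)
    have "inv u 0 + x = x" using W_zero[OF W_inv[OF T(1)]] by simp
    from T_prod[OF W_id T(1) P_zero T(2), unfolded this id_comp lng_one] show ?case by (simp only: add_0_left)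
  qed (simp_all add: distrib_left scale_mult_right)
  from this[of 1] show ?thesis by simp
qed

section \<open>Invertibility of the standard basis elements\<close>

definition ring_unit :: "'h \<Rightarrow> bool" where
  "ring_unit h \<longleftrightarrow> (\<exists>k. h * k = 1 \<and> k * h = 1)"

lemma ring_unit_mult:
  assumes "ring_unit a" "ring_unit b"
  shows "ring_unit (a * b)"
proof -
  obtain a' b' where ab: "a * a' = 1" "a' * a = 1" "b * b' = 1" "b' * b = 1"
    using assms unfolding ring_unit_def by blast
  have "(a * b) * (b' * a') = a * (b * b') * a'" "(b' * a') * (a * b) = b' * (a' * a) * b"
    by (simp_all only: mult.assoc)
  then show ?thesis unfolding ring_unit_def using ab by (intro exI[of _ "b' * a'"]) simp
qed

lemma T_reflection_relation:
  assumes "r \<in> simple_reflections R \<Delta>"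
  shows "(T r + 1) * (T r - smul q 1) = 0" "T r * T r = smul (q - 1) (T r) + smul q 1"
proof -
  have "T r * T r + T r - smul q (T r) - smul q 1 = 0"
    using T_quadratic[OF assms] by (simp add: left_diff_distrib distrib_left scale_mult_left algebra_simps)
  then show "T r * T r = smul (q - 1) (T r) + smul q 1" by (simp add: scale_left_diff_distrib algebra_simps)
  then show "(T r + 1) * (T r - smul q 1) = 0"
    by (simp add: distrib_right right_diff_distrib scale_mult_right scale_left_diff_distrib scale_right_distrib)
qed

lemma T_reflection_inverse:
  assumes "r \<in> simple_reflections R \<Delta>"
  defines "r' \<equiv> smul (inverse q) (T r - smul (q - 1) 1)"
  shows "T r * r' = 1" "r' * T r = 1"
  using T_reflection_relation(2)[OF assms(1)] q_nonzero
  by (simp_all add: r'_def scale_mult_left scale_mult_right left_diff_distrib right_diff_distrib scale_right_diff_distrib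
      scale_right_distrib)

lemma ring_unit_T_reflection: "r \<in> simple_reflections R \<Delta> \<Longrightarrow> ring_unit (T r)"
  using T_reflection_inverse unfolding ring_unit_def by blast

lemma simple_in_reflections: "\<gamma> \<in> \<Delta> \<Longrightarrow> (s \<gamma>, 0) \<in> simple_reflections R \<Delta>"
  by (auto simp: simple_reflections_def)

lemma affine_in_reflections: "(s \<beta>, - \<beta>) \<in> simple_reflections R \<Delta>"
  by (simp add: simple_reflections_def affine_weyl_group_def inv_reflection
      reflection_self root_nonzero[OF beta_root])

lemma lng_simple: assumes "\<gamma> \<in> \<Delta>" shows "lng (s \<gamma>, 0) = 1"
  using lng_right_simple[OF W_id P_zero assms] W_zero[OF W_simple[OF assms]]
  by (simp add: lng_one cross_def pairing_zero simple_pos[OF assms])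

lemma lng_affine: "lng (s \<beta>, - \<beta>) = 1"
  using lng_right_affine[OF W_id P_zero] W_zero[OF W_reflection[OF beta_root]]
  by (simp add: lng_one cross_def pairing_zero beta_pos)

lemma T_right_simple:
  assumes "u \<in> W" "x \<in> P" "\<gamma> \<in> \<Delta>" "cross u x \<gamma> \<le> 0"
  shows "T (u, x) * T (s \<gamma>, 0) = T (u \<circ> s \<gamma>, s \<gamma> x)"
proof -
  have "lng (u \<circ> s \<gamma>, s \<gamma> x) = lng (u, x) + 1" using lng_right_simple[OF assms(1-3)] assms(4) by simp
  then show ?thesis
    using T_prod[OF assms(1) W_simple[OF assms(3)] assms(2) P_zero] by (simp add: inv_reflection lng_simple[OF assms(3)])
qed

lemma T_right_simple':
  assumes "u \<in> W" "x \<in> P" "\<gamma> \<in> \<Delta>" "1 \<le> cross u x \<gamma>"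
  shows "T (u \<circ> s \<gamma>, s \<gamma> x) * T (s \<gamma>, 0) = T (u, x)"
proof -
  have "cross (u \<circ> s \<gamma>) (s \<gamma> x) \<gamma> \<le> 0" using cross_right_simple_self[OF assms(1-3)] assms(4) by simp
  from T_right_simple[OF W_comp[OF assms(1) W_simple[OF assms(3)]] W_P[OF W_simple[OF assms(3)] assms(2)] assms(3) this]
  show ?thesis by (simp only: comp_assoc reflection_comp_self comp_id reflection_involution)
qed

text \<open>Induction on length. A right descent, simple or affine, splits off the invertible
  \<open>T\<close> of a reflection. Without descents the length is zero by
  \<open>no_descents\<close>, and \<open>T\<close> of the inverse group element is then the inverse,
  because all lengths involved are zero.\<close>

lemma ring_unit_T: assumes "u \<in> W" "x \<in> P" shows "ring_unit (T (u, x))"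
  using assms
proof (induct "lng (u, x)" arbitrary: u x rule: less_induct)
  case less
  consider \<gamma> where "\<gamma> \<in> \<Delta>" "1 \<le> cross u x \<gamma>" | "cross u x \<beta> < 0"
    | "\<And>\<gamma>. \<gamma> \<in> \<Delta> \<Longrightarrow> cross u x \<gamma> \<le> 0" "0 \<le> cross u x \<beta>"
    by (metis int_one_le_iff_zero_less not_le)
  then show ?case
  proof cases
    case (1 \<gamma>)
    have "lng (u \<circ> s \<gamma>, s \<gamma> x) < lng (u, x)" using lng_right_simple[OF less(2,3) 1(1)] 1(2) by simp
    then have "ring_unit (T (u \<circ> s \<gamma>, s \<gamma> x))"
      using less(1) W_comp[OF less(2) W_simple[OF 1(1)]] W_P[OF W_simple[OF 1(1)] less(3)] by blast
    then show ?thesis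
      using T_right_simple'[OF less(2,3) 1] ring_unit_mult ring_unit_T_reflection[OF simple_in_reflections[OF 1(1)]]
      by metis
  next
    case 2
    have W': "u \<circ> s \<beta> \<in> W" by (rule W_comp[OF less(2) W_reflection[OF beta_root]])
    have P': "s \<beta> x - \<beta> \<in> P"
      by (rule P_diff[OF W_P[OF W_reflection[OF beta_root] less(3)] root_in_P[OF beta_root]])
    have l: "lng (u, x) = lng (u \<circ> s \<beta>, s \<beta> x - \<beta>) + 1"
      using lng_right_affine[OF less(2,3)] 2 by simp
    then have unit: "ring_unit (T (u \<circ> s \<beta>, s \<beta> x - \<beta>))" using less(1) W' P' by simp
    have e1: "(u \<circ> s \<beta>) \<circ> s \<beta> = u" by (simp only: comp_assoc reflection_comp_self comp_id)
    have e2: "inv (s \<beta>) (s \<beta> x - \<beta>) + - \<beta> = x"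
      by (simp add: inv_reflection W_diff[OF W_reflection[OF beta_root]] reflection_involution
          reflection_self root_nonzero[OF beta_root])
    have "T (u \<circ> s \<beta>, s \<beta> x - \<beta>) * T (s \<beta>, - \<beta>) = T (u, x)"
      using T_prod[OF W' W_reflection[OF beta_root] P' P_uminus[OF root_in_P[OF beta_root]], unfolded e1 e2]
      by (simp add: l lng_affine)
    then show ?thesis using ring_unit_mult[OF unit ring_unit_T_reflection[OF affine_in_reflections]] by simp
  next
    case 3
    have c: "cross u x \<alpha> = 0" if "\<alpha> \<in> pos" for \<alpha> by (rule no_descents[OF less(2,3) 3 that])
    have zero: "lng (w, y) = 0" if "w \<in> W" "\<And>\<alpha>. \<alpha> \<in> pos \<Longrightarrow> cross w y \<alpha> = 0" for w y
      using weyl_length_cross[OF that(1), of y] that(2) by simp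
    have l: "lng (u, x) = 0" by (rule zero[OF less(2) c])
    have l': "lng (inv u, - u x) = 0"
      by (rule zero[OF W_inv[OF less(2)] cross_inverse[OF less(2,3) c]])
    have y: "- u x \<in> P" by (rule P_uminus[OF W_P[OF less(2,3)]])
    have e1: "inv (inv u) x + - u x = 0" by (simp add: W_inv_inv[OF less(2)])
    have e2: "inv u (- u x) + x = 0" by (simp add: W_uminus[OF W_inv[OF less(2)]] W_inv_apply[OF less(2)])
    have "T (u, x) * T (inv u, - u x) = 1"
      using T_prod[OF less(2) W_inv[OF less(2)] less(3) y, unfolded e1 W_comp_inv[OF less(2)]]
      by (simp add: l l' lng_one T_one)
    moreover have "T (inv u, - u x) * T (u, x) = 1"
      using T_prod[OF W_inv[OF less(2)] less(2) y less(3), unfolded e2 W_inv_comp[OF less(2)]]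
      by (simp add: l l' lng_one T_one)
    ultimately show ?thesis unfolding ring_unit_def by blast
  qed
qed

text \<open>\<open>m_inv\<close> is a definite description, which any two-sided inverse pins
  down.\<close>

lemma ring_inverse_eq:
  assumes "h * k = 1" "k * h = (1 :: 'h)"
  shows "m_inv (ring_of_type_algebra :: 'h ring) h = k"
proof -
  have "y = k" if "y * h = 1" for y
  proof -
    have "y * h * k = k" using that by simp
    then show ?thesis using assms(1) by (simp add: mult.assoc)
  qed
  then show ?thesis
    unfolding m_inv_def ring_of_type_algebra_def by (intro the_equality conjI) (simp_all add: assms)
qed

section \<open>The commutative subalgebra of the elements \<theta>\<close>

definition theta_pos :: "'v \<Rightarrow> 'h" where
  "theta_pos x = smul (inverse v ^ lng (id, x)) (T (id, x))"

definition theta_neg :: "'v \<Rightarrow> 'h" where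
  "theta_neg x = smul (v ^ lng (id, x)) (m_inv (ring_of_type_algebra :: 'h ring) (T (id, x)))"

lemma theta_pos_neg: assumes "x \<in> P" shows "theta_pos x * theta_neg x = 1" "theta_neg x * theta_pos x = 1"
proof -
  obtain k where k: "T (id, x) * k = 1" "k * T (id, x) = 1"
    using ring_unit_T[OF W_id assms] unfolding ring_unit_def by blast
  have "inverse v ^ m * v ^ m = 1" for m using v_nonzero by (simp flip: power_mult_distrib)
  then show "theta_pos x * theta_neg x = 1" "theta_neg x * theta_pos x = 1"
    unfolding theta_pos_def theta_neg_def ring_inverse_eq[OF k]
    using k by (simp_all add: scale_mult_left scale_mult_right mult.commute)
qed

lemma theta_pos_add:
  assumes "x \<in> P" "dominant x" "y \<in> P" "dominant y"
  shows "theta_pos (x + y) = theta_pos x * theta_pos y"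
proof -
  have l: "lng (id, x + y) = lng (id, x) + lng (id, y)" by (rule lng_dominant_add[OF assms])
  have "T (id, x) * T (id, y) = T (id, x + y)"
    using T_prod[OF W_id W_id assms(1,3)] l by (simp add: inv_id)
  then show ?thesis by (simp add: theta_pos_def l scale_mult_left scale_mult_right power_add)
qed

lemma theta_pos_commute:
  "x \<in> P \<Longrightarrow> dominant x \<Longrightarrow> y \<in> P \<Longrightarrow> dominant y \<Longrightarrow> theta_pos x * theta_pos y = theta_pos y * theta_pos x"
  using theta_pos_add[of x y] theta_pos_add[of y x] by (simp add: add.commute)

lemma commute_inverse:
  assumes "a * b = b * a" "b * b' = 1" "b' * b = (1 :: 'h)"
  shows "a * b' = b' * a"
proof -
  have "a * b' = b' * (b * a) * b'" using assms(3) by (simp flip: mult.assoc)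
  also have "\<dots> = b' * a * (b * b')" by (simp only: assms(1)[symmetric] mult.assoc)
  finally show ?thesis by (simp add: assms(2))
qed

lemma theta_pos_neg_commute:
  assumes "x \<in> P" "dominant x" "y \<in> P" "dominant y"
  shows "theta_pos x * theta_neg y = theta_neg y * theta_pos x"
  by (rule commute_inverse[OF theta_pos_commute[OF assms] theta_pos_neg[OF assms(3)]])

lemma theta_neg_neg_commute:
  assumes "x \<in> P" "dominant x" "y \<in> P" "dominant y"
  shows "theta_neg x * theta_neg y = theta_neg y * theta_neg x"
  by (rule commute_inverse[OF theta_pos_neg_commute[OF assms(3,4,1,2), symmetric] theta_pos_neg[OF assms(3)]])

abbreviation "\<theta> \<equiv> theta smul R \<Delta> v T"

text \<open>This gives meaning to the definite description in \<open>theta\<close>. Two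
  decompositions of a weight satisfy \<open>y + z' = y' + z\<close>, an identity of dominant
  weights, where \<open>theta_pos\<close> is additive; commutativity does the rest.\<close>

lemma theta_eq:
  assumes y: "y \<in> P" "dominant y" and z: "z \<in> P" "dominant z"
  shows "\<theta> (y - z) = theta_pos y * theta_neg z"
  unfolding theta_def dominant_weights_eq
proof (rule the_equality)
  show "\<exists>y'\<in>{x \<in> P. dominant x}. \<exists>z'\<in>{x \<in> P. dominant x}. y - z = y' - z' \<and> theta_pos y * theta_neg z =
      smul (inverse v ^ lng (id, y')) (T (id, y')) * smul (v ^ lng (id, z')) (m_inv ring_of_type_algebra (T (id, z')))"
    using y z by (intro bexI[of _ y] bexI[of _ z]) (auto simp: theta_pos_def theta_neg_def)
next
  fix h assume "\<exists>y'\<in>{x \<in> P. dominant x}. \<exists>z'\<in>{x \<in> P. dominant x}. y - z = y' - z' \<and> h =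
      smul (inverse v ^ lng (id, y')) (T (id, y')) * smul (v ^ lng (id, z')) (m_inv ring_of_type_algebra (T (id, z')))"
  then obtain y' z' where y': "y' \<in> P" "dominant y'" and z': "z' \<in> P" "dominant z'"
    and eq: "y - z = y' - z'" and h: "h = theta_pos y' * theta_neg z'"
    by (auto simp: theta_pos_def theta_neg_def)
  have sum: "theta_pos y * theta_pos z' = theta_pos y' * theta_pos z"
    using theta_pos_add[OF y z'] theta_pos_add[OF y' z] eq by (metis add.commute diff_add_eq diff_eq_eq)
  have "theta_pos y * theta_neg z = theta_pos y * (theta_pos z' * theta_neg z') * theta_neg z"
    by (simp add: theta_pos_neg[OF z'(1)])
  also have "\<dots> = (theta_pos y * theta_pos z') * (theta_neg z' * theta_neg z)" by (simp only: mult.assoc)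
  also have "\<dots> = theta_pos y' * (theta_pos z * theta_neg z) * theta_neg z'"
    unfolding sum theta_neg_neg_commute[OF z' z] by (simp only: mult.assoc)
  finally show "h = theta_pos y * theta_neg z" by (simp add: h theta_pos_neg[OF z(1)])
qed

text \<open>Only the negative coordinates of \<open>x\<close> are compensated, so \<open>z\<close>
  lies on every simple wall that contains \<open>x\<close>. The last conjunct serves
  \<open>T_simple_theta_orthogonal\<close>.\<close>

lemma dominant_difference:
  assumes "x \<in> P"
  shows "\<exists>z\<in>P. dominant z \<and> dominant (x + z) \<and> (\<forall>\<gamma>\<in>\<Delta>. x \<bullet> coroot \<gamma> = 0 \<longrightarrow> z \<bullet> coroot \<gamma> = 0)"
proof -
  define z where "z = (\<Sum>\<gamma>\<in>\<Delta>. of_int (max 0 (- pairing x \<gamma>)) *\<^sub>R \<omega> \<gamma>)"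
  have zP: "z \<in> P" unfolding z_def by (intro P_sum P_scale_int fundamental_weight_in_P)
  have z: "z \<bullet> coroot \<gamma> = of_int (max 0 (- pairing x \<gamma>))" if "\<gamma> \<in> \<Delta>" for \<gamma>
    unfolding z_def inner_sum_left inner_scaleR_left using that finite_simple
    by (simp add: fundamental_weight_inner if_distrib cong: if_cong)
  have "x \<bullet> coroot \<gamma> = of_int (pairing x \<gamma>)" if "\<gamma> \<in> \<Delta>" for \<gamma>
    using pairing_P[OF assms simple_root[OF that]] by simp
  then show ?thesis using zP z by (intro bexI[of _ z]) (auto simp: dominant_def inner_add_left)
qed

lemma theta_decompose:
  assumes "x \<in> P"
  obtains y z where "y \<in> P" "dominant y" "z \<in> P" "dominant z" "x = y - z" "\<theta> x = theta_pos y * theta_neg z"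
proof -
  obtain z where z: "z \<in> P" "dominant z" "dominant (x + z)" using dominant_difference[OF assms] by blast
  have "x = (x + z) - z" by simp
  then show ?thesis using that[of "x + z" z] theta_eq[of "x + z" z] z P_add[OF assms z(1)] by simp
qed

lemma theta_add:
  assumes "x \<in> P" "y \<in> P"
  shows "\<theta> (x + y) = \<theta> x * \<theta> y"
proof -
  obtain a b where x: "a \<in> P" "dominant a" "b \<in> P" "dominant b" "x = a - b" "\<theta> x = theta_pos a * theta_neg b"
    using theta_decompose[OF assms(1)] by blast
  obtain c d where y: "c \<in> P" "dominant c" "d \<in> P" "dominant d" "y = c - d" "\<theta> y = theta_pos c * theta_neg d"
    using theta_decompose[OF assms(2)] by blast
  have dom: "dominant (a + c)" "dominant (b + d)" using x y by (auto simp: dominant_def inner_add_left)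
  have neg: "theta_neg (b + d) = theta_neg b * theta_neg d"
  proof -
    have "theta_neg (b + d) = theta_neg (b + d) * (theta_pos b * (theta_pos d * theta_neg d) * theta_neg b)"
      by (simp add: theta_pos_neg x y)
    also have "\<dots> = theta_neg (b + d) * theta_pos (b + d) * (theta_neg d * theta_neg b)"
      unfolding theta_pos_add[OF x(3,4) y(3,4)] by (simp only: mult.assoc)
    finally show ?thesis
      by (simp add: theta_pos_neg P_add x y theta_neg_neg_commute[OF y(3,4) x(3,4)])
  qed
  have "x + y = (a + c) - (b + d)" using x(5) y(5) by simp
  then have "\<theta> (x + y) = theta_pos (a + c) * theta_neg (b + d)"
    using theta_eq[OF P_add[OF x(1) y(1)] dom(1) P_add[OF x(3) y(3)] dom(2)] by simp
  also have "\<dots> = theta_pos a * (theta_pos c * theta_neg b) * theta_neg d"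
    unfolding theta_pos_add[OF x(1,2) y(1,2)] neg by (simp only: mult.assoc)
  also have "\<dots> = \<theta> x * \<theta> y"
    unfolding theta_pos_neg_commute[OF y(1,2) x(3,4)] x(6) y(6) by (simp only: mult.assoc)
  finally show ?thesis .
qed

lemma theta_pos_zero: "theta_pos 0 = 1"
  by (simp add: theta_pos_def lng_one T_one)

lemma dominant_zero: "dominant 0"
  by (simp add: dominant_def)

lemma theta_dominant: assumes "x \<in> P" "dominant x" shows "\<theta> x = theta_pos x"
  using theta_eq[OF assms P_zero dominant_zero] theta_pos_neg(1)[OF P_zero] by (simp add: theta_pos_zero)

lemma theta_zero: "\<theta> 0 = 1"
  using theta_dominant[OF P_zero dominant_zero] by (simp add: theta_pos_zero)

lemma theta_uminus: "x \<in> P \<Longrightarrow> \<theta> x * \<theta> (- x) = 1" "x \<in> P \<Longrightarrow> \<theta> (- x) * \<theta> x = 1"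
  using theta_add[of x "- x"] theta_add[of "- x" x] P_uminus[of x] by (simp_all add: theta_zero)

text \<open>The linear extension of \<open>\<theta>\<close>, multiplicative on \<open>kP\<close> by
  \<open>Th_mult\<close>; it transfers identities of the group algebra to \<open>H\<close>.\<close>

definition Th :: "('v \<Rightarrow>\<^sub>0 'k) \<Rightarrow> 'h" where
  "Th f = (\<Sum>x\<in>supp f. smul (coeff_at f x) (\<theta> x))"

lemma Th_supset: "finite A \<Longrightarrow> supp f \<subseteq> A \<Longrightarrow> Th f = (\<Sum>x\<in>A. smul (coeff_at f x) (\<theta> x))"
  unfolding Th_def by (intro sum.mono_neutral_left) (auto simp: in_keys_iff)

lemma Th_zero: "Th 0 = 0"
  by (simp add: Th_def)

lemma Th_add: "Th (f + g) = Th f + Th g"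
proof -
  let ?A = "supp f \<union> supp g"
  have "Th (f + g) = (\<Sum>x\<in>?A. smul (coeff_at (f + g) x) (\<theta> x))"
    by (rule Th_supset) (use Poly_Mapping.keys_add[of f g] in auto)
  then show ?thesis
    by (simp add: Th_supset[of ?A f] Th_supset[of ?A g] lookup_add scale_left_distrib sum.distrib)
qed

lemma Th_single: "Th (Poly_Mapping.single x c) = smul c (\<theta> x)"
  by (cases "c = 0") (simp_all add: Th_def)

lemma Th_uminus: "Th (- f) = - Th f"
  using Th_add[of f "- f"] by (simp add: Th_zero eq_neg_iff_add_eq_0 add.commute)

lemma Th_sum: "Th (sum f I) = (\<Sum>i\<in>I. Th (f i))"
  by (induct I rule: infinite_finite_induct) (auto simp: Th_zero Th_add)

lemma Th_mult:
  assumes "f \<in> kP" "g \<in> kP"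
  shows "Th (f * g) = Th f * Th g"
  using assms(1)
proof (induct rule: kP_induct)
  case (add x c f)
  have "Th (Poly_Mapping.single x c * g) = smul c (\<theta> x) * Th g"
    using assms(2)
  proof (induct rule: kP_induct)
    case (add y d g)
    then show ?case
      using \<open>x \<in> P\<close> by (simp add: distrib_left mult_single Th_add Th_single theta_add scale_mult_left scale_mult_right)
  qed (simp add: Th_zero)
  then show ?case using add(3) by (simp add: distrib_right Th_add Th_single)
qed (simp add: Th_zero)

lemma Th_commute: "f \<in> kP \<Longrightarrow> g \<in> kP \<Longrightarrow> Th f * Th g = Th g * Th f"
  using Th_mult[of f g] Th_mult[of g f] by (simp add: mult.commute)

end

lemma commute_mult:
  fixes t a b :: "'a::semigroup_mult"
  assumes "t * a = a * t" "t * b = b * t"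
  shows "t * (a * b) = (a * b) * t"
proof -
  have "t * (a * b) = a * (t * b)" by (simp only: assms(1) flip: mult.assoc)
  then show ?thesis by (simp only: assms(2) mult.assoc)
qed

section \<open>The Bernstein relation and its consequences\<close>

context affine_hecke_setup
begin

abbreviation T_simple :: "'v \<Rightarrow> 'h" ("\<tau>") where "\<tau> \<gamma> \<equiv> T (s \<gamma>, 0)"

definition T_simple_inverse :: "'v \<Rightarrow> 'h" ("\<tau>''") where
  "\<tau>' \<gamma> = smul (inverse q) (\<tau> \<gamma> - smul (q - 1) 1)"

lemma tau_inverse: "\<gamma> \<in> \<Delta> \<Longrightarrow> \<tau> \<gamma> * \<tau>' \<gamma> = 1" "\<gamma> \<in> \<Delta> \<Longrightarrow> \<tau>' \<gamma> * \<tau> \<gamma> = 1"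
  using T_reflection_inverse[OF simple_in_reflections] unfolding T_simple_inverse_def by blast+

lemma T_finite_dominant:
  assumes "w \<in> W" "x \<in> P" "dominant x"
  shows "T (w, 0) * T (id, x) = T (w, x)"
  using T_prod[OF assms(1) W_id P_zero assms(2)] lng_dominant[OF assms] by (simp add: inv_id)

text \<open>For a dominant weight fixed by \<open>s \<gamma>\<close> lengths add in both orders of
  multiplication, and both products are \<open>T (s \<gamma>, x)\<close>.\<close>

lemma T_simple_theta_pos:
  assumes "\<gamma> \<in> \<Delta>" "x \<in> P" "dominant x" "x \<bullet> coroot \<gamma> = 0"
  shows "\<tau> \<gamma> * theta_pos x = theta_pos x * \<tau> \<gamma>"
proof -
  have fx: "s \<gamma> x = x" by (rule reflection_fixed[OF assms(4)])
  have "cross id x \<gamma> \<le> 0"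
    using pairing_eq_iff[OF assms(2) simple_root[OF assms(1)], of 0] assms(4) simple_pos[OF assms(1)]
    by (simp add: cross_def)
  then have "T (id, x) * \<tau> \<gamma> = T (s \<gamma>, x)"
    using T_right_simple[OF W_id assms(2,1)] by (simp only: fx id_comp)
  then have "\<tau> \<gamma> * T (id, x) = T (id, x) * \<tau> \<gamma>"
    using T_finite_dominant[OF W_simple[OF assms(1)] assms(2,3)] by simp
  then show ?thesis by (simp only: theta_pos_def scale_mult_left scale_mult_right)
qed

lemma T_simple_theta_orthogonal:
  assumes "\<gamma> \<in> \<Delta>" "x \<in> P" "x \<bullet> coroot \<gamma> = 0"
  shows "\<tau> \<gamma> * \<theta> x = \<theta> x * \<tau> \<gamma>"
proof -
  obtain z where z: "z \<in> P" "dominant z" "dominant (x + z)" "z \<bullet> coroot \<gamma> = 0"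
    using dominant_difference[OF assms(2)] assms(1,3) by blast
  have xz: "x + z \<in> P" "(x + z) \<bullet> coroot \<gamma> = 0" using P_add[OF assms(2) z(1)] assms(3) z(4) by (simp_all add: inner_add_left)
  have "\<theta> x = theta_pos (x + z) * theta_neg z" using theta_eq[OF xz(1) z(3) z(1,2)] by simp
  moreover have "\<tau> \<gamma> * theta_pos (x + z) = theta_pos (x + z) * \<tau> \<gamma>"
    by (rule T_simple_theta_pos[OF assms(1) xz(1) z(3) xz(2)])
  moreover have "\<tau> \<gamma> * theta_neg z = theta_neg z * \<tau> \<gamma>"
    by (rule commute_inverse[OF T_simple_theta_pos[OF assms(1) z(1,2,4)] theta_pos_neg[OF z(1)]])
  ultimately show ?thesis using commute_mult by (simp only:)
qed

text \<open>
  With \<open>y = \<omega> + s(\<omega>)\<close>, lengths add in \<open>\<omega> = (\<omega> s) s\<close> and in \<open>(\<omega> s) \<omega> = s y\<close>; dividing gives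
  \<open>T\<^sub>\<omega> T\<^sub>s\<^sup>-\<^sup>1 T\<^sub>\<omega> = T\<^sub>s T\<^sub>y\<close>, which is the Bernstein relation for a fundamental weight.
\<close>

lemma theta_fundamental:
  assumes "\<gamma> \<in> \<Delta>"
  shows "\<tau> \<gamma> * \<theta> (s \<gamma> (\<omega> \<gamma>)) * \<tau> \<gamma> = smul q (\<theta> (\<omega> \<gamma>))"
proof -
  let ?w = "\<omega> \<gamma>"
  have wP: "?w \<in> P" by (rule fundamental_weight_in_P)
  have wdom: "dominant ?w" by (simp add: dominant_def fundamental_weight_inner)
  have w1: "?w \<bullet> coroot \<gamma> = 1" using fundamental_weight_inner[OF assms] by simp
  have sw: "s \<gamma> ?w = ?w - \<gamma>" by (simp add: reflection_def w1)
  have swP: "s \<gamma> ?w \<in> P" by (rule W_P[OF W_simple[OF assms] wP])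
  define y where "y = s \<gamma> ?w + ?w"
  have yP: "y \<in> P" unfolding y_def by (rule P_add[OF swP wP])
  have y0: "y \<bullet> coroot \<gamma> = 0"
    by (simp add: y_def sw inner_add_left inner_diff_left w1 coroot_inner_self simple_nonzero[OF assms])
  have ydom: "dominant y"
    unfolding dominant_def
  proof
    fix \<delta> assume d: "\<delta> \<in> \<Delta>"
    show "0 \<le> y \<bullet> coroot \<delta>"
    proof (cases "\<delta> = \<gamma>")
      case False
      have "\<gamma> \<bullet> coroot \<delta> \<le> 0"
        using simple_inner_nonpos[OF assms d] False simple_nonzero[OF d] by (simp add: inner_coroot divide_le_0_iff)
      then show ?thesis
        using fundamental_weight_inner[OF d, of \<gamma>] False by (simp add: y_def sw inner_add_left inner_diff_left)
    qed (simp add: y0)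
  qed
  have gR: "\<gamma> \<in> R" and gpos: "\<gamma> \<in> pos" using simple_root simple_pos assms by auto
  have pw: "pairing ?w \<gamma> = 1" using pairing_eq_iff[OF wP gR, of 1] w1 by simp
  have py: "pairing y \<gamma> = 0" using pairing_eq_iff[OF yP gR, of 0] y0 by simp
  have cw: "cross id ?w \<gamma> = 1" using pw gpos by (simp add: cross_def)
  have l1: "int (lng (s \<gamma>, s \<gamma> ?w)) = int (lng (id, ?w)) - 1"
    using lng_right_simple[OF W_id wP assms] cw by (simp only: id_comp) simp
  \<comment> \<open>Both lengths are sums of pairings. \<open>s \<gamma>\<close> permutes the
    positive roots other than \<open>\<gamma>\<close>, over which \<open>y\<close> takes twice the
    sum for \<open>?w\<close>; the root \<open>\<gamma>\<close> itself contributes 1 to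
    \<open>?w\<close> and 0 to \<open>y\<close>.\<close>
  have l2: "int (lng (id, y)) = 2 * int (lng (id, ?w)) - 2"
  proof -
    have lw: "int (lng (id, ?w)) = (\<Sum>\<alpha>\<in>pos. pairing ?w \<alpha>)"
      unfolding weyl_length_cross[OF W_id] using dominant_pairing[OF wdom] by (intro sum.cong) (auto simp: cross_def)
    have ly: "int (lng (id, y)) = (\<Sum>\<alpha>\<in>pos. pairing y \<alpha>)"
      unfolding weyl_length_cross[OF W_id] using dominant_pairing[OF ydom] by (intro sum.cong) (auto simp: cross_def)
    have "(\<Sum>\<alpha>\<in>pos - {\<gamma>}. pairing y \<alpha>) = (\<Sum>\<alpha>\<in>pos - {\<gamma>}. pairing ?w (s \<gamma> \<alpha>)) + (\<Sum>\<alpha>\<in>pos - {\<gamma>}. pairing ?w \<alpha>)"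
      unfolding sum.distrib[symmetric] y_def
      by (rule sum.cong) (auto simp: pairing_add[OF swP wP] pos_root pairing_reflection)
    also have "(\<Sum>\<alpha>\<in>pos - {\<gamma>}. pairing ?w (s \<gamma> \<alpha>)) = (\<Sum>\<alpha>\<in>pos - {\<gamma>}. pairing ?w \<alpha>)"
      by (rule sum.reindex_bij_betw[OF bij_betw_simple_reflection[OF assms]])
    finally show ?thesis
      unfolding lw ly sum.remove[OF finite_pos gpos] py pw by simp
  qed
  define U where "U = T (s \<gamma>, s \<gamma> ?w)"
  have "1 \<le> cross id ?w \<gamma>" using cw by simp
  from T_right_simple'[OF W_id wP assms this] have e1: "U * \<tau> \<gamma> = T (id, ?w)"
    by (simp only: U_def id_comp)
  have "lng (s \<gamma>, y) = lng (s \<gamma>, s \<gamma> ?w) + lng (id, ?w)"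
    using lng_dominant[OF W_simple[OF assms] yP ydom] lng_simple[OF assms] l1 l2 by linarith
  then have "U * T (id, ?w) = T (s \<gamma>, y)"
    using T_prod[OF W_simple[OF assms] W_id swP wP] by (simp only: U_def inv_id id_apply comp_id y_def)
  also have "\<dots> = \<tau> \<gamma> * T (id, y)" by (rule T_finite_dominant[OF W_simple[OF assms] yP ydom, symmetric])
  finally have e2: "U * T (id, ?w) = \<tau> \<gamma> * T (id, y)" .
  have U: "U = T (id, ?w) * \<tau>' \<gamma>"
    by (simp add: e1[symmetric] mult.assoc tau_inverse(1)[OF assms])
  have Tw: "T (id, x) = smul (v ^ lng (id, x)) (theta_pos x)" for x
    using v_nonzero by (simp add: theta_pos_def flip: power_mult_distrib)
  let ?l = "lng (id, ?w)"
  \<comment> \<open>The excess of 2 in length is the origin of the factor \<open>q\<close>, the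
    square of \<open>v\<close>.\<close>
  have ll: "2 * ?l = lng (id, y) + 2" using l2 by linarith
  have vl: "v ^ ?l * v ^ ?l = v ^ lng (id, y) * q"
    by (simp only: power_add[symmetric] mult_2[symmetric] ll v_square[symmetric])
  have "smul (v ^ lng (id, y)) (smul q (theta_pos ?w * \<tau>' \<gamma> * theta_pos ?w)) = smul (v ^ ?l) (smul (v ^ ?l) (theta_pos ?w * \<tau>' \<gamma> * theta_pos ?w))"
    by (simp add: vl)
  also have "\<dots> = U * T (id, ?w)"
    unfolding U Tw[of ?w] by (simp add: scale_mult_left scale_mult_right)
  also have "\<dots> = smul (v ^ lng (id, y)) (\<tau> \<gamma> * theta_pos y)"
    unfolding e2 Tw[of y] by (simp add: scale_mult_right)
  finally have "smul (v ^ lng (id, y)) (smul q (theta_pos ?w * \<tau>' \<gamma> * theta_pos ?w)) = smul (v ^ lng (id, y)) (\<tau> \<gamma> * theta_pos y)" .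
  moreover have "v ^ lng (id, y) \<noteq> 0" using v_nonzero by simp
  ultimately have key: "smul q (theta_pos ?w * \<tau>' \<gamma> * theta_pos ?w) = \<tau> \<gamma> * theta_pos y"
    using scale_left_imp_eq by blast
  have ty: "theta_pos y = \<theta> (s \<gamma> ?w) * \<theta> ?w"
    using theta_dominant[OF yP ydom] theta_add[OF swP wP] by (simp add: y_def)
  have tw: "theta_pos ?w = \<theta> ?w" using theta_dominant[OF wP wdom] by simp
  have "smul q (\<theta> ?w * \<tau>' \<gamma>) = smul q (\<theta> ?w * \<tau>' \<gamma> * \<theta> ?w) * \<theta> (- ?w)"
    by (simp add: scale_mult_left mult.assoc theta_uminus[OF wP])
  also have "\<dots> = \<tau> \<gamma> * \<theta> (s \<gamma> ?w) * (\<theta> ?w * \<theta> (- ?w))"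
    using key unfolding tw ty by (simp add: mult.assoc)
  finally have "smul q (\<theta> ?w * \<tau>' \<gamma>) = \<tau> \<gamma> * \<theta> (s \<gamma> ?w)" by (simp add: theta_uminus[OF wP])
  then have "\<tau> \<gamma> * \<theta> (s \<gamma> ?w) * \<tau> \<gamma> = smul q (\<theta> ?w * (\<tau>' \<gamma> * \<tau> \<gamma>))"
    by (simp only: scale_mult_left mult.assoc flip: \<open>smul q (\<theta> ?w * \<tau>' \<gamma>) = \<tau> \<gamma> * \<theta> (s \<gamma> ?w)\<close>)
  then show ?thesis by (simp add: tau_inverse[OF assms])
qed

text \<open>The element \<open>d\<close> is the Demazure quotient of \<open>f\<close>.\<close>

definition bernstein :: "'v \<Rightarrow> ('v \<Rightarrow>\<^sub>0 'k) \<Rightarrow> bool" where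
  "bernstein \<gamma> f \<longleftrightarrow> f \<in> kP \<and> (\<exists>d\<in>kP. f - act (s \<gamma>) f = (1 - mon (- \<gamma>)) * d \<and>
     \<tau> \<gamma> * Th f = Th (act (s \<gamma>) f) * \<tau> \<gamma> + smul (q - 1) (Th d))"

text \<open>The Demazure quotient obeys a twisted Leibniz rule, with
  \<open>act (s \<gamma>) f\<close> in front of the second term, and so does the correction term
  when \<open>\<tau> \<gamma>\<close> is moved past a product.\<close>

lemma bernstein_mult:
  assumes "\<gamma> \<in> \<Delta>" "bernstein \<gamma> f" "bernstein \<gamma> g"
  shows "bernstein \<gamma> (f * g)"
proof -
  obtain d where d: "d \<in> kP" "f - act (s \<gamma>) f = (1 - mon (- \<gamma>)) * d"
    "\<tau> \<gamma> * Th f = Th (act (s \<gamma>) f) * \<tau> \<gamma> + smul (q - 1) (Th d)" and f: "f \<in> kP"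
    using assms(2) unfolding bernstein_def by blast
  obtain e where e: "e \<in> kP" "g - act (s \<gamma>) g = (1 - mon (- \<gamma>)) * e"
    "\<tau> \<gamma> * Th g = Th (act (s \<gamma>) g) * \<tau> \<gamma> + smul (q - 1) (Th e)" and g: "g \<in> kP"
    using assms(3) unfolding bernstein_def by blast
  have sW: "s \<gamma> \<in> W" by (rule W_simple[OF assms(1)])
  have sf: "act (s \<gamma>) f \<in> kP" and sg: "act (s \<gamma>) g \<in> kP" using kP_act[OF sW] f g by auto
  let ?d = "d * g + act (s \<gamma>) f * e"
  have "f * g - act (s \<gamma>) (f * g) = (f - act (s \<gamma>) f) * g + act (s \<gamma>) f * (g - act (s \<gamma>) g)"
    unfolding act_mult_W[OF sW] by (simp add: left_diff_distrib right_diff_distrib)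
  also have "\<dots> = (1 - mon (- \<gamma>)) * ?d" unfolding d(2) e(2) by (simp add: distrib_left mult_ac)
  finally have eq: "f * g - act (s \<gamma>) (f * g) = (1 - mon (- \<gamma>)) * ?d" .
  have "\<tau> \<gamma> * Th (f * g) = (\<tau> \<gamma> * Th f) * Th g" by (simp add: Th_mult[OF f g] mult.assoc)
  also have "\<dots> = Th (act (s \<gamma>) f) * (\<tau> \<gamma> * Th g) + smul (q - 1) (Th (d * g))"
    unfolding d(3) by (simp add: distrib_right mult.assoc scale_mult_left Th_mult[OF d(1) g])
  also have "\<dots> = Th (act (s \<gamma>) (f * g)) * \<tau> \<gamma> + smul (q - 1) (Th ?d)"
    unfolding e(3) act_mult_W[OF sW]
    by (simp add: distrib_left scale_mult_right Th_add Th_mult[OF sf sg] Th_mult[OF sf e(1)] mult.assoc scale_right_distrib)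
  finally show ?thesis
    unfolding bernstein_def using eq kP_mult[OF f g] kP_add[OF kP_mult[OF d(1) g] kP_mult[OF sf e(1)]] by blast
qed

lemma bernstein_add:
  assumes "bernstein \<gamma> f" "bernstein \<gamma> g"
  shows "bernstein \<gamma> (f + g)"
proof -
  obtain d where d: "d \<in> kP" "f - act (s \<gamma>) f = (1 - mon (- \<gamma>)) * d"
    "\<tau> \<gamma> * Th f = Th (act (s \<gamma>) f) * \<tau> \<gamma> + smul (q - 1) (Th d)" and f: "f \<in> kP"
    using assms(1) unfolding bernstein_def by blast
  obtain e where e: "e \<in> kP" "g - act (s \<gamma>) g = (1 - mon (- \<gamma>)) * e"
    "\<tau> \<gamma> * Th g = Th (act (s \<gamma>) g) * \<tau> \<gamma> + smul (q - 1) (Th e)" and g: "g \<in> kP"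
    using assms(2) unfolding bernstein_def by blast
  have "f + g - act (s \<gamma>) (f + g) = (f - act (s \<gamma>) f) + (g - act (s \<gamma>) g)" by (simp add: act_add)
  also have "\<dots> = (1 - mon (- \<gamma>)) * (d + e)" unfolding d(2) e(2) by (simp add: distrib_left)
  finally have "f + g - act (s \<gamma>) (f + g) = (1 - mon (- \<gamma>)) * (d + e)" .
  moreover have "\<tau> \<gamma> * Th (f + g) = Th (act (s \<gamma>) (f + g)) * \<tau> \<gamma> + smul (q - 1) (Th (d + e))"
    by (simp add: Th_add act_add distrib_left distrib_right d(3) e(3) scale_right_distrib)
  ultimately show ?thesis
    unfolding bernstein_def using kP_add[OF f g] kP_add[OF d(1) e(1)] by blast
qed

lemma bernstein_orthogonal:
  assumes "\<gamma> \<in> \<Delta>" "x \<in> P" "x \<bullet> coroot \<gamma> = 0"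
  shows "bernstein \<gamma> (Poly_Mapping.single x c)"
  unfolding bernstein_def
proof (intro conjI bexI[of _ 0])
  have "s \<gamma> x = x" by (rule reflection_fixed[OF assms(3)])
  then show "Poly_Mapping.single x c - act (s \<gamma>) (Poly_Mapping.single x c) = (1 - mon (- \<gamma>)) * 0"
    "\<tau> \<gamma> * Th (Poly_Mapping.single x c) = Th (act (s \<gamma>) (Poly_Mapping.single x c)) * \<tau> \<gamma> + smul (q - 1) (Th 0)"
    using T_simple_theta_orthogonal[OF assms]
    by (simp_all add: act_single Th_single Th_zero scale_mult_left scale_mult_right)
qed (use assms kP_single kP_zero in auto)

text \<open>The first relation is \<open>theta_fundamental\<close> multiplied by the inverse of
  \<open>\<tau> \<gamma>\<close>; the second results from the first by multiplying with
  \<open>\<theta>\<close> of the opposite weights on both sides.\<close>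

lemma bernstein_fundamental:
  assumes "\<gamma> \<in> \<Delta>"
  shows "bernstein \<gamma> (mon (\<omega> \<gamma>))" "bernstein \<gamma> (mon (- \<omega> \<gamma>))"
proof -
  let ?w = "\<omega> \<gamma>"
  have wP: "?w \<in> P" by (rule fundamental_weight_in_P)
  have swP: "s \<gamma> ?w \<in> P" by (rule W_P[OF W_simple[OF assms] wP])
  have sw: "s \<gamma> ?w = ?w - \<gamma>" by (simp add: reflection_def fundamental_weight_inner[OF assms])
  have sm: "s \<gamma> (- ?w) = - s \<gamma> ?w" by (rule W_uminus[OF W_simple[OF assms]])
  have "\<theta> (s \<gamma> ?w) * \<tau> \<gamma> = \<tau>' \<gamma> * (\<tau> \<gamma> * \<theta> (s \<gamma> ?w) * \<tau> \<gamma>)"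
    by (simp add: tau_inverse[OF assms] flip: mult.assoc)
  also have "\<dots> = \<tau> \<gamma> * \<theta> ?w - smul (q - 1) (\<theta> ?w)"
    unfolding theta_fundamental[OF assms] T_simple_inverse_def using q_nonzero
    by (simp add: scale_mult_left scale_mult_right left_diff_distrib scale_right_diff_distrib)
  finally have rel: "\<tau> \<gamma> * \<theta> ?w = \<theta> (s \<gamma> ?w) * \<tau> \<gamma> + smul (q - 1) (\<theta> ?w)" by (simp add: algebra_simps)
  show "bernstein \<gamma> (mon ?w)"
    unfolding bernstein_def
    by (intro conjI bexI[of _ "mon ?w"])
      (simp_all add: kP_single wP act_single Th_single rel left_diff_distrib mult_single sw)
  have "\<theta> (- s \<gamma> ?w) * (\<tau> \<gamma> * \<theta> ?w) * \<theta> (- ?w) =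
      \<theta> (- s \<gamma> ?w) * (\<theta> (s \<gamma> ?w) * \<tau> \<gamma> + smul (q - 1) (\<theta> ?w)) * \<theta> (- ?w)" by (simp only: rel)
  also have "\<dots> = (\<theta> (- s \<gamma> ?w) * \<theta> (s \<gamma> ?w)) * \<tau> \<gamma> * \<theta> (- ?w) + smul (q - 1) (\<theta> (- s \<gamma> ?w) * (\<theta> ?w * \<theta> (- ?w)))"
    by (simp only: distrib_left distrib_right scale_mult_left scale_mult_right mult.assoc)
  also have "\<theta> (- s \<gamma> ?w) * (\<tau> \<gamma> * \<theta> ?w) * \<theta> (- ?w) = \<theta> (- s \<gamma> ?w) * \<tau> \<gamma> * (\<theta> ?w * \<theta> (- ?w))"
    by (simp only: mult.assoc)
  finally have rel': "\<tau> \<gamma> * \<theta> (- ?w) = \<theta> (- s \<gamma> ?w) * \<tau> \<gamma> - smul (q - 1) (\<theta> (- s \<gamma> ?w))"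
    by (simp add: theta_uminus[OF wP] theta_uminus[OF swP])
  show "bernstein \<gamma> (mon (- ?w))"
    unfolding bernstein_def
  proof (intro conjI bexI[of _ "- mon (- s \<gamma> ?w)"])
    show "mon (- ?w) - act (s \<gamma>) (mon (- ?w)) = (1 - mon (- \<gamma>)) * - mon (- s \<gamma> ?w)"
      by (simp add: act_single sm left_diff_distrib mult_single) (simp add: sw)
    show "\<tau> \<gamma> * Th (mon (- ?w)) = Th (act (s \<gamma>) (mon (- ?w))) * \<tau> \<gamma> + smul (q - 1) (Th (- mon (- s \<gamma> ?w)))"
      by (simp add: act_single sm Th_single Th_uminus rel')
  qed (use wP swP kP_single kP_uminus P_uminus in auto)
qed

text \<open>The relation is stable under products and sums, and every weight is an integral multiple
  of \<open>\<omega> \<gamma>\<close> plus a weight orthogonal to the coroot of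
  \<open>\<gamma>\<close>.\<close>

lemma bernstein_kP:
  assumes "\<gamma> \<in> \<Delta>" "f \<in> kP"
  shows "bernstein \<gamma> f"
proof -
  have one: "bernstein \<gamma> 1" using bernstein_orthogonal[OF assms(1) P_zero, of 1] by simp
  have power: "bernstein \<gamma> (mon (real n *\<^sub>R x))" if "bernstein \<gamma> (mon x)" for n x
  proof (induct n)
    case (Suc n)
    have "mon (real (Suc n) *\<^sub>R x) = (mon x * mon (real n *\<^sub>R x) :: 'v \<Rightarrow>\<^sub>0 'k)"
      by (simp add: mult_single scaleR_add_left)
    then show ?case using bernstein_mult[OF assms(1) that Suc] by simp
  qed (simp add: one)
  have fund: "bernstein \<gamma> (mon (of_int k *\<^sub>R \<omega> \<gamma>))" for k
  proof (cases "0 \<le> k")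
    case True
    then show ?thesis using power[OF bernstein_fundamental(1)[OF assms(1)], of "nat k"] by simp
  next
    case False
    then have "of_int k *\<^sub>R \<omega> \<gamma> = real (nat (- k)) *\<^sub>R (- \<omega> \<gamma>)" by simp
    then show ?thesis using power[OF bernstein_fundamental(2)[OF assms(1)], of "nat (- k)"] by simp
  qed
  have mono: "bernstein \<gamma> (Poly_Mapping.single x c)" if x: "x \<in> P" for x c
  proof -
    define k where "k = pairing x \<gamma>"
    have k: "x \<bullet> coroot \<gamma> = of_int k" using pairing_P[OF x simple_root[OF assms(1)]] by (simp add: k_def)
    let ?y = "x - of_int k *\<^sub>R \<omega> \<gamma>"
    have "?y \<in> P" by (rule P_diff[OF x P_scale_int[OF fundamental_weight_in_P]])
    moreover have "?y \<bullet> coroot \<gamma> = 0" by (simp add: inner_diff_left k fundamental_weight_inner[OF assms(1)])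
    ultimately have "bernstein \<gamma> (Poly_Mapping.single ?y c)" by (rule bernstein_orthogonal[OF assms(1)])
    from bernstein_mult[OF assms(1) fund[of k] this] show ?thesis by (simp add: mult_single)
  qed
  show ?thesis
    using assms(2)
  proof (induct rule: kP_induct)
    case zero
    then show ?case using mono[OF P_zero, of 0] by simp
  next
    case (add x c f)
    then show ?case using bernstein_add mono by blast
  qed
qed

text \<open>Invariance makes \<open>1 - mon (- \<gamma>)\<close> annihilate the quotient
  \<open>d\<close>; having leading coefficient 1 it can be cancelled, so the correction term
  vanishes.\<close>

lemma Th_invariant_commute:
  assumes "\<gamma> \<in> \<Delta>" "f \<in> kP" "act (s \<gamma>) f = f"
  shows "\<tau> \<gamma> * Th f = Th f * \<tau> \<gamma>"
proof -
  obtain d where d: "f - act (s \<gamma>) f = (1 - mon (- \<gamma>)) * d"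
    "\<tau> \<gamma> * Th f = Th (act (s \<gamma>) f) * \<tau> \<gamma> + smul (q - 1) (Th d)"
    using bernstein_kP[OF assms(1,2)] unfolding bernstein_def by blast
  have "(1 - mon (- \<gamma>)) * d = 0" using d(1) assms(3) by simp
  then have "d = 0" using lead_cancel[OF lead_root[OF simple_pos[OF assms(1)]]] by blast
  then show ?thesis using d(2) assms(3) by (simp add: Th_zero)
qed

text \<open>A weight is folded into the dominant chamber by right multiplications with
  \<open>\<tau> \<gamma>\<close>, or with its inverse where the length changes the other way. Over a
  dominant weight \<open>T\<close> is a finite part times a multiple of
  \<open>\<theta> x\<close>.\<close>

lemma T_generate [consumes 2, case_names dominant right inverse]:
  assumes "u \<in> W" "x \<in> P"
    and dom: "\<And>w x. w \<in> W \<Longrightarrow> x \<in> P \<Longrightarrow> Q (T (w, 0) * \<theta> x)"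
    and right: "\<And>h \<gamma>. \<gamma> \<in> \<Delta> \<Longrightarrow> Q h \<Longrightarrow> Q (h * \<tau> \<gamma>)"
    and inverse: "\<And>h \<gamma>. \<gamma> \<in> \<Delta> \<Longrightarrow> Q h \<Longrightarrow> Q (h * \<tau>' \<gamma>)"
    and scale: "\<And>c h. Q h \<Longrightarrow> Q (smul c h)"
  shows "Q (T (u, x))"
  using assms(1,2)
proof (induct x arbitrary: u rule: dominant_induct)
  case (dominant x)
  have "T (id, x) = smul (v ^ lng (id, x)) (\<theta> x)"
    using v_nonzero theta_dominant[OF dominant(3,1)] by (simp add: theta_pos_def flip: power_mult_distrib)
  then have "T (u, x) = smul (v ^ lng (id, x)) (T (u, 0) * \<theta> x)"
    using T_finite_dominant[OF dominant(2,3,1)] by (simp add: scale_mult_right)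
  then show ?case using scale dom[OF dominant(2,3)] by simp
next
  case (step \<gamma> x)
  have Q: "Q (T (u \<circ> s \<gamma>, s \<gamma> x))"
    by (rule step(3)[OF W_comp[OF step(4) W_simple[OF step(1)]] W_P[OF W_simple[OF step(1)] step(5)]])
  show ?case
  proof (cases "1 \<le> cross u x \<gamma>")
    case True
    then show ?thesis using T_right_simple'[OF step(4,5,1)] right[OF step(1) Q] by simp
  next
    case False
    then have "T (u, x) = T (u \<circ> s \<gamma>, s \<gamma> x) * \<tau>' \<gamma>"
      using T_right_simple[OF step(4,5,1)] tau_inverse(1)[OF step(1)] by (simp add: mult.assoc flip: T_right_simple[OF step(4,5,1)])
    then show ?thesis using inverse[OF step(1) Q] by simp
  qed
qed

lemma T_finite_induct [consumes 1, case_names one step]: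
  assumes "w \<in> W" "Q 1" "\<And>h \<gamma>. \<gamma> \<in> \<Delta> \<Longrightarrow> Q h \<Longrightarrow> Q (h * \<tau> \<gamma>)"
  shows "Q (T (w, 0))"
  using assms(1)
proof (induct rule: W_right_induct)
  case id
  then show ?case using assms(2) by (simp only: T_one)
next
  case (step \<gamma> w)
  have "cross w 0 \<gamma> \<le> 0" using step(3) by (simp add: cross_def pairing_zero)
  from T_right_simple[OF step(2) P_zero step(1) this] have "T (w \<circ> s \<gamma>, 0) = T (w, 0) * \<tau> \<gamma>"
    using W_zero[OF W_simple[OF step(1)]] by (simp only:)
  then show ?case using assms(3)[OF step(1,4)] by (simp only:)
qed

lemma Th_central: assumes "f \<in> kPW" shows "Th f \<in> center"
proof -
  have tau: "Th f * \<tau> \<gamma> = \<tau> \<gamma> * Th f" if "\<gamma> \<in> \<Delta>" for \<gamma>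
    using Th_invariant_commute[OF that kPW_kP[OF assms] kPW_act[OF assms W_simple[OF that]]] by simp
  have tau': "Th f * \<tau>' \<gamma> = \<tau>' \<gamma> * Th f" if "\<gamma> \<in> \<Delta>" for \<gamma>
    by (rule commute_inverse[OF tau[OF that] tau_inverse[OF that]])
  have step: "Th f * (h * k) = h * k * Th f" if "Th f * h = h * Th f" "Th f * k = k * Th f" for h k
    using that by (rule commute_mult)
  have finite: "Th f * T (w, 0) = T (w, 0) * Th f" if "w \<in> W" for w
    using that by (induct rule: T_finite_induct[where Q = "\<lambda>h. Th f * h = h * Th f"]) (auto intro: step tau)
  have "Th f * h = h * Th f" for h
  proof (induct h rule: span_T_induct)
    case (T u x)
    then show ?case
    proof (induct rule: T_generate[where Q = "\<lambda>h. Th f * h = h * Th f"])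
      case (dominant w x)
      have "Th f * \<theta> x = \<theta> x * Th f"
        using Th_commute[OF kPW_kP[OF assms] kP_single[OF dominant(2), of 1]] by (simp add: Th_single)
      then show ?case using step finite[OF dominant(1)] by blast
    qed (auto intro: step tau tau' simp: scale_mult_left scale_mult_right)
  qed (simp_all add: distrib_left distrib_right scale_mult_left scale_mult_right)
  then show ?thesis by (simp add: center_def)
qed

text \<open>On \<open>c\<close> a factor \<open>\<tau> \<gamma>\<close> at the right end of
  \<open>h\<close> is a scalar, so \<open>T_generate\<close> reduces to a finite \<open>T\<close>
  times \<open>\<theta> x\<close>. The Bernstein relation moves the finite part to the right, where
  it becomes scalar again.\<close>

lemma left_module_generated_by_Th:
  assumes "\<And>\<gamma>. \<gamma> \<in> \<Delta> \<Longrightarrow> \<tau> \<gamma> * c = smul \<epsilon> c"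
  shows "\<exists>f\<in>kP. h * c = Th f * c"
proof -
  define M where "M h \<longleftrightarrow> (\<exists>f\<in>kP. h * c = Th f * c)" for h
  have add: "M (h + h')" if "M h" "M h'" for h h'
    using that unfolding M_def by (metis Th_add distrib_right kP_add)
  have scale: "M (smul a h)" if M: "M h" for a h
  proof -
    obtain f where f: "f \<in> kP" "h * c = Th f * c" using M unfolding M_def by blast
    have "smul a h * c = Th (Poly_Mapping.single 0 a * f) * c"
      by (simp add: Th_mult[OF kP_single[OF P_zero] f(1)] Th_single theta_zero scale_mult_left f(2))
    then show ?thesis unfolding M_def using kP_mult[OF kP_single[OF P_zero] f(1)] by blast
  qed
  have right: "M (h * \<tau> \<gamma>)" if "\<gamma> \<in> \<Delta>" "M h" for \<gamma> h
    using scale[OF that(2), of \<epsilon>] unfolding M_def by (simp add: mult.assoc assms[OF that(1)] scale_mult_left scale_mult_right)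
  have inverse: "M (h * \<tau>' \<gamma>)" if "\<gamma> \<in> \<Delta>" "M h" for \<gamma> h
  proof -
    have "h * \<tau>' \<gamma> = smul (inverse q) (h * \<tau> \<gamma> + smul (- (q - 1)) h)"
      by (simp add: T_simple_inverse_def scale_mult_right right_diff_distrib scale_left_diff_distrib)
    then show ?thesis using scale[OF add[OF right[OF that] scale[OF that(2)]]] by simp
  qed
  have tau_Th: "\<exists>g\<in>kP. \<tau> \<gamma> * (Th f * c) = Th g * c" if "\<gamma> \<in> \<Delta>" "f \<in> kP" for \<gamma> f
  proof -
    obtain d where d: "d \<in> kP" "\<tau> \<gamma> * Th f = Th (act (s \<gamma>) f) * \<tau> \<gamma> + smul (q - 1) (Th d)"
      using bernstein_kP[OF \<open>\<gamma> \<in> \<Delta>\<close> \<open>f \<in> kP\<close>] unfolding bernstein_def by blast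
    have s: "act (s \<gamma>) f \<in> kP" by (rule kP_act[OF W_simple[OF that(1)] that(2)])
    let ?g = "Poly_Mapping.single 0 \<epsilon> * act (s \<gamma>) f + Poly_Mapping.single 0 (q - 1) * d"
    have "\<tau> \<gamma> * (Th f * c) = Th (act (s \<gamma>) f) * (\<tau> \<gamma> * c) + smul (q - 1) (Th d) * c"
      by (simp add: d(2) distrib_right flip: mult.assoc)
    also have "\<dots> = Th ?g * c"
      by (simp add: assms[OF that(1)] Th_add Th_mult kP_single P_zero s d(1) Th_single theta_zero
          scale_mult_left scale_mult_right distrib_right)
    finally show ?thesis using s d(1) by (blast intro: kP_add kP_mult kP_single P_zero)
  qed
  have fin: "\<forall>f\<in>kP. \<exists>g\<in>kP. T (w, 0) * (Th f * c) = Th g * c" if "w \<in> W" for w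
    using that
  proof (induct rule: T_finite_induct[where Q = "\<lambda>h. \<forall>f\<in>kP. \<exists>g\<in>kP. h * (Th f * c) = Th g * c"])
    case one
    then show ?case by auto
  next
    case (step h \<gamma>)
    show ?case
    proof
      fix f :: "'v \<Rightarrow>\<^sub>0 'k" assume "f \<in> kP"
      then obtain g where g: "g \<in> kP" "\<tau> \<gamma> * (Th f * c) = Th g * c" using tau_Th[OF step(1)] by blast
      have "h * \<tau> \<gamma> * (Th f * c) = h * (Th g * c)" unfolding g(2)[symmetric] by (simp only: mult.assoc)
      then show "\<exists>g\<in>kP. h * \<tau> \<gamma> * (Th f * c) = Th g * c" using step(2) g(1) by simp
    qed
  qed
  have "M h"
  proof (induct h rule: span_T_induct)
    case zero
    then show ?case unfolding M_def using kP_zero by (intro bexI[of _ 0]) (simp_all add: Th_zero)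
  next
    case (add a h h')
    then show ?case using \<open>\<And>h' h. M h \<Longrightarrow> M h' \<Longrightarrow> M (h + h')\<close> scale by blast
  next
    case (T u x)
    then show ?case
    proof (induct rule: T_generate[where Q = M])
      case (dominant w x)
      have "mon x \<in> (kP :: ('v \<Rightarrow>\<^sub>0 'k) set)" by (rule kP_single[OF dominant(2)])
      then obtain g where "g \<in> kP" "T (w, 0) * (Th (mon x) * c) = Th g * c" using fin[OF dominant(1)] by blast
      then show ?case unfolding M_def by (intro bexI[of _ g]) (simp_all add: Th_single mult.assoc)
    qed (auto intro: right inverse scale)
  qed
  then show ?thesis by (simp add: M_def)
qed

end

section \<open>Cyclic modules over the central quotients\<close>

lemma ring_of_type: "ring (ring_of_type_algebra :: 'a::ring_1 ring)"
  by (rule ringI; (rule abelian_groupI monoidI)?)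
    (auto simp: ring_of_type_algebra_def add.assoc mult.assoc add.commute distrib_left distrib_right
      intro: exI[of _ "- x" for x] add.left_inverse)

text \<open>Here cosets and module operations are translated into membership of differences in
  \<open>I\<close>.\<close>

locale type_ring_ideal =
  fixes I :: "'h::ring_1 set"
  assumes ideal: "ideal I (ring_of_type_algebra :: 'h ring)"
begin

abbreviation "A \<equiv> (ring_of_type_algebra :: 'h ring)"
abbreviation "M \<equiv> quotient_module I"
abbreviation coset :: "'h \<Rightarrow> 'h set" where "coset \<equiv> image_in_quotient I"

sublocale ideal I A by (rule ideal)

lemma A_simps: "carrier A = UNIV" "x \<otimes>\<^bsub>A\<^esub> y = x * y" "x \<oplus>\<^bsub>A\<^esub> y = x + y" "\<zero>\<^bsub>A\<^esub> = 0" "\<one>\<^bsub>A\<^esub> = 1"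
  by (simp_all add: ring_of_type_algebra_def)

lemma mem_add: "a \<in> I \<Longrightarrow> b \<in> I \<Longrightarrow> a + b \<in> I"
  using additive_subgroup.a_closed[OF is_additive_subgroup, of a b] by (simp add: A_simps)

lemma mem_left: "a \<in> I \<Longrightarrow> h * a \<in> I" and mem_right: "a \<in> I \<Longrightarrow> a * h \<in> I"
  using I_l_closed[of a h] I_r_closed[of a h] by (simp_all add: A_simps)

lemma mem_zero: "0 \<in> I"
  using additive_subgroup.zero_closed[OF is_additive_subgroup] by (simp add: A_simps)

lemma mem_uminus: "a \<in> I \<Longrightarrow> - a \<in> I"
  using mem_left[of a "- 1"] by simp

lemma mem_diff: "a \<in> I \<Longrightarrow> b \<in> I \<Longrightarrow> a - b \<in> I"
  using mem_add[of a "- b"] mem_uminus[of b] by simp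

lemma mem_sum: "(\<And>i. i \<in> J \<Longrightarrow> f i \<in> I) \<Longrightarrow> sum f J \<in> I"
  by (induct J rule: infinite_finite_induct) (auto intro: mem_zero mem_add)

lemma mem_coset_iff: "z \<in> coset x \<longleftrightarrow> z - x \<in> I"
proof -
  have "coset x = (\<lambda>i. i + x) ` I"
    by (auto simp: image_in_quotient_def a_r_coset_def' A_simps)
  then show ?thesis by (force intro: image_eqI[of _ _ "z - x"])
qed

lemma coset_eq_iff: "coset x = coset y \<longleftrightarrow> x - y \<in> I"
proof
  assume "coset x = coset y"
  moreover have "x \<in> coset x" using mem_zero by (simp add: mem_coset_iff)
  ultimately show "x - y \<in> I" by (simp only: mem_coset_iff)
next
  assume d: "x - y \<in> I"
  show "coset x = coset y"
  proof (rule Set.set_eqI)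
    fix z
    have "z - y = (z - x) + (x - y)" "z - x = (z - y) - (x - y)" by simp_all
    then show "z \<in> coset x \<longleftrightarrow> z \<in> coset y"
      using mem_add[OF _ d, of "z - x"] mem_diff[OF _ d, of "z - y"] by (auto simp only: mem_coset_iff)
  qed
qed

lemma M_carrier: "carrier M = range coset"
  by (auto simp: quotient_module_def FactRing_def A_RCOSETS_def' A_simps image_in_quotient_def Let_def)

lemma M_add: "coset x \<oplus>\<^bsub>M\<^esub> coset y = coset (x + y)"
  using a_rcos_sum[of x y] by (simp add: quotient_module_def FactRing_def image_in_quotient_def A_simps Let_def)

lemma M_mult: "coset x \<otimes>\<^bsub>M\<^esub> coset y = coset (x * y)"
  using rcoset_mult_add[of x y] by (simp add: quotient_module_def FactRing_def image_in_quotient_def A_simps Let_def)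

lemma M_smult: "x \<odot>\<^bsub>M\<^esub> coset y = coset (x * y)"
  using rcoset_mult_add[of x y] by (simp add: quotient_module_def FactRing_def image_in_quotient_def A_simps Let_def)

lemma M_zero: "\<zero>\<^bsub>M\<^esub> = coset 0"
proof -
  have "coset 0 = I" by (auto simp: image_in_quotient_def a_r_coset_def' A_simps)
  then show ?thesis by (simp add: quotient_module_def FactRing_def Let_def)
qed

lemma coset_eq_zero_iff: "coset x = \<zero>\<^bsub>M\<^esub> \<longleftrightarrow> x \<in> I"
  by (simp add: M_zero coset_eq_iff)

lemma generated_eq: "generated_left_ideal M (coset c) = range (\<lambda>x. coset (x * c))"
  unfolding generated_left_ideal_def M_carrier M_mult[symmetric] by blast

lemma submodule_generated: "submodule (generated_left_ideal M (coset c)) A M"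
proof (intro submodule.intro subgroup.intro submodule_axioms.intro)
  let ?L = "generated_left_ideal M (coset c)"
  show "?L \<subseteq> carrier (add_monoid M)" by (auto simp: generated_eq M_carrier)
  show "x \<otimes>\<^bsub>add_monoid M\<^esub> y \<in> ?L" if "x \<in> ?L" "y \<in> ?L" for x y
    using that by (auto simp: generated_eq M_add simp flip: distrib_right)
  show "\<one>\<^bsub>add_monoid M\<^esub> \<in> ?L"
    unfolding generated_eq using rangeI[of "\<lambda>x. coset (x * c)" 0] by (simp add: M_zero)
  show "m_inv (add_monoid M) x \<in> ?L" if x: "x \<in> ?L" for x
  proof -
    obtain a where a: "x = coset (a * c)" using x by (auto simp: generated_eq)
    have "m_inv (add_monoid M) x = coset (- a * c)"
      unfolding m_inv_def
    proof (rule the_equality)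
      fix y assume y: "y \<in> carrier (add_monoid M) \<and> x \<otimes>\<^bsub>add_monoid M\<^esub> y = \<one>\<^bsub>add_monoid M\<^esub> \<and>
        y \<otimes>\<^bsub>add_monoid M\<^esub> x = \<one>\<^bsub>add_monoid M\<^esub>"
      then obtain b where b: "y = coset b" by (auto simp: M_carrier)
      have "a * c + b \<in> I" using y by (simp add: a b M_add coset_eq_zero_iff)
      then show "y = coset (- a * c)" by (simp add: b coset_eq_iff add.commute)
    qed (simp add: a M_carrier M_add M_zero)
    then show ?thesis unfolding generated_eq by blast
  qed
  show "h \<odot>\<^bsub>M\<^esub> x \<in> ?L" if "h \<in> carrier A" "x \<in> ?L" for h x
    using that by (auto simp: generated_eq M_smult simp flip: mult.assoc)
qed

text \<open>All elements of the generated module have the form \<open>h * c\<^sub>2\<close>. From a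
  nonzero one, left multiplication by some \<open>c\<^sub>1 * g\<close> returns the generator; so
  nonzero submodules contain the generator, and \<open>c\<^sub>1\<close> does not annihilate the
  module.\<close>

lemma irreducible_generated:
  assumes transitive: "\<And>h. h * c\<^sub>2 \<notin> I \<Longrightarrow> \<exists>g. c\<^sub>1 * (g * h) * c\<^sub>2 - c\<^sub>1 * t * c\<^sub>2 \<in> I"
    and nonzero: "coset (c\<^sub>1 * t * c\<^sub>2) \<noteq> \<zero>\<^bsub>M\<^esub>"
  defines "L \<equiv> generated_left_ideal M (coset (c\<^sub>1 * t * c\<^sub>2))"
  shows "irreducible_submodule A M L \<and> (\<exists>m\<in>L. c\<^sub>1 \<odot>\<^bsub>M\<^esub> m \<noteq> \<zero>\<^bsub>M\<^esub>)"
proof -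
  let ?m = "c\<^sub>1 * t * c\<^sub>2"
  have L_eq: "L = range (\<lambda>x. coset (x * ?m))" by (simp add: L_def generated_eq)
  have m_notin: "?m \<notin> I" using nonzero by (simp add: coset_eq_zero_iff)
  have m_L: "coset ?m \<in> L" unfolding L_eq using rangeI[of "\<lambda>x. coset (x * ?m)" 1] by simp
  have reach: "\<exists>g. coset (c\<^sub>1 * (g * (x * ?m))) = coset ?m" if notin: "x * ?m \<notin> I" for x
  proof -
    have e: "x * ?m = (x * c\<^sub>1 * t) * c\<^sub>2" by (simp only: mult.assoc)
    obtain g where "c\<^sub>1 * (g * (x * c\<^sub>1 * t)) * c\<^sub>2 - ?m \<in> I" using transitive notin unfolding e by blast
    moreover have "c\<^sub>1 * (g * (x * c\<^sub>1 * t)) * c\<^sub>2 = c\<^sub>1 * (g * (x * ?m))" by (simp only: mult.assoc)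
    ultimately show ?thesis by (auto simp: coset_eq_iff)
  qed
  have "N = {\<zero>\<^bsub>M\<^esub>} \<or> N = L" if N: "submodule N A M" "N \<subseteq> L" for N
  proof (cases "N = {\<zero>\<^bsub>M\<^esub>}")
    case False
    interpret N: submodule N A M by (rule N(1))
    have smult: "h \<odot>\<^bsub>M\<^esub> y \<in> N" if "y \<in> N" for h y using N.smult_closed[of h y] that by (simp add: A_simps)
    have "\<zero>\<^bsub>M\<^esub> \<in> N" using N.one_closed by simp
    then obtain y where y: "y \<in> N" "y \<noteq> \<zero>\<^bsub>M\<^esub>" using False by blast
    then obtain x where x: "y = coset (x * ?m)" using N(2) unfolding L_eq by blast
    obtain g where g: "coset (c\<^sub>1 * (g * (x * ?m))) = coset ?m"
      using reach[of x] y(2) by (auto simp: x coset_eq_zero_iff)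
    have "(c\<^sub>1 * g) \<odot>\<^bsub>M\<^esub> y \<in> N" by (rule smult[OF y(1)])
    then have m: "coset ?m \<in> N" unfolding x M_smult g[symmetric] by (simp only: mult.assoc)
    have "coset (a * ?m) \<in> N" for a using smult[OF m, of a] by (simp only: M_smult)
    then have "L \<subseteq> N" unfolding L_eq by blast
    then show ?thesis using N(2) by blast
  qed simp
  then have "irreducible_submodule A M L"
    unfolding irreducible_submodule_def using submodule_generated m_L nonzero by (auto simp: L_def)
  moreover obtain g where "coset (c\<^sub>1 * (g * (1 * ?m))) = coset ?m" using reach[of 1] m_notin by auto
  then have "c\<^sub>1 \<odot>\<^bsub>M\<^esub> coset (g * ?m) \<noteq> \<zero>\<^bsub>M\<^esub>" using nonzero by (simp add: M_smult)
  moreover have "coset (g * ?m) \<in> L" unfolding L_eq by blast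
  ultimately show ?thesis by blast
qed

end

section \<open>Factorisation of the two symmetrizers, and irreducibility\<close>

context affine_hecke_setup
begin

lemma T_finite_right:
  assumes "w \<in> W" "\<gamma> \<in> \<Delta>" "w \<gamma> \<in> pos"
  shows "T (w \<circ> s \<gamma>, 0) = T (w, 0) * \<tau> \<gamma>"
proof -
  have "cross w 0 \<gamma> \<le> 0" using assms(3) by (simp add: cross_def pairing_zero)
  from T_right_simple[OF assms(1) P_zero assms(2) this] show ?thesis
    using W_zero[OF W_simple[OF assms(2)]] by (simp only:)
qed

lemma card_inversions_left:
  assumes "w \<in> W" "\<gamma> \<in> \<Delta>" "inv w \<gamma> \<in> pos"
  shows "card (inversions (s \<gamma> \<circ> w)) = Suc (card (inversions w))"
proof -
  have "inv (s \<gamma> \<circ> w) = inv w \<circ> s \<gamma>"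
    using o_inv_distrib[OF W_bij[OF W_simple[OF assms(2)]] W_bij[OF assms(1)]] by (simp only: inv_reflection)
  then have "card (inversions (s \<gamma> \<circ> w)) = card (inversions (inv w \<circ> s \<gamma>))"
    using inversions_inv[OF W_comp[OF W_simple[OF assms(2)] assms(1)]] by (simp only:)
  also have "\<dots> = Suc (card (inversions w))"
    using card_inversions_simple[OF W_inv[OF assms(1)] assms(2)] assms(3) inversions_inv[OF assms(1)] by simp
  finally show ?thesis .
qed

lemma T_finite_left:
  assumes "w \<in> W" "\<gamma> \<in> \<Delta>" "inv w \<gamma> \<in> pos"
  shows "T (s \<gamma> \<circ> w, 0) = \<tau> \<gamma> * T (w, 0)"
proof -
  have "inv w 0 + 0 = 0" using W_zero[OF W_inv[OF assms(1)]] by simp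
  from T_prod[OF W_simple[OF assms(2)] assms(1) P_zero P_zero, unfolded this]
  show ?thesis
    using card_inversions_left[OF assms] lng_finite[OF assms(1)] lng_finite[OF W_comp[OF W_simple[OF assms(2)] assms(1)]]
      lng_simple[OF assms(2)] by simp
qed

lemma card_inversions_le: "card (inversions w) \<le> card pos"
  by (rule card_mono[OF finite_pos]) (auto simp: inversions_def)

text \<open>Pairing \<open>w\<close> with \<open>w \<circ> s \<gamma>\<close> yields the right
  factor, pairing it with \<open>s \<gamma> \<circ> w\<close> the left one: within a pair the
  lengths differ by 1 and the coefficients by the ratio \<open>\<kappa>\<close>. Lengths stop at
  \<open>card pos\<close>, hence the range of \<open>m\<close>.\<close>

lemma symmetrizer_factor:
  assumes "\<gamma> \<in> \<Delta>" and g: "\<And>m. m < card pos \<Longrightarrow> g (Suc m) = \<kappa> * g m"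
  defines "c \<equiv> \<Sum>w\<in>W. smul (g (card (inversions w))) (T (w, 0))"
  shows "\<exists>a. c = a * (1 + smul \<kappa> (\<tau> \<gamma>))" "\<exists>b. c = (1 + smul \<kappa> (\<tau> \<gamma>)) * b"
proof -
  let ?F = "\<lambda>w. smul (g (card (inversions w))) (T (w, 0))"
  have "c = (\<Sum>w\<in>{w \<in> W. w \<gamma> \<in> pos}. ?F w + ?F (w \<circ> s \<gamma>))"
    unfolding c_def
  proof (rule sum_involution_split[OF finite_W])
    show "w \<circ> s \<gamma> \<in> W" "(w \<circ> s \<gamma>) \<circ> s \<gamma> = w" "(w \<circ> s \<gamma>) \<gamma> \<in> pos \<longleftrightarrow> w \<gamma> \<notin> pos" if "w \<in> W" for w
      using that W_comp[OF that W_simple[OF assms(1)]] W_simple_neg[OF that assms(1)]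
      by (auto simp only: comp_assoc reflection_comp_self comp_id)
  qed
  also have "\<dots> = (\<Sum>w\<in>{w \<in> W. w \<gamma> \<in> pos}. ?F w * (1 + smul \<kappa> (\<tau> \<gamma>)))"
  proof (rule sum.cong[OF refl])
    fix w assume "w \<in> {w \<in> W. w \<gamma> \<in> pos}"
    then have w: "w \<in> W" "w \<gamma> \<in> pos" by auto
    have card: "card (inversions (w \<circ> s \<gamma>)) = Suc (card (inversions w))"
      using card_inversions_simple[OF w(1) assms(1)] w(2) by simp
    then have "g (card (inversions (w \<circ> s \<gamma>))) = \<kappa> * g (card (inversions w))"
      using g[of "card (inversions w)"] card_inversions_le[of "w \<circ> s \<gamma>"] by simp
    then show "?F w + ?F (w \<circ> s \<gamma>) = ?F w * (1 + smul \<kappa> (\<tau> \<gamma>))"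
      unfolding T_finite_right[OF w(1) assms(1) w(2)]
      by (simp add: distrib_left scale_mult_left scale_mult_right)
  qed
  finally have "c = (\<Sum>w\<in>{w \<in> W. w \<gamma> \<in> pos}. ?F w) * (1 + smul \<kappa> (\<tau> \<gamma>))"
    by (simp only: sum_distrib_right)
  then show "\<exists>a. c = a * (1 + smul \<kappa> (\<tau> \<gamma>))" by blast
  have "c = (\<Sum>w\<in>{w \<in> W. inv w \<gamma> \<in> pos}. ?F w + ?F (s \<gamma> \<circ> w))"
    unfolding c_def
  proof (rule sum_involution_split[OF finite_W])
    show "s \<gamma> \<circ> w \<in> W" "s \<gamma> \<circ> (s \<gamma> \<circ> w) = w" "inv (s \<gamma> \<circ> w) \<gamma> \<in> pos \<longleftrightarrow> inv w \<gamma> \<notin> pos" if "w \<in> W" for w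
      using that W_comp[OF W_simple[OF assms(1)] that] W_left_flip[OF that assms(1)]
      by (auto simp only: comp_assoc[symmetric] reflection_comp_self id_comp)
  qed
  also have "\<dots> = (\<Sum>w\<in>{w \<in> W. inv w \<gamma> \<in> pos}. (1 + smul \<kappa> (\<tau> \<gamma>)) * ?F w)"
  proof (rule sum.cong[OF refl])
    fix w assume "w \<in> {w \<in> W. inv w \<gamma> \<in> pos}"
    then have w: "w \<in> W" "inv w \<gamma> \<in> pos" by auto
    have "g (card (inversions (s \<gamma> \<circ> w))) = \<kappa> * g (card (inversions w))"
      using g[of "card (inversions w)"] card_inversions_le[of "s \<gamma> \<circ> w"] card_inversions_left[OF w(1) assms(1) w(2)]
      by simp
    then show "?F w + ?F (s \<gamma> \<circ> w) = (1 + smul \<kappa> (\<tau> \<gamma>)) * ?F w"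
      unfolding T_finite_left[OF w(1) assms(1) w(2)]
      by (simp add: distrib_right scale_mult_left scale_mult_right scale_right_distrib mult.commute[of \<kappa>])
  qed
  finally have "c = (1 + smul \<kappa> (\<tau> \<gamma>)) * (\<Sum>w\<in>{w \<in> W. inv w \<gamma> \<in> pos}. ?F w)"
    by (simp only: sum_distrib_left)
  then show "\<exists>b. c = (1 + smul \<kappa> (\<tau> \<gamma>)) * b" by blast
qed

abbreviation "C \<equiv> hecke_C smul R \<Delta> v T"
abbreviation "C' \<equiv> hecke_C' smul R \<Delta> q v T"

lemma lng_longest: "lng (longest_element R \<Delta>, 0) = card pos"
  using lng_finite[OF longest(1)] longest(2) by simp

lemma C_factor:
  assumes "\<gamma> \<in> \<Delta>"
  shows "\<exists>a. C = a * (1 + smul 1 (\<tau> \<gamma>))" "\<exists>b. C = (1 + smul 1 (\<tau> \<gamma>)) * b"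
proof -
  have "C = (\<Sum>w\<in>W. smul ((\<lambda>_. inverse v ^ card pos) (card (inversions w))) (T (w, 0)))"
    by (simp add: hecke_C_def lng_longest scale_sum_right)
  then show "\<exists>a. C = a * (1 + smul 1 (\<tau> \<gamma>))" "\<exists>b. C = (1 + smul 1 (\<tau> \<gamma>)) * b"
    using symmetrizer_factor[OF assms, of "\<lambda>_. inverse v ^ card pos" 1] by simp_all
qed

lemma C'_factor:
  assumes "\<gamma> \<in> \<Delta>"
  shows "\<exists>a. C' = a * (1 + smul (- inverse q) (\<tau> \<gamma>))" "\<exists>b. C' = (1 + smul (- inverse q) (\<tau> \<gamma>)) * b"
proof -
  define g where "g m = v ^ card pos * ((- 1) ^ (card pos - m) * inverse q ^ m)" for m
  have C': "C' = (\<Sum>w\<in>W. smul (g (card (inversions w))) (T (w, 0)))"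
    unfolding hecke_C'_def scale_sum_right by (rule sum.cong) (simp_all add: lng_longest lng_finite g_def)
  \<comment> \<open>The bound on \<open>m\<close> keeps the subtraction in the exponent of -1 from
    truncating.\<close>
  have step: "g (Suc m) = - inverse q * g m" if "m < card pos" for m
  proof -
    have "card pos - m = Suc (card pos - Suc m)" using that by simp
    then show ?thesis by (simp add: g_def)
  qed
  show "\<exists>a. C' = a * (1 + smul (- inverse q) (\<tau> \<gamma>))" "\<exists>b. C' = (1 + smul (- inverse q) (\<tau> \<gamma>)) * b"
    unfolding C' using symmetrizer_factor[where g = g and \<kappa> = "- inverse q", OF assms step] by blast+
qed

text \<open>Up to the scalar \<open>- inverse q\<close> both are the quadratic relation, with
  factors \<open>\<tau> \<gamma> + 1\<close> and \<open>\<tau> \<gamma> - smul q 1\<close>.\<close>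

lemma factor_orthogonal:
  assumes "\<gamma> \<in> \<Delta>"
  shows "(1 + smul 1 (\<tau> \<gamma>)) * (1 + smul (- inverse q) (\<tau> \<gamma>)) = 0"
    "(1 + smul (- inverse q) (\<tau> \<gamma>)) * (1 + smul 1 (\<tau> \<gamma>)) = 0"
  using T_reflection_relation(2)[OF simple_in_reflections[OF assms]] q_nonzero
  by (simp_all add: distrib_left distrib_right left_diff_distrib right_diff_distrib scale_mult_left scale_mult_right
      scale_right_distrib scale_left_diff_distrib scale_right_diff_distrib)

lemma tau_C: assumes "\<gamma> \<in> \<Delta>" shows "\<tau> \<gamma> * C = smul q C"
proof -
  obtain b where b: "C = (1 + smul 1 (\<tau> \<gamma>)) * b" using C_factor(2)[OF assms] by blast
  have "\<tau> \<gamma> * (1 + smul 1 (\<tau> \<gamma>)) = smul q (1 + smul 1 (\<tau> \<gamma>))"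
    using T_reflection_relation(2)[OF simple_in_reflections[OF assms]]
    by (simp add: distrib_left scale_right_distrib scale_left_diff_distrib)
  from arg_cong[OF this, of "\<lambda>h. h * b"] show ?thesis unfolding b by (simp only: mult.assoc scale_mult_left)
qed

lemma tau_C': assumes "\<gamma> \<in> \<Delta>" shows "\<tau> \<gamma> * C' = smul (- 1) C'"
proof -
  obtain b where b: "C' = (1 + smul (- inverse q) (\<tau> \<gamma>)) * b" using C'_factor(2)[OF assms] by blast
  have "\<tau> \<gamma> * (1 + smul (- inverse q) (\<tau> \<gamma>)) = smul (- 1) (1 + smul (- inverse q) (\<tau> \<gamma>))"
    using T_reflection_relation(2)[OF simple_in_reflections[OF assms]] q_nonzero
    by (simp add: distrib_left right_diff_distrib scale_mult_right scale_right_distrib scale_left_diff_distrib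
        scale_right_diff_distrib)
  from arg_cong[OF this, of "\<lambda>h. h * b"] show ?thesis unfolding b by (simp only: mult.assoc scale_mult_left)
qed

text \<open>
  The bilinear form \<open>(g, h) \<mapsto> c\<^sub>1 g h c\<^sub>2\<close> takes values in the centre times \<open>c\<^sub>1 \<theta>\<^sub>\<rho> c\<^sub>2\<close>, and dual bases of the
  group algebra make it nondegenerate on \<open>H c\<^sub>2\<close>.
\<close>

lemma perfect_pairing:
  assumes factor: "\<And>\<gamma>. \<gamma> \<in> \<Delta> \<Longrightarrow> \<exists>a \<mu> \<nu> b. c\<^sub>1 = a * (1 + smul \<mu> (\<tau> \<gamma>)) \<and> c\<^sub>2 = (1 + smul \<nu> (\<tau> \<gamma>)) * b \<and>
      (1 + smul \<mu> (\<tau> \<gamma>)) * (1 + smul \<nu> (\<tau> \<gamma>)) = 0"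
    and eigen: "\<And>\<gamma>. \<gamma> \<in> \<Delta> \<Longrightarrow> \<tau> \<gamma> * c\<^sub>2 = smul \<epsilon> c\<^sub>2"
  shows "\<exists>(n::nat) E F. \<forall>h. \<exists>z. (\<forall>i<n. z i \<in> center \<and> c\<^sub>1 * (E i * h) * c\<^sub>2 = z i * (c\<^sub>1 * \<theta> \<rho> * c\<^sub>2)) \<and>
    h * c\<^sub>2 = (\<Sum>i<n. z i * F i) * c\<^sub>2"
proof -
  define \<Phi> where "\<Phi> f = c\<^sub>1 * Th f * c\<^sub>2" for f
  have add: "\<Phi> (f + g) = \<Phi> f + \<Phi> g" for f g by (simp add: \<Phi>_def Th_add distrib_left distrib_right)
  \<comment> \<open>\<open>Th f\<close> commutes with the right factor of \<open>c\<^sub>1\<close>,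
    which then meets the left factor of \<open>c\<^sub>2\<close> and annihilates it.\<close>
  have inv: "\<Phi> f = 0" if f: "f \<in> kP" "\<gamma> \<in> \<Delta>" "act (s \<gamma>) f = f" for f \<gamma>
  proof -
    obtain a \<mu> \<nu> b where ab: "c\<^sub>1 = a * (1 + smul \<mu> (\<tau> \<gamma>))" "c\<^sub>2 = (1 + smul \<nu> (\<tau> \<gamma>)) * b"
      "(1 + smul \<mu> (\<tau> \<gamma>)) * (1 + smul \<nu> (\<tau> \<gamma>)) = 0" using factor[OF f(2)] by blast
    have comm: "(1 + smul \<mu> (\<tau> \<gamma>)) * Th f = Th f * (1 + smul \<mu> (\<tau> \<gamma>))"
      using Th_invariant_commute[OF f(2,1,3)] by (simp add: distrib_left distrib_right scale_mult_left scale_mult_right)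
    have "\<Phi> f = a * ((1 + smul \<mu> (\<tau> \<gamma>)) * Th f) * (1 + smul \<nu> (\<tau> \<gamma>)) * b"
      unfolding \<Phi>_def ab(1,2) by (simp only: mult.assoc)
    also have "\<dots> = a * Th f * ((1 + smul \<mu> (\<tau> \<gamma>)) * (1 + smul \<nu> (\<tau> \<gamma>))) * b"
      unfolding comm by (simp only: mult.assoc)
    finally show ?thesis by (simp only: ab(3) mult_zero_right mult_zero_left)
  qed
  have anti: "\<Phi> (act (s \<gamma>) f) = - \<Phi> f" if "f \<in> kP" "\<gamma> \<in> \<Delta>" for f \<gamma>
  proof -
    \<comment> \<open>The sum is fixed by \<open>s \<gamma>\<close>, so antisymmetry is an instance
      of the vanishing just shown, as is the vanishing on singular weights.\<close>
    have "\<Phi> (act (s \<gamma>) f + f) = 0"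
      using that kP_act[OF W_simple[OF that(2)] that(1)]
      by (intro inv[OF kP_add that(2)]) (simp_all add: act_add act_reflection_involution add.commute)
    then show ?thesis by (simp add: add eq_neg_iff_add_eq_0)
  qed
  have sing: "\<Phi> (Poly_Mapping.single x c) = 0" if "x \<in> P" "\<gamma> \<in> \<Delta>" "s \<gamma> x = x" for x c \<gamma>
    using that by (intro inv[OF kP_single that(2)]) (simp_all add: act_single)
  have quotient: "\<Phi> f = Th p * (c\<^sub>1 * \<theta> \<rho> * c\<^sub>2)" if f: "f \<in> kP" and p: "p \<in> kPW" "alternator f = p * alternator (mon \<rho>)" for f p
  proof -
    have rP: "mon \<rho> \<in> kP" by (rule kP_single[OF rho_in_P])
    have pr: "p * mon \<rho> \<in> kP" by (rule kP_mult[OF kPW_kP[OF p(1)] rP])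
    \<comment> \<open>\<open>f\<close> and \<open>p * mon \<rho>\<close> have the same alternating
      sum, so by \<open>antisymmetric_vanish\<close> the functional \<open>\<Phi>\<close> takes the
      same value on both.\<close>
    have "alternator (f + - (p * mon \<rho>)) = 0"
      by (simp only: alternator_add alternator_uminus alternator_invariant_mult[OF p(1)] p(2) right_minus)
    from antisymmetric_vanish[of \<Phi>, OF add anti sing kP_add[OF f kP_uminus[OF pr]] this]
    have "\<Phi> f + \<Phi> (- (p * mon \<rho>)) = 0" by (simp only: add)
    then have "\<Phi> f = \<Phi> (p * mon \<rho>)" by (simp add: \<Phi>_def Th_uminus eq_neg_iff_add_eq_0)
    also have "\<dots> = c\<^sub>1 * Th p * \<theta> \<rho> * c\<^sub>2"
      by (simp add: \<Phi>_def Th_mult[OF kPW_kP[OF p(1)] rP] Th_single mult.assoc)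
    also have "c\<^sub>1 * Th p = Th p * c\<^sub>1" using Th_central[OF p(1)] by (simp add: center_def)
    finally show ?thesis by (simp only: mult.assoc)
  qed
  obtain n :: nat and e F :: "nat \<Rightarrow> 'v \<Rightarrow>\<^sub>0 'k" where eF: "\<And>i. i < n \<Longrightarrow> e i \<in> kP" "\<And>i. i < n \<Longrightarrow> F i \<in> kP"
    and dual: "\<And>f p. f \<in> kP \<Longrightarrow> (\<And>i. i < n \<Longrightarrow> alternator (f * e i) = p i * alternator (mon \<rho>)) \<Longrightarrow> f = (\<Sum>i<n. p i * F i)"
    using dual_basis[where 'k = 'k] by blast
  have *: "\<exists>z. (\<forall>i<n. z i \<in> center \<and> c\<^sub>1 * (Th (e i) * h) * c\<^sub>2 = z i * (c\<^sub>1 * \<theta> \<rho> * c\<^sub>2)) \<and>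
      h * c\<^sub>2 = (\<Sum>i<n. z i * Th (F i)) * c\<^sub>2" for h
  proof -
    obtain f where f: "f \<in> kP" "h * c\<^sub>2 = Th f * c\<^sub>2" using left_module_generated_by_Th[OF eigen] by blast
    have "\<forall>i. \<exists>p. i < n \<longrightarrow> p \<in> kPW \<and> alternator (f * e i) = p * alternator (mon \<rho>)"
      using alternator_quotient[OF kP_mult[OF f(1) eF(1)]] by blast
    then obtain p where p: "\<And>i. i < n \<Longrightarrow> p i \<in> kPW \<and> alternator (f * e i) = p i * alternator (mon \<rho>)" by metis
    \<comment> \<open>The dual basis expands \<open>f\<close> with exactly the coefficients that the
      pairing with the \<open>e i\<close> produces, so one family \<open>z\<close> serves both
      claims.\<close>
    have f_eq: "f = (\<Sum>i<n. p i * F i)" using dual[OF f(1)] p by blast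
    have "c\<^sub>1 * (Th (e i) * h) * c\<^sub>2 = Th (p i) * (c\<^sub>1 * \<theta> \<rho> * c\<^sub>2)" if i: "i < n" for i
    proof -
      have "c\<^sub>1 * (Th (e i) * h) * c\<^sub>2 = c\<^sub>1 * Th (e i) * (h * c\<^sub>2)" by (simp only: mult.assoc)
      also have "\<dots> = c\<^sub>1 * (Th (e i) * Th f) * c\<^sub>2" unfolding f(2) by (simp only: mult.assoc)
      also have "Th (e i) * Th f = Th (f * e i)" using Th_mult[OF eF(1)[OF i] f(1)] by (simp add: mult.commute)
      finally show ?thesis
        using quotient[OF kP_mult[OF f(1) eF(1)[OF i]]] p[OF i] by (simp add: \<Phi>_def)
    qed
    then have A: "\<forall>i<n. Th (p i) \<in> center \<and> c\<^sub>1 * (Th (e i) * h) * c\<^sub>2 = Th (p i) * (c\<^sub>1 * \<theta> \<rho> * c\<^sub>2)"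
      using p Th_central by blast
    have mult: "Th (p i * F i) = Th (p i) * Th (F i)" if "i < n" for i
      using Th_mult[OF kPW_kP eF(2)[OF that]] p[OF that] by blast
    have "Th f = (\<Sum>i<n. Th (p i * F i))" by (subst f_eq) (rule Th_sum)
    also have "\<dots> = (\<Sum>i<n. Th (p i) * Th (F i))" by (rule sum.cong) (simp_all add: mult)
    finally have "h * c\<^sub>2 = (\<Sum>i<n. Th (p i) * Th (F i)) * c\<^sub>2"
      by (rule trans[OF f(2) arg_cong[where f = "\<lambda>g. g * c\<^sub>2"]])
    with A show ?thesis by (intro exI[of _ "\<lambda>i. Th (p i)"] conjI)
  qed
  show ?thesis by (rule exI[of _ n], rule exI[of _ "\<lambda>i. Th (e i)"], rule exI[of _ "\<lambda>i. Th (F i)"], rule allI, rule *)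
qed

lemma central_ideal_ideal: "ideal (central_ideal smul R \<Delta> v T \<psi>) (ring_of_type_algebra :: 'h ring)"
  unfolding central_ideal_def
  by (rule ring.genideal_ideal[OF ring_of_type]) (simp add: ring_of_type_algebra_def)

lemma central_ideal_generator:
  assumes "z \<in> center"
  shows "z - smul (phi smul R \<Delta> v T \<psi> z) 1 \<in> central_ideal smul R \<Delta> v T \<psi>"
  unfolding central_ideal_def
  by (rule subsetD[OF ring.genideal_self[OF ring_of_type]]) (use assms in \<open>auto simp: ring_of_type_algebra_def\<close>)

text \<open>Stated for a pair of abstract elements, so that exchanging \<open>C\<close> and
  \<open>C'\<close> gives both halves of the theorem.\<close>

lemma irreducible_if_paired:
  fixes \<psi> :: "'v \<Rightarrow> 'k"
  assumes factor: "\<And>\<gamma>. \<gamma> \<in> \<Delta> \<Longrightarrow> \<exists>a \<mu> \<nu> b. c\<^sub>1 = a * (1 + smul \<mu> (\<tau> \<gamma>)) \<and> c\<^sub>2 = (1 + smul \<nu> (\<tau> \<gamma>)) * b \<and>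
      (1 + smul \<mu> (\<tau> \<gamma>)) * (1 + smul \<nu> (\<tau> \<gamma>)) = 0"
    and eigen: "\<And>\<gamma>. \<gamma> \<in> \<Delta> \<Longrightarrow> \<tau> \<gamma> * c\<^sub>2 = smul \<epsilon> c\<^sub>2"
  defines "I \<equiv> central_ideal smul R \<Delta> v T \<psi>"
  defines "M \<equiv> quotient_module I"
  defines "L \<equiv> generated_left_ideal M (image_in_quotient I (c\<^sub>1 * \<theta> \<rho> * c\<^sub>2))"
  assumes "image_in_quotient I (c\<^sub>1 * \<theta> \<rho> * c\<^sub>2) \<noteq> \<zero>\<^bsub>M\<^esub>"
  shows "irreducible_submodule (ring_of_type_algebra :: 'h ring) M L \<and> (\<exists>m\<in>L. c\<^sub>1 \<odot>\<^bsub>M\<^esub> m \<noteq> \<zero>\<^bsub>M\<^esub>)"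
proof -
  interpret I: type_ring_ideal I
    by (rule type_ring_ideal.intro) (unfold I_def, rule central_ideal_ideal)
  let ?m = "c\<^sub>1 * \<theta> \<rho> * c\<^sub>2"
  define \<phi> where "\<phi> = phi smul R \<Delta> v T \<psi>"
  have gen: "z - smul (\<phi> z) 1 \<in> I" if "z \<in> center" for z
    unfolding I_def \<phi>_def by (rule central_ideal_generator[OF that])
  obtain n :: nat and E F where EF: "\<And>h. \<exists>z. (\<forall>i<n. z i \<in> center \<and> c\<^sub>1 * (E i * h) * c\<^sub>2 = z i * ?m) \<and>
      h * c\<^sub>2 = (\<Sum>i<n. z i * F i) * c\<^sub>2"
    using perfect_pairing[OF factor eigen] by blast
  have "\<exists>g. c\<^sub>1 * (g * h) * c\<^sub>2 - ?m \<in> I" if h: "h * c\<^sub>2 \<notin> I" for h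
  proof -
    obtain z where z: "\<And>i. i < n \<Longrightarrow> z i \<in> center" "\<And>i. i < n \<Longrightarrow> c\<^sub>1 * (E i * h) * c\<^sub>2 = z i * ?m"
      "h * c\<^sub>2 = (\<Sum>i<n. z i * F i) * c\<^sub>2" using EF by blast
    have "\<exists>i<n. \<phi> (z i) \<noteq> 0"
    proof (rule ccontr)
      assume "\<not> ?thesis"
      \<comment> \<open>A central element whose scalar is zero is itself a generator of the ideal,
        so the whole expansion of \<open>h * c\<^sub>2\<close> would lie in it.\<close>
      then have "z i \<in> I" if "i < n" for i using gen[OF z(1)[OF that]] that by simp
      then have "(\<Sum>i<n. z i * F i) * c\<^sub>2 \<in> I" by (intro I.mem_right I.mem_sum) simp
      then show False using h z(3) by simp
    qed
    then obtain i where i: "i < n" "\<phi> (z i) \<noteq> 0" by blast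
    define k where "k = inverse (\<phi> (z i))"
    have "c\<^sub>1 * (smul k (E i) * h) * c\<^sub>2 - ?m = smul k (z i * ?m) - smul (k * \<phi> (z i)) ?m"
      using i(2) by (simp add: scale_mult_left scale_mult_right z(2)[OF i(1)] k_def)
    also have "\<dots> = smul k ((z i - smul (\<phi> (z i)) 1) * ?m)"
      by (simp add: left_diff_distrib scale_right_diff_distrib scale_mult_left)
    also have "\<dots> = smul k 1 * ((z i - smul (\<phi> (z i)) 1) * ?m)" by (simp only: scale_mult_left mult_1_left)
    also have "\<dots> \<in> I" by (intro I.mem_left I.mem_right gen z(1) i(1))
    finally show ?thesis by blast
  qed
  from I.irreducible_generated[OF this] assms(6) show ?thesis unfolding M_def L_def by blast
qed

end

theorem theorem4p1:
  fixes R \<Delta> :: "'v::euclidean_space set"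
    and q v :: "'k::alg_closed_field"
    and smul :: "'k \<Rightarrow> 'h::ring_1 \<Rightarrow> 'h"
    and T :: "('v \<Rightarrow> 'v) \<times> 'v \<Rightarrow> 'h"
    and G Tor :: "('k ^ 'n ^ 'n) set"
    and \<iota> :: "'v \<Rightarrow> 'k ^ 'n ^ 'n \<Rightarrow> 'k"
    and t :: "'k ^ 'n ^ 'n"
  assumes "irreducible_root_system R"
    and "simple_roots R \<Delta>"
    and "q \<noteq> 0"
    and "v ^ 2 = q"
    and "affine_hecke_algebra smul R \<Delta> q T"
    and "simply_connected_simple_group R G Tor \<iota>"
    and "t \<in> Tor"
  shows "let C = hecke_C smul R \<Delta> v T;
             C' = hecke_C' smul R \<Delta> q v T;
             \<theta>\<^sub>\<rho> = theta smul R \<Delta> v T (rho \<Delta>);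
             Z\<^sub>t = central_ideal smul R \<Delta> v T (\<lambda>x. \<iota> x t);
             H\<^sub>t = quotient_module Z\<^sub>t;
             c = image_in_quotient Z\<^sub>t (C * \<theta>\<^sub>\<rho> * C');
             c' = image_in_quotient Z\<^sub>t (C' * \<theta>\<^sub>\<rho> * C);
             L\<^sub>t = generated_left_ideal H\<^sub>t c;
             L'\<^sub>t = generated_left_ideal H\<^sub>t c'
         in (c \<noteq> \<zero>\<^bsub>H\<^sub>t\<^esub> \<longrightarrow>
               irreducible_submodule (ring_of_type_algebra :: 'h ring) H\<^sub>t L\<^sub>t \<and>
               (\<exists>m\<in>L\<^sub>t. C \<odot>\<^bsub>H\<^sub>t\<^esub> m \<noteq> \<zero>\<^bsub>H\<^sub>t\<^esub>)) \<and>
            (c' \<noteq> \<zero>\<^bsub>H\<^sub>t\<^esub> \<longrightarrow>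
               irreducible_submodule (ring_of_type_algebra :: 'h ring) H\<^sub>t L'\<^sub>t \<and>
               (\<exists>m\<in>L'\<^sub>t. C' \<odot>\<^bsub>H\<^sub>t\<^esub> m \<noteq> \<zero>\<^bsub>H\<^sub>t\<^esub>))"
proof -
  interpret affine_hecke_setup smul R \<Delta> q T v
    by (intro affine_hecke_setup.intro irreducible_based_root_system.intro based_root_system.intro
        irreducible_based_root_system_axioms.intro affine_hecke_setup_axioms.intro)
      (use assms in \<open>auto simp: irreducible_root_system_def\<close>)
  have CC': "\<exists>a \<mu> \<nu> b. C = a * (1 + smul \<mu> (\<tau> \<gamma>)) \<and> C' = (1 + smul \<nu> (\<tau> \<gamma>)) * b \<and>
      (1 + smul \<mu> (\<tau> \<gamma>)) * (1 + smul \<nu> (\<tau> \<gamma>)) = 0" if "\<gamma> \<in> \<Delta>" for \<gamma>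
    using C_factor(1)[OF that] C'_factor(2)[OF that] factor_orthogonal(1)[OF that] by blast
  have C'C: "\<exists>a \<mu> \<nu> b. C' = a * (1 + smul \<mu> (\<tau> \<gamma>)) \<and> C = (1 + smul \<nu> (\<tau> \<gamma>)) * b \<and>
      (1 + smul \<mu> (\<tau> \<gamma>)) * (1 + smul \<nu> (\<tau> \<gamma>)) = 0" if "\<gamma> \<in> \<Delta>" for \<gamma>
    using C'_factor(1)[OF that] C_factor(2)[OF that] factor_orthogonal(2)[OF that] by blast
  show ?thesis
    unfolding Let_def
    using irreducible_if_paired[OF CC' tau_C'] irreducible_if_paired[OF C'C tau_C] by blast
qed

end
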